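(* For an $(n,k)$-Buyer-Seller instance, the transaction matrix $\mathbf{C}$, the transaction price matrix $P$ and the transaction reserve matrix $R$ can all be determined in $O(n\sqrt{k\, M(n,k)})$ time, where $M(n,k)$ is the time required to multiply an $n\times k$ matrix by a $k\times n$ matrix.
   Context: An $(n,k)$-Buyer-Seller instance consists of a set $C=\{1,\ldots, k\}$ of commodities; an $n$-tuple of buyers $b_1,\ldots,b_n$ with $b_i=(B_i,p_i)$, where $B_i\subseteq C$ are the commodities desired by buyer $i$ and $p_i: B_i\rightarrow \mathbb{R}^{+}$ is buyer $i$'s maximum price function; and an $n$-tuple of sellers $s_1,\ldots,s_n$ with $s_j=(S_j,v_j)$, where $S_j\subseteq C$ are the commodities owned by seller $j$ and $v_j: S_j\rightarrow \mathbb{R}^{+}$ is seller $j$'s reserve price function. For a buyer $i$ and seller $j$ the transaction set is $C_{ij}=\{l : l\in B_i\cap S_j,\ p_i(l)\geq v_j(l)\}$; the transaction matrix $\mathbf{C}$ has entries $|C_{ij}|$; the price matrix $P$ has entries $P_{ij}=\sum_{l\in C_{ij}} p_i(l)$; the reserve matrix $R$ has entries $R_{ij}=\sum_{l\in C_{ij}} v_j(l)$. *)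

theory Defs
  imports "Jordan_Normal_Form.Matrix" "HOL-Library.Landau_Symbols"
begin

section \<open>Buyer-Seller instances\<close>

text \<open>A trader is a pair of a set of commodities and a price function on that set; the price
  function is total here, but no definition below looks at its values outside the set.
  Buyers, sellers and commodities are numbered from 0, as are rows and columns of matrices.\<close>

type_synonym trader = "nat set \<times> (nat \<Rightarrow> real)"

definition trader_on :: "nat \<Rightarrow> trader \<Rightarrow> bool" where
  "trader_on k a \<longleftrightarrow> fst a \<subseteq> {..<k} \<and> (\<forall>l\<in>fst a. 0 < snd a l)"

definition buyer_seller_instance ::
    "nat \<Rightarrow> nat \<Rightarrow> (nat \<Rightarrow> trader) \<Rightarrow> (nat \<Rightarrow> trader) \<Rightarrow> bool" where
  "buyer_seller_instance n k b s \<longleftrightarrow> (\<forall>i<n. trader_on k (b i)) \<and> (\<forall>j<n. trader_on k (s j))"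

definition transaction_set :: "trader \<Rightarrow> trader \<Rightarrow> nat set" where
  "transaction_set b s = {l \<in> fst b \<inter> fst s. snd b l \<ge> snd s l}"

definition transaction_matrix ::
    "nat \<Rightarrow> (nat \<Rightarrow> trader) \<Rightarrow> (nat \<Rightarrow> trader) \<Rightarrow> nat mat" where
  "transaction_matrix n b s = mat n n (\<lambda>(i, j). card (transaction_set (b i) (s j)))"

definition price_matrix ::
    "nat \<Rightarrow> (nat \<Rightarrow> trader) \<Rightarrow> (nat \<Rightarrow> trader) \<Rightarrow> real mat" where
  "price_matrix n b s = mat n n (\<lambda>(i, j). \<Sum>l\<in>transaction_set (b i) (s j). snd (b i) l)"

definition reserve_matrix ::
    "nat \<Rightarrow> (nat \<Rightarrow> trader) \<Rightarrow> (nat \<Rightarrow> trader) \<Rightarrow> real mat" where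
  "reserve_matrix n b s = mat n n (\<lambda>(i, j). \<Sum>l\<in>transaction_set (b i) (s j). snd (s j) l)"


section \<open>Programs and running time\<close>

text \<open>The model of computation is a real RAM, presented as a while language. A program uses
  finitely many named arrays of natural numbers (for indices and addresses) and finitely many
  named arrays of reals; a scalar variable is cell 0 of an array. Every operation, array access,
  assignment and branch costs one unit.

  Two restrictions keep the unit cost meaningful: natural numbers are only added and subtracted
  (truncating at 0), so that unit-cost index arithmetic cannot be used to pack data into long
  numbers and multiply them, and reals influence natural numbers only through comparisons
  (there is no floor). The only real constants are 0 and 1.\<close>

type_synonym name = string

record state =
  nats :: "name \<Rightarrow> nat \<Rightarrow> nat"
  reals :: "name \<Rightarrow> nat \<Rightarrow> real"

datatype nexp = NConst nat | NRead name nexp | NAdd nexp nexp | NSub nexp nexp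

datatype rexp = RZero | ROne | RRead name nexp
  | RAdd rexp rexp | RSub rexp rexp | RMul rexp rexp | RDiv rexp rexp

datatype bexp = NLess nexp nexp | RLess rexp rexp | BNot bexp | BAnd bexp bexp

datatype com = Skip
  | NAssign name nexp nexp
  | RAssign name nexp rexp
  | Seq com com
  | Cond bexp com com
  | Loop bexp com

fun nval :: "nexp \<Rightarrow> state \<Rightarrow> nat" where
  "nval (NConst m) s = m"
| "nval (NRead x e) s = nats s x (nval e s)"
| "nval (NAdd e f) s = nval e s + nval f s"
| "nval (NSub e f) s = nval e s - nval f s"

fun rval :: "rexp \<Rightarrow> state \<Rightarrow> real" where
  "rval RZero s = 0"
| "rval ROne s = 1"
| "rval (RRead x e) s = reals s x (nval e s)"
| "rval (RAdd e f) s = rval e s + rval f s"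
| "rval (RSub e f) s = rval e s - rval f s"
| "rval (RMul e f) s = rval e s * rval f s"
| "rval (RDiv e f) s = rval e s / rval f s"

fun bval :: "bexp \<Rightarrow> state \<Rightarrow> bool" where
  "bval (NLess e f) s \<longleftrightarrow> nval e s < nval f s"
| "bval (RLess e f) s \<longleftrightarrow> rval e s < rval f s"
| "bval (BNot b) s \<longleftrightarrow> \<not> bval b s"
| "bval (BAnd b c) s \<longleftrightarrow> bval b s \<and> bval c s"

fun ncost :: "nexp \<Rightarrow> nat" where
  "ncost (NConst m) = 1"
| "ncost (NRead x e) = 1 + ncost e"
| "ncost (NAdd e f) = 1 + ncost e + ncost f"
| "ncost (NSub e f) = 1 + ncost e + ncost f"

fun rcost :: "rexp \<Rightarrow> nat" where
  "rcost RZero = 1"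
| "rcost ROne = 1"
| "rcost (RRead x e) = 1 + ncost e"
| "rcost (RAdd e f) = 1 + rcost e + rcost f"
| "rcost (RSub e f) = 1 + rcost e + rcost f"
| "rcost (RMul e f) = 1 + rcost e + rcost f"
| "rcost (RDiv e f) = 1 + rcost e + rcost f"

fun bcost :: "bexp \<Rightarrow> nat" where
  "bcost (NLess e f) = 1 + ncost e + ncost f"
| "bcost (RLess e f) = 1 + rcost e + rcost f"
| "bcost (BNot b) = 1 + bcost b"
| "bcost (BAnd b c) = 1 + bcost b + bcost c"

definition nat_update :: "name \<Rightarrow> nat \<Rightarrow> nat \<Rightarrow> state \<Rightarrow> state" where
  "nat_update x i m s = s\<lparr>nats := (nats s)(x := (nats s x)(i := m))\<rparr>"

definition real_update :: "name \<Rightarrow> nat \<Rightarrow> real \<Rightarrow> state \<Rightarrow> state" where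
  "real_update x i r s = s\<lparr>reals := (reals s)(x := (reals s x)(i := r))\<rparr>"

text \<open>\<open>exec c s t s'\<close>: started in \<open>s\<close>, the program \<open>c\<close> terminates in \<open>s'\<close> after time \<open>t\<close>.\<close>

inductive exec :: "com \<Rightarrow> state \<Rightarrow> nat \<Rightarrow> state \<Rightarrow> bool" where
  Skip: "exec Skip s 1 s"
| NAssign: "exec (NAssign x e f) s (1 + ncost e + ncost f) (nat_update x (nval e s) (nval f s) s)"
| RAssign: "exec (RAssign x e f) s (1 + ncost e + rcost f) (real_update x (nval e s) (rval f s) s)"
| Seq: "exec c s t s' \<Longrightarrow> exec d s' u s'' \<Longrightarrow> exec (Seq c d) s (t + u) s''"
| Cond_True: "bval b s \<Longrightarrow> exec c s t s' \<Longrightarrow> exec (Cond b c d) s (1 + bcost b + t) s'"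
| Cond_False: "\<not> bval b s \<Longrightarrow> exec d s t s' \<Longrightarrow> exec (Cond b c d) s (1 + bcost b + t) s'"
| Loop_False: "\<not> bval b s \<Longrightarrow> exec (Loop b c) s (1 + bcost b) s"
| Loop_True: "bval b s \<Longrightarrow> exec c s t s' \<Longrightarrow> exec (Loop b c) s' u s''
    \<Longrightarrow> exec (Loop b c) s (1 + bcost b + t + u) s''"


section \<open>The two computational problems\<close>

text \<open>Row-major storage of a matrix in an array of reals.\<close>

definition holds_matrix :: "state \<Rightarrow> name \<Rightarrow> real mat \<Rightarrow> bool" where
  "holds_matrix s x A \<longleftrightarrow>
     (\<forall>i<dim_row A. \<forall>j<dim_col A. reals s x (i * dim_col A + j) = A $$ (i, j))"

text \<open>The traders \<open>a 0, \<dots>, a (n - 1)\<close> are given by an \<open>n \<times> k\<close> membership table and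
  an \<open>n \<times> k\<close> table of prices; a price cell is meaningful only where the commodity is traded.\<close>

definition holds_traders ::
    "state \<Rightarrow> name \<Rightarrow> name \<Rightarrow> nat \<Rightarrow> nat \<Rightarrow> (nat \<Rightarrow> trader) \<Rightarrow> bool" where
  "holds_traders s x y n k a \<longleftrightarrow>
     (\<forall>i<n. \<forall>l<k. nats s x (i * k + l) = (if l \<in> fst (a i) then 1 else 0) \<and>
        (l \<in> fst (a i) \<longrightarrow> reals s y (i * k + l) = snd (a i) l))"

definition holds_sizes :: "state \<Rightarrow> nat \<Rightarrow> nat \<Rightarrow> bool" where
  "holds_sizes s n k \<longleftrightarrow> nats s ''n'' 0 = n \<and> nats s ''k'' 0 = k"

text \<open>In both problems one program handles all sizes, and the memory that does not hold the
  input has arbitrary initial contents.\<close>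

definition multiplies_within :: "com \<Rightarrow> (nat \<Rightarrow> nat \<Rightarrow> real) \<Rightarrow> bool" where
  "multiplies_within c T \<longleftrightarrow>
     (\<forall>n\<ge>1. \<forall>k\<ge>1. \<forall>A\<in>carrier_mat n k. \<forall>B\<in>carrier_mat k n. \<forall>s.
        holds_sizes s n k \<and> holds_matrix s ''A'' A \<and> holds_matrix s ''B'' B \<longrightarrow>
        (\<exists>t s'. exec c s t s' \<and> real t \<le> T n k \<and> holds_matrix s' ''AB'' (A * B)))"

definition determines_transactions_within :: "com \<Rightarrow> (nat \<Rightarrow> nat \<Rightarrow> real) \<Rightarrow> bool" where
  "determines_transactions_within c T \<longleftrightarrow>
     (\<forall>n\<ge>1. \<forall>k\<ge>1. \<forall>buyers sellers. \<forall>s.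
        buyer_seller_instance n k buyers sellers \<and> holds_sizes s n k \<and>
        holds_traders s ''buyer_goods'' ''max_price'' n k buyers \<and>
        holds_traders s ''seller_goods'' ''reserve_price'' n k sellers \<longrightarrow>
        (\<exists>t s'. exec c s t s' \<and> real t \<le> T n k \<and>
           holds_matrix s' ''C'' (map_mat real (transaction_matrix n buyers sellers)) \<and>
           holds_matrix s' ''P'' (price_matrix n buyers sellers) \<and>
           holds_matrix s' ''R'' (reserve_matrix n buyers sellers)))"

end

theory Submission
  imports Defs "HOL-Library.Countable"
begin

text \<open>
  For each commodity, sort the \<open>2n\<close> prices and cut the sorted list into buckets of \<open>w\<close> entries.
  A buyer and a seller in the same bucket are compared directly, at a total cost of \<open>O(nkw)\<close>.
  For each bucket, the pairs of a buyer in it and a seller in an earlier bucket are summed over all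
  commodities at once by a single matrix product, at a total cost of \<open>O((n/w) M(n,k))\<close>. The two
  costs balance at \<open>w = sqrt (M(n,k) / k)\<close>.

  The program cannot evaluate \<open>M\<close>, which need not even be computable. It therefore tries
  \<open>w = 1, 2, 4, \<dots>\<close>, running each attempt with fuel \<open>O(nkw)\<close> and starting over with the next
  \<open>w\<close> when the fuel is used up. The costs of the attempts form a geometric series, and an attempt with
  \<open>k w\<^sup>2 \<ge> 3 M(n,k)\<close> succeeds. Each attempt sorts by selection in blocks of \<open>w\<close> entries,
  which stays within these costs because \<open>M(n,k) \<ge> nk\<close>: a multiplication program must read all
  entries of its input; and \<open>M(n,k) \<ge> n\<^sup>2\<close>, since it must write all entries of its output.
\<close>

subsection \<open>Executions\<close>

text \<open>The entries of C, P and R are sums over the commodities of a buyer weight times a seller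
  weight, restricted by the price comparison; a weight is 1 or a price, and 0 where nothing is
  traded. That each term is such a product lets matrix multiplication in: "buyer in this bucket" and
  "seller in an earlier bucket" concern one factor each and are imposed by zeroing entries. The
  obstacle is that the multiplication program is a black box. It may destroy its operands, its sizes
  and every array that it names, so working arrays get fresh names, the input is copied to them, and
  the operands are refilled before each call. Its cost is known only through M, so a clock has to be
  built in by rewriting loops, those of the black box included. A run cut short leaves arbitrary
  data behind; this is harmless because the next run rebuilds what it uses from tables that no run
  writes. The lower bounds on M also pay for filling the operands and adding up the results around
  each product.\<close>

lemma nats_nat_update [simp]: "nats (nat_update x i m s) = (nats s)(x := (nats s x)(i := m))"
  and reals_nat_update [simp]: "reals (nat_update x i m s) = reals s"
  and nats_real_update [simp]: "nats (real_update x i r s) = nats s"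
  and reals_real_update [simp]: "reals (real_update x i r s) = (reals s)(x := (reals s x)(i := r))"
  by (auto simp: nat_update_def real_update_def)

inductive_cases exec_SkipE: "exec Skip s t s'"
inductive_cases exec_NAssignE: "exec (NAssign x e f) s t s'"
inductive_cases exec_RAssignE: "exec (RAssign x e f) s t s'"
inductive_cases exec_SeqE: "exec (Seq c d) s t s'"
inductive_cases exec_CondE: "exec (Cond b c d) s t s'"
inductive_cases exec_LoopE: "exec (Loop b c) s t s'"

lemma exec_LoopD:
  "exec (Loop b c) s t s' \<Longrightarrow> bval b s \<Longrightarrow>
     \<exists>u s1 w. t = 1 + bcost b + u + w \<and> exec c s u s1 \<and> exec (Loop b c) s1 w s'"
  by (erule exec_LoopE) fastforce+

text \<open>Used twice: to identify the run of a fuelled program known by its outcome with the run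
  known by its duration, and to compare a multiplication run on a perturbed input with the run that
  its specification promises.\<close>

lemma exec_deterministic:
  "exec c s t s' \<Longrightarrow> exec c s u s'' \<Longrightarrow> t = u \<and> s' = s''"
proof (induction arbitrary: u s'' rule: exec.induct)
  case (Seq c s t s1 d t2 s2)
  from Seq.prems obtain t' s1' u' where
    u: "u = t' + u'" and c: "exec c s t' s1'" and d: "exec d s1' u' s''"
    by (rule exec_SeqE)
  from Seq.IH(1)[OF c] d have "exec d s1 u' s''" by simp
  from Seq.IH(1)[OF c] Seq.IH(2)[OF this] u show ?case by simp
next
  case (Cond_True b s c t s' d)
  from Cond_True.prems Cond_True.hyps(1) obtain t' where
    u: "u = 1 + bcost b + t'" and c: "exec c s t' s''"
    by (elim exec_CondE) auto
  from Cond_True.IH[OF c] u show ?case by simp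
next
  case (Cond_False b s d t s' c)
  from Cond_False.prems Cond_False.hyps(1) obtain t' where
    u: "u = 1 + bcost b + t'" and d: "exec d s t' s''"
    by (elim exec_CondE) auto
  from Cond_False.IH[OF d] u show ?case by simp
next
  case (Loop_True b s c t s1 t2 s2)
  from exec_LoopD[OF Loop_True.prems Loop_True.hyps(1)] obtain t' s1' u' where
    u: "u = 1 + bcost b + t' + u'" and c: "exec c s t' s1'" and d: "exec (Loop b c) s1' u' s''"
    by blast
  from Loop_True.IH(1)[OF c] d have "exec (Loop b c) s1 u' s''" by simp
  from Loop_True.IH(1)[OF c] Loop_True.IH(2)[OF this] u show ?case by simp
next
  case (Loop_False b s c)
  from Loop_False.prems show ?case
    by (rule exec_LoopE) (use Loop_False.hyps in simp_all)
qed (erule exec_SkipE exec_NAssignE exec_RAssignE, simp)+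


subsection \<open>Frames\<close>

fun nwrites :: "com \<Rightarrow> name set" where
  "nwrites Skip = {}"
| "nwrites (NAssign x e f) = {x}"
| "nwrites (RAssign x e f) = {}"
| "nwrites (Seq c d) = nwrites c \<union> nwrites d"
| "nwrites (Cond b c d) = nwrites c \<union> nwrites d"
| "nwrites (Loop b c) = nwrites c"

fun rwrites :: "com \<Rightarrow> name set" where
  "rwrites Skip = {}"
| "rwrites (NAssign x e f) = {}"
| "rwrites (RAssign x e f) = {x}"
| "rwrites (Seq c d) = rwrites c \<union> rwrites d"
| "rwrites (Cond b c d) = rwrites c \<union> rwrites d"
| "rwrites (Loop b c) = rwrites c"

text \<open>The frame is read off the program text. The rules for programs below hand this fact to
  the next step, so postconditions mention only what a program is meant to change.\<close>

definition agree_off :: "com \<Rightarrow> state \<Rightarrow> state \<Rightarrow> bool" where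
  "agree_off c s s' \<longleftrightarrow>
     (\<forall>x. x \<notin> nwrites c \<longrightarrow> nats s' x = nats s x) \<and>
     (\<forall>x. x \<notin> rwrites c \<longrightarrow> reals s' x = reals s x)"

lemma agree_off_refl [simp]: "agree_off c s s"
  by (simp add: agree_off_def)

lemma agree_off_trans: "agree_off c s s' \<Longrightarrow> agree_off c s' s'' \<Longrightarrow> agree_off c s s''"
  by (simp add: agree_off_def)

lemma agree_off_mono:
  "agree_off c s s' \<Longrightarrow> nwrites c \<subseteq> nwrites d \<Longrightarrow> rwrites c \<subseteq> rwrites d \<Longrightarrow> agree_off d s s'"
  by (auto simp: agree_off_def)

lemma agree_off_nats: "agree_off c s s' \<Longrightarrow> x \<notin> nwrites c \<Longrightarrow> nats s' x = nats s x"
  and agree_off_reals: "agree_off c s s' \<Longrightarrow> x \<notin> rwrites c \<Longrightarrow> reals s' x = reals s x"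
  by (simp_all add: agree_off_def)

lemma exec_agree_off: "exec c s t s' \<Longrightarrow> agree_off c s s'"
  by (induction rule: exec.induct) (auto simp: agree_off_def)

fun nexp_names :: "nexp \<Rightarrow> name set" where
  "nexp_names (NConst m) = {}"
| "nexp_names (NRead x e) = insert x (nexp_names e)"
| "nexp_names (NAdd e f) = nexp_names e \<union> nexp_names f"
| "nexp_names (NSub e f) = nexp_names e \<union> nexp_names f"

fun rexp_names :: "rexp \<Rightarrow> name set" where
  "rexp_names RZero = {}"
| "rexp_names ROne = {}"
| "rexp_names (RRead x e) = nexp_names e"
| "rexp_names (RAdd e f) = rexp_names e \<union> rexp_names f"
| "rexp_names (RSub e f) = rexp_names e \<union> rexp_names f"
| "rexp_names (RMul e f) = rexp_names e \<union> rexp_names f"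
| "rexp_names (RDiv e f) = rexp_names e \<union> rexp_names f"

fun bexp_names :: "bexp \<Rightarrow> name set" where
  "bexp_names (NLess e f) = nexp_names e \<union> nexp_names f"
| "bexp_names (RLess e f) = rexp_names e \<union> rexp_names f"
| "bexp_names (BNot b) = bexp_names b"
| "bexp_names (BAnd b c) = bexp_names b \<union> bexp_names c"

text \<open>Only the names of arrays of natural numbers are collected here.\<close>

fun com_names :: "com \<Rightarrow> name set" where
  "com_names Skip = {}"
| "com_names (NAssign x e f) = insert x (nexp_names e \<union> nexp_names f)"
| "com_names (RAssign x e f) = nexp_names e \<union> rexp_names f"
| "com_names (Seq c d) = com_names c \<union> com_names d"
| "com_names (Cond b c d) = bexp_names b \<union> com_names c \<union> com_names d"
| "com_names (Loop b c) = bexp_names b \<union> com_names c"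

lemma nwrites_subset_com_names: "nwrites c \<subseteq> com_names c"
  by (induction c) auto

lemma finite_nexp_names [simp]: "finite (nexp_names e)"
  by (induction e) auto

lemma finite_rexp_names [simp]: "finite (rexp_names e)"
  by (induction e) auto

lemma finite_bexp_names [simp]: "finite (bexp_names b)"
  by (induction b) auto

lemma finite_com_names [simp]: "finite (com_names c)"
  by (induction c) auto

lemma finite_rwrites [simp]: "finite (rwrites c)"
  by (induction c) auto

lemma nval_nat_update [simp]: "x \<notin> nexp_names e \<Longrightarrow> nval e (nat_update x i m s) = nval e s"
  by (induction e) auto

lemma rval_nat_update [simp]: "x \<notin> rexp_names e \<Longrightarrow> rval e (nat_update x i m s) = rval e s"
  by (induction e) auto

lemma bval_nat_update [simp]: "x \<notin> bexp_names b \<Longrightarrow> bval b (nat_update x i m s) = bval b s"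
  by (induction b) auto

lemma nval_cong: "(\<And>x. x \<in> nexp_names e \<Longrightarrow> nats s' x = nats s x) \<Longrightarrow> nval e s' = nval e s"
  by (induction e) auto


subsection \<open>Interrupting a program when its fuel is used up\<close>

text \<open>Only loops consume fuel: a program without loops runs in bounded time anyway.\<close>

fun limit :: "name \<Rightarrow> com \<Rightarrow> com" where
  "limit x (Seq c d) = Seq (limit x c) (limit x d)"
| "limit x (Cond b c d) = Cond b (limit x c) (limit x d)"
| "limit x (Loop b c) = Loop (BAnd b (NLess (NConst 0) (NRead x (NConst 0))))
     (Seq (NAssign x (NConst 0) (NSub (NRead x (NConst 0)) (NConst 1))) (limit x c))"
| "limit x c = c"

text \<open>Both branches of a conditional are charged, so the number depends on the program alone.
  It bounds the time of a program without loops and the time per unit of fuel of a limited one. The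
  12 in the loop case is the fuel test added to the guard (6, with the unit for branching) and the
  decrement (6).\<close>

fun overhead :: "com \<Rightarrow> nat" where
  "overhead Skip = 1"
| "overhead (NAssign x e f) = 1 + ncost e + ncost f"
| "overhead (RAssign x e f) = 1 + ncost e + rcost f"
| "overhead (Seq c d) = overhead c + overhead d"
| "overhead (Cond b c d) = 1 + bcost b + overhead c + overhead d"
| "overhead (Loop b c) = 12 + bcost b + overhead c"

lemma nwrites_limit: "nwrites (limit x c) \<subseteq> insert x (nwrites c)"
  by (induction c) auto

lemma rwrites_limit [simp]: "rwrites (limit x c) = rwrites c"
  by (induction c) auto

text \<open>Code outside loops is passed at most once, and each pass through a body burns a unit of
  fuel; hence at most \<open>overhead c\<close> steps per unit burnt, and once more for the rest.
  The program \<open>c\<close> itself may run forever: the fuel alone forces the end.\<close>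

lemma limit_terminates:
  "x \<notin> com_names c \<Longrightarrow> \<exists>t s'. exec (limit x c) s t s' \<and> nats s' x 0 \<le> nats s x 0 \<and>
     t \<le> overhead c * (1 + nats s x 0 - nats s' x 0)"
proof (induction c arbitrary: s)
  case Skip
  show ?case using exec.Skip[of s] by (intro exI[of _ 1] exI[of _ s]) auto
next
  case (NAssign y e f)
  then show ?case using exec.NAssign[of y e f s]
    by (intro exI[of _ "1 + ncost e + ncost f"] exI[of _ "nat_update y (nval e s) (nval f s) s"]) auto
next
  case (RAssign y e f)
  then show ?case using exec.RAssign[of y e f s]
    by (intro exI[of _ "1 + ncost e + rcost f"] exI[of _ "real_update y (nval e s) (rval f s) s"]) auto
next
  case (Seq c d)
  then obtain t s1 where 1: "exec (limit x c) s t s1" "nats s1 x 0 \<le> nats s x 0"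
    "t \<le> overhead c * (1 + nats s x 0 - nats s1 x 0)" by fastforce
  from Seq obtain u s2 where 2: "exec (limit x d) s1 u s2" "nats s2 x 0 \<le> nats s1 x 0"
    "u \<le> overhead d * (1 + nats s1 x 0 - nats s2 x 0)" by fastforce
  have "t \<le> overhead c * (1 + nats s x 0 - nats s2 x 0)"
    using 1(3) by (rule order_trans) (use 2 in auto)
  moreover have "u \<le> overhead d * (1 + nats s x 0 - nats s2 x 0)"
    using 2(3) by (rule order_trans) (use 1 in auto)
  ultimately have "t + u \<le> overhead (Seq c d) * (1 + nats s x 0 - nats s2 x 0)"
    by (simp only: overhead.simps add_mult_distrib)
  with 1 2 show ?case by (auto intro!: exec.Seq exI[of _ "t + u"] exI[of _ s2])
next
  case (Cond b c d)
  have "\<exists>t s'. exec (limit x (if bval b s then c else d)) s t s' \<and> nats s' x 0 \<le> nats s x 0 \<and>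
     t \<le> (overhead c + overhead d) * (1 + nats s x 0 - nats s' x 0)"
  proof (cases "bval b s")
    case True
    then show ?thesis using Cond.IH(1)[of s] Cond.prems
      by (fastforce simp: add_mult_distrib intro: order_trans)
  next
    case False
    then show ?thesis using Cond.IH(2)[of s] Cond.prems
      by (fastforce simp: add_mult_distrib intro: order_trans)
  qed
  then obtain t s1 where 1: "exec (limit x (if bval b s then c else d)) s t s1" "nats s1 x 0 \<le> nats s x 0"
    "t \<le> (overhead c + overhead d) * (1 + nats s x 0 - nats s1 x 0)" by blast
  have "1 \<le> 1 + nats s x 0 - nats s1 x 0" using 1(2) by linarith
  from mult_le_mono2[OF this, of "1 + bcost b"]
  have "1 + bcost b \<le> (1 + bcost b) * (1 + nats s x 0 - nats s1 x 0)" by simp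
  with 1(3) have "1 + bcost b + t \<le> overhead (Cond b c d) * (1 + nats s x 0 - nats s1 x 0)"
    unfolding overhead.simps add_mult_distrib by linarith
  moreover have "exec (limit x (Cond b c d)) s (1 + bcost b + t) s1"
    using 1(1) exec.Cond_True[of b s "limit x c" t s1] exec.Cond_False[of b s "limit x d" t s1]
    by (cases "bval b s") simp_all
  ultimately show ?case using 1(2) by blast
next
  case (Loop b c)
  let ?g = "BAnd b (NLess (NConst 0) (NRead x (NConst 0)))"
  let ?tick = "NAssign x (NConst 0) (NSub (NRead x (NConst 0)) (NConst 1))"
  show ?case
  proof (induction "nats s x 0" arbitrary: s rule: less_induct)
    case less
    show ?case
    proof (cases "bval ?g s")
      case False
      then have "exec (limit x (Loop b c)) s (1 + bcost ?g) s"
        by (simp only: limit.simps exec.Loop_False not_False_eq_True)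
      then show ?thesis by (intro exI[of _ "1 + bcost ?g"] exI[of _ s]) auto
    next
      case True
      define s0 where "s0 = nat_update x 0 (nats s x 0 - 1) s"
      have e0: "exec ?tick s 6 s0"
        using exec.NAssign[of x "NConst 0" "NSub (NRead x (NConst 0)) (NConst 1)" s]
        by (simp add: s0_def eval_nat_numeral)
      obtain t s1 where 1: "exec (limit x c) s0 t s1" "nats s1 x 0 \<le> nats s0 x 0"
        "t \<le> overhead c * (1 + nats s0 x 0 - nats s1 x 0)"
        using Loop.IH[of s0] Loop.prems by auto
      have f: "nats s0 x 0 + 1 = nats s x 0" using True by (simp add: s0_def)
      then have "nats s1 x 0 < nats s x 0" using 1(2) by linarith
      from less[OF this] obtain u s2 where 2: "exec (limit x (Loop b c)) s1 u s2"
        "nats s2 x 0 \<le> nats s1 x 0"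
        "u \<le> overhead (Loop b c) * (1 + nats s1 x 0 - nats s2 x 0)" by blast
      let ?t = "1 + bcost ?g + (6 + t) + u"
      have "exec (limit x (Loop b c)) s ?t s2"
        unfolding limit.simps
        by (rule exec.Loop_True[OF True exec.Seq[OF e0 1(1)]]) (use 2 in simp)
      moreover have "?t \<le> overhead (Loop b c) * (1 + nats s x 0 - nats s2 x 0)"
      proof -
        \<comment> \<open>The unit taken by the decrement pays for the additive 1 in the bound for
          the body, so the first iteration counts \<open>p\<close>, and the remaining ones, with
          their own 1, count \<open>q\<close>.\<close>
        define p q where "p = nats s x 0 - nats s1 x 0" and "q = 1 + nats s1 x 0 - nats s2 x 0"
        have pq: "1 + nats s0 x 0 - nats s1 x 0 = p" "1 + nats s x 0 - nats s2 x 0 = p + q" "p \<ge> 1"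
          using f 1(2) 2(2) by (auto simp: p_def q_def)
        have "11 + bcost b + 1 \<le> (12 + bcost b) * p" using pq(3) by (cases p) auto
        moreover have "t \<le> overhead c * p" "u \<le> overhead (Loop b c) * q"
          using 1(3) 2(3) unfolding pq(1) q_def by simp_all
        ultimately show ?thesis
          unfolding pq(2) by (simp add: algebra_simps)
      qed
      ultimately show ?thesis using 1(2) 2(2) f by (auto intro!: exI[of _ ?t] exI[of _ s2])
    qed
  qed
qed

lemma nat_update_twice [simp]: "nat_update x i m (nat_update x i m' s) = nat_update x i m s"
  by (simp add: nat_update_def)

lemma nat_update_commute:
  "x \<noteq> y \<Longrightarrow> nat_update x i m (nat_update y j m' s) = nat_update y j m' (nat_update x i m s)"
  by (simp add: nat_update_def fun_upd_twist)

lemma nat_real_update_commute: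
  "real_update x i r (nat_update y j m s) = nat_update y j m (real_update x i r s)"
  by (simp add: nat_update_def real_update_def)

text \<open>Each iteration costs at least one unit of time, so the fuel burnt never exceeds the time
  \<open>t\<close> of the original run; this is what \<open>F \<le> f + t\<close> records. Either
  the copy ran to the end, with the same state up to the fuel cell, or the fuel vanished, which
  needs \<open>F \<le> t\<close>. In the second case the state is arbitrary except that the fuel is
  0.\<close>

lemma limit_simulates:
  assumes "exec c s t s'" "x \<notin> com_names c"
  shows "\<exists>u f s2. exec (limit x c) (nat_update x 0 F s) u s2 \<and>
    (F \<le> t \<and> nats s2 x 0 = 0 \<or> F \<le> f + t \<and> s2 = nat_update x 0 f s')"
  using assms
proof (induction arbitrary: F rule: exec.induct)
  case (Skip s)
  have "exec (limit x Skip) (nat_update x 0 F s) 1 (nat_update x 0 F s)" by (simp add: exec.Skip[simplified])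
  moreover have "F \<le> F + 1" by simp
  ultimately show ?case by blast
next
  case (NAssign y e f s)
  then have "exec (limit x (NAssign y e f)) (nat_update x 0 F s) (1 + ncost e + ncost f)
      (nat_update x 0 F (nat_update y (nval e s) (nval f s) s))"
    using exec.NAssign[of y e f "nat_update x 0 F s"] by (simp add: nat_update_commute[of x y])
  moreover have "F \<le> F + (1 + ncost e + ncost f)" by simp
  ultimately show ?case by blast
next
  case (RAssign y e f s)
  then have "exec (limit x (RAssign y e f)) (nat_update x 0 F s) (1 + ncost e + rcost f)
      (nat_update x 0 F (real_update y (nval e s) (rval f s) s))"
    using exec.RAssign[of y e f "nat_update x 0 F s"] by (simp add: nat_real_update_commute)
  moreover have "F \<le> F + (1 + ncost e + rcost f)" by simp
  ultimately show ?case by blast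
next
  case (Seq c s t s' d t' s'')
  then have x: "x \<notin> com_names c" "x \<notin> com_names d" by auto
  from Seq.IH(1)[OF x(1), of F] obtain u f s2 where
    1: "exec (limit x c) (nat_update x 0 F s) u s2"
      "F \<le> t \<and> nats s2 x 0 = 0 \<or> F \<le> f + t \<and> s2 = nat_update x 0 f s'" by blast
  show ?case
  proof (cases "F \<le> t \<and> nats s2 x 0 = 0")
    case True
    \<comment> \<open>After the fuel is gone, the rest runs on a meaningless state. It still
      terminates and cannot refuel, so the 0 survives to the end.\<close>
    from limit_terminates[OF x(2), of s2] obtain u' s3 where
      "exec (limit x d) s2 u' s3" "nats s3 x 0 \<le> nats s2 x 0" by blast
    with 1 True show ?thesis by (auto intro!: exec.Seq exI)
  next
    case False
    with 1 have f: "F \<le> f + t" "s2 = nat_update x 0 f s'" by auto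
    from Seq.IH(2)[OF x(2), of f] obtain u' f' s3 where
      "exec (limit x d) s2 u' s3"
      "f \<le> t' \<and> nats s3 x 0 = 0 \<or> f \<le> f' + t' \<and> s3 = nat_update x 0 f' s''"
      unfolding f(2) by blast
    with 1 f show ?thesis
      by (intro exI[of _ "u + u'"] exI[of _ f'] exI[of _ s3]) (auto intro: exec.Seq)
  qed
next
  case (Cond_True b s c t s' d)
  then obtain u f s2 where "exec (limit x c) (nat_update x 0 F s) u s2"
      "F \<le> t \<and> nats s2 x 0 = 0 \<or> F \<le> f + t \<and> s2 = nat_update x 0 f s'" by fastforce
  with Cond_True show ?case
    by (intro exI[of _ "1 + bcost b + u"] exI[of _ f] exI[of _ s2])
      (auto intro!: exec.Cond_True[simplified])
next
  case (Cond_False b s d t s' c)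
  then obtain u f s2 where "exec (limit x d) (nat_update x 0 F s) u s2"
      "F \<le> t \<and> nats s2 x 0 = 0 \<or> F \<le> f + t \<and> s2 = nat_update x 0 f s'" by fastforce
  with Cond_False show ?case
    by (intro exI[of _ "1 + bcost b + u"] exI[of _ f] exI[of _ s2])
      (auto intro!: exec.Cond_False[simplified])
next
  case (Loop_False b s c)
  let ?g = "BAnd b (NLess (NConst 0) (NRead x (NConst 0)))"
  have "exec (limit x (Loop b c)) (nat_update x 0 F s) (1 + bcost ?g) (nat_update x 0 F s)"
    unfolding limit.simps by (rule exec.Loop_False) (use Loop_False in auto)
  then show ?case by (intro exI conjI) (assumption, auto)
next
  case (Loop_True b s c t s' t' s'')
  let ?g = "BAnd b (NLess (NConst 0) (NRead x (NConst 0)))"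
  let ?tick = "NAssign x (NConst 0) (NSub (NRead x (NConst 0)) (NConst 1))"
  from Loop_True have x: "x \<notin> com_names c" "x \<notin> bexp_names b" by auto
  show ?case
  proof (cases F)
    case 0
    have "exec (limit x (Loop b c)) (nat_update x 0 F s) (1 + bcost ?g) (nat_update x 0 F s)"
      unfolding limit.simps by (rule exec.Loop_False) (use 0 in auto)
    then show ?thesis by (intro exI conjI) (assumption, auto simp: 0)
  next
    case (Suc F')
    have g: "bval ?g (nat_update x 0 F s)" using x Loop_True.hyps Suc by simp
    have "exec ?tick (nat_update x 0 F s) (1 + ncost (NConst 0) + ncost (NSub (NRead x (NConst 0)) (NConst 1)))
        (nat_update x 0 F' s)"
      using exec.NAssign[of x "NConst 0" "NSub (NRead x (NConst 0)) (NConst 1)" "nat_update x 0 F s"] Suc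
      by simp
    then obtain q where e0: "exec ?tick (nat_update x 0 F s) q (nat_update x 0 F' s)" by blast
    from Loop_True.IH(1)[OF x(1), of F'] obtain u f s2 where
      1: "exec (limit x c) (nat_update x 0 F' s) u s2"
        "F' \<le> t \<and> nats s2 x 0 = 0 \<or> F' \<le> f + t \<and> s2 = nat_update x 0 f s'" by blast
    note E = exec.Loop_True[OF g exec.Seq[OF e0 1(1)]]
    show ?thesis
    proof (cases "F' \<le> t \<and> nats s2 x 0 = 0")
      case True
      from limit_terminates[OF Loop_True.prems, of s2] obtain u' s3 where
        2: "exec (limit x (Loop b c)) s2 u' s3" "nats s3 x 0 \<le> nats s2 x 0" by blast
      with E[OF 2(1)[unfolded limit.simps]] True Suc show ?thesis
        unfolding limit.simps
        by (intro exI conjI) (assumption, simp)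
    next
      case False
      with 1 have f: "F' \<le> f + t" "s2 = nat_update x 0 f s'" by auto
      from Loop_True.IH(2)[OF Loop_True.prems, of f] obtain u' f' s3 where
        2: "exec (limit x (Loop b c)) s2 u' s3"
        "f \<le> t' \<and> nats s3 x 0 = 0 \<or> f \<le> f' + t' \<and> s3 = nat_update x 0 f' s''"
        unfolding f(2) by blast
      have "F \<le> 1 + bcost b + t + t' \<and> nats s3 x 0 = 0 \<or>
          F \<le> f' + (1 + bcost b + t + t') \<and> s3 = nat_update x 0 f' s''"
        using 2(2) f Suc by auto
      with E[OF 2(1)[unfolded limit.simps]] show ?thesis
        unfolding limit.simps by blast
    qed
  qed
qed


subsection \<open>Lower bounds for matrix multiplication\<close>

text \<open>An assignment changes at most one cell of reals and costs at least one unit; all other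
  steps leave the reals alone.\<close>

lemma exec_changed_cells:
  "exec c s t s' \<Longrightarrow> finite {i. reals s' x i \<noteq> reals s x i} \<and> card {i. reals s' x i \<noteq> reals s x i} \<le> t"
proof (induction rule: exec.induct)
  case (RAssign y e f s)
  let ?C = "{i. reals (real_update y (nval e s) (rval f s) s) x i \<noteq> reals s x i}"
  have "?C \<subseteq> {nval e s}" by auto
  from finite_subset[OF this] card_mono[OF _ this] show ?case by simp
next
  case (Seq c s t s1 d u s2)
  have "{i. reals s2 x i \<noteq> reals s x i} \<subseteq>
      {i. reals s1 x i \<noteq> reals s x i} \<union> {i. reals s2 x i \<noteq> reals s1 x i}" (is "?C \<subseteq> ?A \<union> ?B") by auto
  moreover have "finite (?A \<union> ?B)" "card (?A \<union> ?B) \<le> t + u"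
    using Seq.IH card_Un_le[of ?A ?B] by auto
  ultimately show ?case by (meson card_mono finite_subset order_trans)
next
  case (Loop_True b s c t s1 u s2)
  have "{i. reals s2 x i \<noteq> reals s x i} \<subseteq>
      {i. reals s1 x i \<noteq> reals s x i} \<union> {i. reals s2 x i \<noteq> reals s1 x i}" (is "?C \<subseteq> ?A \<union> ?B") by auto
  moreover have "finite (?A \<union> ?B)" "card (?A \<union> ?B) \<le> 1 + bcost b + t + u"
    using Loop_True.IH card_Un_le[of ?A ?B] by auto
  ultimately show ?case by (meson card_mono finite_subset order_trans)
qed auto

lemma nval_real_update [simp]: "nval e (real_update x i r s) = nval e s"
  by (induction e) auto

text \<open>Addresses are collected from accesses to every array, a superset of those read in
  \<open>x\<close>. The cost of the expression still bounds their number, which is all that the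
  counting argument asks for.\<close>

fun rexp_reads :: "name \<Rightarrow> rexp \<Rightarrow> state \<Rightarrow> nat set" where
  "rexp_reads x RZero s = {}"
| "rexp_reads x ROne s = {}"
| "rexp_reads x (RRead y e) s = {nval e s}"
| "rexp_reads x (RAdd e f) s = rexp_reads x e s \<union> rexp_reads x f s"
| "rexp_reads x (RSub e f) s = rexp_reads x e s \<union> rexp_reads x f s"
| "rexp_reads x (RMul e f) s = rexp_reads x e s \<union> rexp_reads x f s"
| "rexp_reads x (RDiv e f) s = rexp_reads x e s \<union> rexp_reads x f s"

fun bexp_reads :: "name \<Rightarrow> bexp \<Rightarrow> state \<Rightarrow> nat set" where
  "bexp_reads x (NLess e f) s = {}"
| "bexp_reads x (RLess e f) s = rexp_reads x e s \<union> rexp_reads x f s"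
| "bexp_reads x (BNot b) s = bexp_reads x b s"
| "bexp_reads x (BAnd b c) s = bexp_reads x b s \<union> bexp_reads x c s"

lemma card_Un_le_trans: "card A \<le> m \<Longrightarrow> card B \<le> l \<Longrightarrow> card (A \<union> B) \<le> m + l"
  using card_Un_le[of A B] by linarith

lemma rexp_reads_bound: "finite (rexp_reads x e s) \<and> card (rexp_reads x e s) \<le> rcost e"
  by (induction e) (auto intro: card_Un_le_trans[THEN le_SucI])

lemma bexp_reads_bound: "finite (bexp_reads x b s) \<and> card (bexp_reads x b s) \<le> bcost b"
  by (induction b) (auto intro: card_Un_le_trans[THEN le_SucI] le_SucI simp: rexp_reads_bound)

lemma rval_real_update_unread:
  "i \<notin> rexp_reads x e s \<Longrightarrow> rval e (real_update x i r s) = rval e s"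
  by (induction e) auto

lemma bval_real_update_unread:
  "i \<notin> bexp_reads x b s \<Longrightarrow> bval b (real_update x i r s) = bval b s"
  by (induction b) (auto simp: rval_real_update_unread)

lemma real_update_twice [simp]: "real_update x i r (real_update x i r' s) = real_update x i r s"
  by (simp add: real_update_def)

lemma real_update_commute:
  "(x, i) \<noteq> (y, j) \<Longrightarrow> real_update x i r (real_update y j r' s) = real_update y j r' (real_update x i r s)"
  by (cases "x = y") (auto simp: real_update_def fun_upd_twist)

text \<open>Reals reach control flow and addresses only through comparisons, so after changing a
  cell that is never read the run is replayed step by step with the same duration. The final content
  \<open>r'\<close> is existential because the run may overwrite the cell.\<close>

lemma exec_unread_cells:
  "exec c s t s' \<Longrightarrow> \<exists>X. finite X \<and> card X \<le> t \<and>
     (\<forall>i. i \<notin> X \<longrightarrow> (\<forall>r. \<exists>r'. exec c (real_update x i r s) t (real_update x i r' s')))"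
proof (induction rule: exec.induct)
  case (Skip s)
  show ?case by (intro exI[of _ "{}"]) (auto intro: exec.Skip[simplified])
next
  case (NAssign y e f s)
  have "exec (NAssign y e f) (real_update x i r s) (1 + ncost e + ncost f)
      (real_update x i r (nat_update y (nval e s) (nval f s) s))" for i r
    using exec.NAssign[of y e f "real_update x i r s"] by (simp add: nat_real_update_commute)
  then show ?case by (intro exI[of _ "{}"]) auto
next
  case (RAssign y e f s)
  have "\<exists>r'. exec (RAssign y e f) (real_update x i r s) (1 + ncost e + rcost f)
      (real_update x i r' (real_update y (nval e s) (rval f s) s))"
    if "i \<notin> rexp_reads x f s" for i r
  proof -
    from exec.RAssign[of y e f "real_update x i r s"] that
    have *: "exec (RAssign y e f) (real_update x i r s) (1 + ncost e + rcost f)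
        (real_update y (nval e s) (rval f s) (real_update x i r s))"
      by (simp add: rval_real_update_unread)
    show ?thesis
    proof (cases "(y, nval e s) = (x, i)")
      case True
      with * show ?thesis by (auto intro!: exI[of _ "rval f s"])
    next
      case False
      with * show ?thesis by (auto simp: real_update_commute intro!: exI[of _ r])
    qed
  qed
  with rexp_reads_bound[of x f s] show ?case by (intro exI[of _ "rexp_reads x f s"]) auto
next
  case (Seq c s t s1 d u s2)
  from Seq.IH(1) obtain X where X: "finite X" "card X \<le> t"
    "\<And>i r. i \<notin> X \<Longrightarrow> \<exists>r'. exec c (real_update x i r s) t (real_update x i r' s1)" by blast
  from Seq.IH(2) obtain Y where Y: "finite Y" "card Y \<le> u"
    "\<And>i r. i \<notin> Y \<Longrightarrow> \<exists>r'. exec d (real_update x i r s1) u (real_update x i r' s2)" by blast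
  have "\<exists>r'. exec (Seq c d) (real_update x i r s) (t + u) (real_update x i r' s2)"
    if "i \<notin> X \<union> Y" for i r
  proof -
    from that X(3)[of i r] obtain q where q: "exec c (real_update x i r s) t (real_update x i q s1)" by auto
    from that Y(3)[of i q] obtain q' where "exec d (real_update x i q s1) u (real_update x i q' s2)" by auto
    from exec.Seq[OF q this] show ?thesis ..
  qed
  with X Y show ?case by (intro exI[of _ "X \<union> Y"]) (auto intro: card_Un_le_trans)
next
  case (Cond_True b s c t s1 d)
  then obtain X where X: "finite X" "card X \<le> t"
    "\<And>i r. i \<notin> X \<Longrightarrow> \<exists>r'. exec c (real_update x i r s) t (real_update x i r' s1)" by blast
  have "\<exists>r'. exec (Cond b c d) (real_update x i r s) (1 + bcost b + t) (real_update x i r' s1)"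
    if "i \<notin> bexp_reads x b s \<union> X" for i r
  proof -
    from that Cond_True.hyps(1) have b: "bval b (real_update x i r s)"
      by (simp add: bval_real_update_unread)
    from that X(3)[of i r] obtain q where "exec c (real_update x i r s) t (real_update x i q s1)" by auto
    from exec.Cond_True[OF b this] show ?thesis ..
  qed
  with X bexp_reads_bound[of x b s] show ?case
    by (intro exI[of _ "bexp_reads x b s \<union> X"]) (auto intro: card_Un_le_trans le_SucI)
next
  case (Cond_False b s d t s1 c)
  then obtain X where X: "finite X" "card X \<le> t"
    "\<And>i r. i \<notin> X \<Longrightarrow> \<exists>r'. exec d (real_update x i r s) t (real_update x i r' s1)" by blast
  have "\<exists>r'. exec (Cond b c d) (real_update x i r s) (1 + bcost b + t) (real_update x i r' s1)"
    if "i \<notin> bexp_reads x b s \<union> X" for i r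
  proof -
    from that Cond_False.hyps(1) have b: "\<not> bval b (real_update x i r s)"
      by (simp add: bval_real_update_unread)
    from that X(3)[of i r] obtain q where "exec d (real_update x i r s) t (real_update x i q s1)" by auto
    from exec.Cond_False[OF b this] show ?thesis ..
  qed
  with X bexp_reads_bound[of x b s] show ?case
    by (intro exI[of _ "bexp_reads x b s \<union> X"]) (auto intro: card_Un_le_trans le_SucI)
next
  case (Loop_False b s c)
  have "exec (Loop b c) (real_update x i r s) (1 + bcost b) (real_update x i r s)"
    if "i \<notin> bexp_reads x b s" for i r
    using that Loop_False.hyps(1) exec.Loop_False[of b "real_update x i r s"]
    by (simp add: bval_real_update_unread)
  with bexp_reads_bound[of x b s] show ?case
    by (intro exI[of _ "bexp_reads x b s"]) (auto intro: le_SucI)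
next
  case (Loop_True b s c t s1 u s2)
  from Loop_True.IH(1) obtain X where X: "finite X" "card X \<le> t"
    "\<And>i r. i \<notin> X \<Longrightarrow> \<exists>r'. exec c (real_update x i r s) t (real_update x i r' s1)" by blast
  from Loop_True.IH(2) obtain Y where Y: "finite Y" "card Y \<le> u"
    "\<And>i r. i \<notin> Y \<Longrightarrow> \<exists>r'. exec (Loop b c) (real_update x i r s1) u (real_update x i r' s2)" by blast
  have "\<exists>r'. exec (Loop b c) (real_update x i r s) (1 + bcost b + t + u) (real_update x i r' s2)"
    if i: "i \<notin> bexp_reads x b s \<union> X \<union> Y" for i r
  proof -
    from i Loop_True.hyps(1) have "bval b (real_update x i r s)"
      by (simp add: bval_real_update_unread)
    note b = this
    from i X(3)[of i r] obtain q where q: "exec c (real_update x i r s) t (real_update x i q s1)" by auto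
    from i Y(3)[of i q] obtain q' where
      "exec (Loop b c) (real_update x i q s1) u (real_update x i q' s2)" by auto
    from exec.Loop_True[OF b q this] show ?thesis ..
  qed
  moreover have "card (bexp_reads x b s \<union> X \<union> Y) \<le> 1 + bcost b + t + u"
    using card_Un_le_trans[OF card_Un_le_trans[OF conjunct2[OF bexp_reads_bound[of x b s]] X(2)] Y(2)]
    by simp
  ultimately show ?case using X Y bexp_reads_bound[of x b s]
    by (intro exI[of _ "bexp_reads x b s \<union> X \<union> Y"]) auto
qed

lemma row_major_eq_iff:
  fixes i i' j j' m :: nat
  assumes "j < m" "j' < m"
  shows "i * m + j = i' * m + j' \<longleftrightarrow> i = i' \<and> j = j'"
proof
  assume e: "i * m + j = i' * m + j'"
  from arg_cong[OF e, of "\<lambda>a. a div m"] arg_cong[OF e, of "\<lambda>a. a mod m"] assms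
  show "i = i' \<and> j = j'" by simp
qed simp

lemma row_major_less:
  fixes i j m n :: nat
  assumes "i < n" "j < m"
  shows "i * m + j < n * m"
proof -
  have "i * m + j < Suc i * m" using assms by simp
  also have "\<dots> \<le> n * m" using assms by (intro mult_le_mono1) simp
  finally show ?thesis .
qed

lemma row_major_cases:
  fixes p n m :: nat
  assumes "p < n * m"
  obtains i j where "i < n" "j < m" "p = i * m + j"
proof
  have "m > 0" using assms by (cases m) auto
  then show "p mod m < m" by simp
  show "p div m < n" using assms by (simp add: less_mult_imp_div_less)
qed simp

text \<open>The output array is filled with 1 beforehand while the factors are zero matrices, so
  each of the \<open>n * n\<close> output cells must be changed.\<close>

lemma multiplies_within_output_bound:
  assumes "multiplies_within c M" "n \<ge> 1" "k \<ge> 1"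
  shows "real (n * n) \<le> M n k"
proof -
  define s :: state where "s = \<lparr>nats = (\<lambda>x _. if x = ''n'' then n else k),
    reals = (\<lambda>x _. if x = ''AB'' then 1 else 0)\<rparr>"
  have "holds_sizes s n k" "holds_matrix s ''A'' (0\<^sub>m n k)" "holds_matrix s ''B'' (0\<^sub>m k n)"
    by (auto simp: s_def holds_sizes_def holds_matrix_def)
  with assms obtain t s' where t: "exec c s t s'" "real t \<le> M n k"
    and out: "holds_matrix s' ''AB'' (0\<^sub>m n k * 0\<^sub>m k n)"
    unfolding multiplies_within_def by (meson zero_carrier_mat)
  have "{..<n * n} \<subseteq> {i. reals s' ''AB'' i \<noteq> reals s ''AB'' i}"
  proof
    fix p assume "p \<in> {..<n * n}"
    then obtain i j where "i < n" "j < n" "p = i * n + j" by (auto elim: row_major_cases)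
    with out show "p \<in> {i. reals s' ''AB'' i \<noteq> reals s ''AB'' i}"
      by (auto simp: holds_matrix_def s_def)
  qed
  from card_mono[OF _ this] exec_changed_cells[OF t(1), of "''AB''"] have "n * n \<le> t" by simp
  with t(2) show ?thesis by linarith
qed

text \<open>Changing an unread entry of the left factor from 0 to 1 would go unnoticed.\<close>

lemma multiplies_within_input_bound:
  assumes "multiplies_within c M" "n \<ge> 1" "k \<ge> 1"
  shows "real (n * k) \<le> M n k"
proof -
  define s :: state where "s = \<lparr>nats = (\<lambda>x _. if x = ''n'' then n else k),
    reals = (\<lambda>x _. if x = ''B'' then 1 else 0)\<rparr>"
  \<comment> \<open>Against a factor of ones, an entry 1 of the left matrix shows up in column 0 of
    the product.\<close>
  define B :: "real mat" where "B = mat k n (\<lambda>_. 1)"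
  have B: "B \<in> carrier_mat k n" "holds_matrix s ''B'' B"
    by (auto simp: s_def B_def holds_matrix_def)
  have "holds_sizes s n k" "holds_matrix s ''A'' (0\<^sub>m n k)"
    by (auto simp: s_def holds_sizes_def holds_matrix_def)
  with assms B obtain t s' where t: "exec c s t s'" "real t \<le> M n k"
    and out: "holds_matrix s' ''AB'' (0\<^sub>m n k * B)"
    unfolding multiplies_within_def by (meson zero_carrier_mat)
  obtain X where X: "finite X" "card X \<le> t"
    "\<And>i r. i \<notin> X \<Longrightarrow> \<exists>r'. exec c (real_update ''A'' i r s) t (real_update ''A'' i r' s')"
    using exec_unread_cells[OF t(1), of "''A''"] by blast
  have "{..<n * k} \<subseteq> X"
  proof (rule ccontr)
    assume "\<not> {..<n * k} \<subseteq> X"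
    then obtain p where p: "p < n * k" "p \<notin> X" by auto
    then obtain i l where il: "i < n" "l < k" "p = i * k + l" by (auto elim: row_major_cases)
    define A :: "real mat" where "A = mat n k (\<lambda>(i', l'). if i' = i \<and> l' = l then 1 else 0)"
    define s1 where "s1 = real_update ''A'' p 1 s"
    have "A \<in> carrier_mat n k" "holds_matrix s1 ''A'' A"
      using il by (auto simp: A_def s1_def s_def holds_matrix_def row_major_eq_iff)
    moreover have "holds_sizes s1 n k" "holds_matrix s1 ''B'' B"
      using B by (auto simp: s1_def s_def holds_sizes_def holds_matrix_def)
    ultimately obtain t1 s1' where 1: "exec c s1 t1 s1'" "holds_matrix s1' ''AB'' (A * B)"
      using assms B(1) unfolding multiplies_within_def by meson
    \<comment> \<open>The final state of the replay differs from that of the original run in the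
      array \<open>A\<close> alone, so it outputs the product of the zero matrix, whereas
      correctness on the changed input demands an entry 1.\<close>
    from X(3)[OF p(2), of 1] obtain r' where "exec c s1 t (real_update ''A'' p r' s')"
      by (auto simp: s1_def)
    with 1(1) have s1': "s1' = real_update ''A'' p r' s'" by (meson exec_deterministic)
    have "0 < n" using assms by simp
    have "(0\<^sub>m n k * B) $$ (i, 0) = 0"
      using il B(1) \<open>0 < n\<close> by simp
    moreover have "(A * B) $$ (i, 0) = (\<Sum>l'\<in>{0..<k}. (if l' = l then 1 else 0))"
    proof -
      have "(A * B) $$ (i, 0) = row A i \<bullet> col B 0"
        using il \<open>0 < n\<close> by (simp add: A_def B_def)
      also have "\<dots> = (\<Sum>l'\<in>{0..<k}. row A i $ l' * col B 0 $ l')"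
        by (simp add: scalar_prod_def B_def)
      also have "\<dots> = (\<Sum>l'\<in>{0..<k}. if l' = l then 1 else 0)"
        using il \<open>0 < n\<close> by (intro sum.cong) (auto simp: A_def B_def)
      finally show ?thesis .
    qed
    moreover have "(A * B) $$ (i, 0) = (0\<^sub>m n k * B) $$ (i, 0)"
      using out 1(2) il B(1) \<open>0 < n\<close> \<open>A \<in> carrier_mat n k\<close>
      unfolding s1' holds_matrix_def by force
    ultimately show False using il by simp
  qed
  from card_mono[OF X(1) this] X(2) have "n * k \<le> t" by simp
  with t(2) show ?thesis by linarith
qed


subsection \<open>Programs with a time bound and a postcondition\<close>

text \<open>Total correctness for one given initial state: facts about that state are ordinary
  hypotheses, and loop invariants may refer to it. The time is only bounded, so constants can be
  rounded up freely.\<close>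

definition runs :: "com \<Rightarrow> state \<Rightarrow> nat \<Rightarrow> (state \<Rightarrow> bool) \<Rightarrow> bool" where
  "runs c s T Q \<longleftrightarrow> (\<exists>t s'. exec c s t s' \<and> t \<le> T \<and> Q s')"

lemma runs_conseq:
  "runs c s T P \<Longrightarrow> T \<le> T' \<Longrightarrow> (\<And>s'. P s' \<Longrightarrow> agree_off c s s' \<Longrightarrow> Q s') \<Longrightarrow> runs c s T' Q"
  unfolding runs_def by (meson exec_agree_off order_trans)

lemma runs_Seq:
  "runs c s T P \<Longrightarrow> (\<And>s'. P s' \<Longrightarrow> agree_off c s s' \<Longrightarrow> runs d s' U Q) \<Longrightarrow> T + U \<le> V \<Longrightarrow>
     runs (Seq c d) s V Q"
  unfolding runs_def by (meson add_mono exec.Seq exec_agree_off order_trans)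

lemma runs_Cond:
  assumes "bval b s \<Longrightarrow> runs c s T Q" "\<not> bval b s \<Longrightarrow> runs d s T Q" "1 + bcost b + T \<le> V"
  shows "runs (Cond b c d) s V Q"
proof (cases "bval b s")
  case True
  with assms(1) obtain t s' where "exec c s t s'" "t \<le> T" "Q s'" unfolding runs_def by blast
  with exec.Cond_True[OF True this(1)] assms(3) show ?thesis
    unfolding runs_def by (meson add_le_cancel_left order_trans)
next
  case False
  with assms(2) obtain t s' where "exec d s t s'" "t \<le> T" "Q s'" unfolding runs_def by blast
  with exec.Cond_False[OF False this(1)] assms(3) show ?thesis
    unfolding runs_def by (meson add_le_cancel_left order_trans)
qed

section \<open>Programs without loops, evaluated symbolically\<close>

fun loop_free :: "com \<Rightarrow> bool" where
  "loop_free (Seq c d) \<longleftrightarrow> loop_free c \<and> loop_free d"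
| "loop_free (Cond b c d) \<longleftrightarrow> loop_free c \<and> loop_free d"
| "loop_free (Loop b c) \<longleftrightarrow> False"
| "loop_free c \<longleftrightarrow> True"

text \<open>Meant for programs without loops; the value at a loop is junk.\<close>

fun effect :: "com \<Rightarrow> state \<Rightarrow> state" where
  "effect Skip s = s"
| "effect (NAssign x e f) s = nat_update x (nval e s) (nval f s) s"
| "effect (RAssign x e f) s = real_update x (nval e s) (rval f s) s"
| "effect (Seq c d) s = effect d (effect c s)"
| "effect (Cond b c d) s = (if bval b s then effect c s else effect d s)"
| "effect (Loop b c) s = s"

lemma exec_loop_free: "loop_free c \<Longrightarrow> \<exists>t\<le>overhead c. exec c s t (effect c s)"
proof (induction c arbitrary: s)
  case (Seq c d)
  then have "\<exists>t\<le>overhead c. exec c s t (effect c s)"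
    "\<exists>t\<le>overhead d. exec d (effect c s) t (effect d (effect c s))" by auto
  then show ?case by (auto intro: exec.Seq add_mono)
next
  case (Cond b c d)
  show ?case
  proof (cases "bval b s")
    case True
    from Cond obtain t where "t \<le> overhead c" "exec c s t (effect c s)" by auto
    with exec.Cond_True[OF True this(2), of d] show ?thesis
      by (intro exI[of _ "1 + bcost b + t"]) (auto simp: True)
  next
    case False
    from Cond obtain t where "t \<le> overhead d" "exec d s t (effect d s)" by auto
    with exec.Cond_False[OF False this(2), of c] show ?thesis
      by (intro exI[of _ "1 + bcost b + t"]) (auto simp: False)
  qed
next
  case Skip
  show ?case using exec.Skip by auto
next
  case (NAssign x e f)
  show ?case using exec.NAssign[of x e f s] by auto
next
  case (RAssign x e f)
  show ?case using exec.RAssign[of x e f s] by auto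
qed simp

lemma runs_loop_free: "loop_free c \<Longrightarrow> overhead c \<le> T \<Longrightarrow> Q (effect c s) \<Longrightarrow> runs c s T Q"
  unfolding runs_def using exec_loop_free[of c s] order_trans by blast

lemma runs_Seq_loop_free:
  assumes "loop_free c" "runs d (effect c s) U Q" "overhead c + U \<le> V"
  shows "runs (Seq c d) s V Q"
  by (rule runs_Seq[OF runs_loop_free[of c _ "\<lambda>s'. s' = effect c s"]]) (use assms in auto)

section \<open>Counting loops and their invariants\<close>

definition for_loop :: "name \<Rightarrow> nexp \<Rightarrow> nexp \<Rightarrow> nexp \<Rightarrow> com \<Rightarrow> com" where
  "for_loop x lo hi d c = Seq (NAssign x (NConst 0) lo)
     (Loop (NLess (NRead x (NConst 0)) hi)
       (Seq c (NAssign x (NConst 0) (NAdd (NRead x (NConst 0)) d))))"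

lemma writes_for_loop [simp]:
  "nwrites (for_loop x lo hi d c) = insert x (nwrites c)"
  "rwrites (for_loop x lo hi d c) = rwrites c"
  "com_names (for_loop x lo hi d c) =
     insert x (nexp_names lo \<union> nexp_names hi \<union> nexp_names d \<union> com_names c)"
  by (auto simp: for_loop_def)

text \<open>The number of rounds is the quotient of the distance to \<open>h\<close> by the step,
  rounded up. The counter may jump over \<open>h\<close>, so only \<open>h \<le> p\<close> is known
  at the exit. The body reaches the invariant for \<open>p + \<delta>\<close> while the counter cell
  still holds \<open>p\<close>; hence the demand that \<open>I\<close> survive changes of that cell.
  In the time, 6 is the first assignment (2) and the last test (4), and 9 is test (4) and increment
  (5).\<close>

lemma runs_for_step:
  assumes fixed: "(nexp_names hi \<union> nexp_names d) \<inter> insert x (nwrites c) = {}" "x \<notin> nwrites c"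
    and h: "nval hi s = h" "nval d s = \<delta>" "0 < \<delta>"
    and init: "I (nval lo s) (nat_update x 0 (nval lo s) s)"
    and step: "\<And>p s'. I p s' \<Longrightarrow> p < h \<Longrightarrow> nats s' x 0 = p \<Longrightarrow>
        agree_off (for_loop x lo hi d c) s s' \<Longrightarrow> runs c s' \<tau> (I (p + \<delta>))"
    and stable: "\<And>p m s'. I p s' \<Longrightarrow> I p (nat_update x 0 m s')"
    and Q: "\<And>p s'. h \<le> p \<Longrightarrow> I p s' \<Longrightarrow> agree_off (for_loop x lo hi d c) s s' \<Longrightarrow> Q s'"
    and T: "6 + ncost lo + ncost hi +
        (h - nval lo s + (\<delta> - 1)) div \<delta> * (9 + ncost hi + ncost d + \<tau>) \<le> T"
  shows "runs (for_loop x lo hi d c) s T Q"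
proof -
  let ?c = "Seq c (NAssign x (NConst 0) (NAdd (NRead x (NConst 0)) d))"
  let ?b = "NLess (NRead x (NConst 0)) hi"
  let ?P = "for_loop x lo hi d c"
  let ?K = "9 + ncost hi + ncost d + \<tau>"
  have hi_d: "nval hi s' = h \<and> nval d s' = \<delta>" if "agree_off ?P s s'" for s'
  proof -
    from that fixed have "nats s' y = nats s y" if "y \<in> nexp_names hi \<union> nexp_names d" for y
      using that by (auto simp: agree_off_def)
    then have "nval hi s' = nval hi s" "nval d s' = nval d s" by (auto intro!: nval_cong)
    with h show ?thesis by simp
  qed
  have loop: "runs (Loop ?b ?c) s' (4 + ncost hi + (h - p + (\<delta> - 1)) div \<delta> * ?K)
      (\<lambda>s''. \<exists>p. h \<le> p \<and> I p s'' \<and> agree_off ?P s s'')"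
    if "I p s'" "nats s' x 0 = p" "agree_off ?P s s'" for p s'
    using that
  proof (induction "h - p" arbitrary: p s' rule: less_induct)
    case less
    show ?case
    proof (cases "p < h")
      case False
      then have "exec (Loop ?b ?c) s' (1 + bcost ?b) s'"
        by (intro exec.Loop_False) (use less.prems hi_d in simp)
      with False less.prems show ?thesis unfolding runs_def
        by (intro exI[of _ "1 + bcost ?b"] exI[of _ s'] conjI exI[of _ p]) auto
    next
      case True
      from step[OF less.prems(1) True less.prems(2,3)] obtain t s1 where
        1: "exec c s' t s1" "t \<le> \<tau>" "I (p + \<delta>) s1" unfolding runs_def by blast
      have x1: "nats s1 x 0 = p"
        using exec_agree_off[OF 1(1)] fixed(2) less.prems(2) by (simp add: agree_off_def)
      have a1: "agree_off ?P s s1"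
        using less.prems(3) agree_off_mono[OF exec_agree_off[OF 1(1)], of ?P]
        by (auto intro: agree_off_trans)
      define s2 where "s2 = nat_update x 0 (p + \<delta>) s1"
      have e2: "exec (NAssign x (NConst 0) (NAdd (NRead x (NConst 0)) d)) s1 (5 + ncost d) s2"
        using exec.NAssign[of x "NConst 0" "NAdd (NRead x (NConst 0)) d" s1] hi_d[OF a1]
        by (simp add: s2_def x1 eval_nat_numeral)
      have a2: "agree_off ?P s s2"
        using a1 by (auto simp: s2_def agree_off_def)
      have "h - (p + \<delta>) < h - p" using True h(3) by simp
      from less.hyps[OF this, of s2] 1(3) a2 stable obtain u s3 where
        3: "exec (Loop ?b ?c) s2 u s3" "u \<le> 4 + ncost hi + (h - (p + \<delta>) + (\<delta> - 1)) div \<delta> * ?K"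
          "\<exists>p. h \<le> p \<and> I p s3 \<and> agree_off ?P s s3"
        unfolding runs_def by (auto simp: s2_def)
      have "bval ?b s'" using True less.prems hi_d by simp
      note e = exec.Loop_True[OF this exec.Seq[OF 1(1) e2] 3(1)]
      \<comment> \<open>One round lowers the rounded-up quotient by exactly one; the second case is
        a last step that overshoots \<open>h\<close>.\<close>
      have it: "(h - p + (\<delta> - 1)) div \<delta> = Suc ((h - (p + \<delta>) + (\<delta> - 1)) div \<delta>)"
      proof (cases "p + \<delta> \<le> h")
        case True
        then have "h - p + (\<delta> - 1) = (h - (p + \<delta>) + (\<delta> - 1)) + \<delta>" by simp
        then show ?thesis using h(3) by (simp only: div_add_self2[of \<delta>] Suc_eq_plus1)
      next
        case False
        then have e: "h - p + (\<delta> - 1) = (h - p - 1) + \<delta>" "h - p - 1 < \<delta>" "h - (p + \<delta>) = 0"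
          using True h(3) by auto
        have "(h - p + (\<delta> - 1)) div \<delta> = Suc ((h - p - 1) div \<delta>)"
          unfolding e(1) using h(3) by (simp only: div_add_self2[of \<delta>] Suc_eq_plus1)
        then show ?thesis using e h(3) by simp
      qed
      have "1 + bcost ?b + (t + (5 + ncost d)) + u \<le> 4 + ncost hi + (h - p + (\<delta> - 1)) div \<delta> * ?K"
        using 1(2) 3(2) unfolding it by simp
      with e 3(3) show ?thesis unfolding runs_def by blast
    qed
  qed
  define s0 where "s0 = nat_update x 0 (nval lo s) s"
  have e0: "exec (NAssign x (NConst 0) lo) s (2 + ncost lo) s0"
    using exec.NAssign[of x "NConst 0" lo s] by (simp add: s0_def)
  have "agree_off ?P s s0" by (auto simp: s0_def agree_off_def)
  with loop[of "nval lo s" s0] init obtain u s1 p where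
    1: "exec (Loop ?b ?c) s0 u s1" "u \<le> 4 + ncost hi + (h - nval lo s + (\<delta> - 1)) div \<delta> * ?K"
    "h \<le> p" "I p s1" "agree_off ?P s s1"
    unfolding runs_def by (auto simp: s0_def)
  have "exec ?P s (2 + ncost lo + u) s1"
    unfolding for_loop_def by (rule exec.Seq[OF e0 1(1)])
  moreover have "2 + ncost lo + u \<le> T" using 1(2) T by simp
  ultimately show ?thesis unfolding runs_def using Q[OF 1(3-5)] by blast
qed

text \<open>Carrying \<open>l \<le> p \<le> h\<close> in the invariant turns the exit condition of a
  unit step into \<open>p = h\<close>.\<close>

lemma runs_for:
  assumes fixed: "nexp_names hi \<inter> insert x (nwrites c) = {}" "x \<notin> nwrites c"
    and h: "nval hi s = h" "nval lo s = l" "l \<le> h"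
    and init: "I l (nat_update x 0 l s)"
    and step: "\<And>p s'. I p s' \<Longrightarrow> l \<le> p \<Longrightarrow> p < h \<Longrightarrow> nats s' x 0 = p \<Longrightarrow>
        agree_off (for_loop x lo hi (NConst 1) c) s s' \<Longrightarrow> runs c s' \<tau> (I (Suc p))"
    and stable: "\<And>p m s'. I p s' \<Longrightarrow> I p (nat_update x 0 m s')"
    and Q: "\<And>s'. I h s' \<Longrightarrow> agree_off (for_loop x lo hi (NConst 1) c) s s' \<Longrightarrow> Q s'"
    and T: "6 + ncost lo + ncost hi + (h - l) * (10 + ncost hi + \<tau>) \<le> T"
  shows "runs (for_loop x lo hi (NConst 1) c) s T Q"
proof (rule runs_for_step[where I = "\<lambda>p s'. l \<le> p \<and> p \<le> h \<and> I p s'" and \<tau> = \<tau>])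
  fix p s' assume "l \<le> p \<and> p \<le> h \<and> I p s'" "p < h" "nats s' x 0 = p"
    "agree_off (for_loop x lo hi (NConst 1) c) s s'"
  with step[of p s'] show "runs c s' \<tau> (\<lambda>s''. l \<le> p + 1 \<and> p + 1 \<le> h \<and> I (p + 1) s'')"
    by (auto intro: runs_conseq)
qed (use assms in \<open>auto simp: add_ac\<close>)

text \<open>The table has rows of length \<open>m\<close> and starts at address \<open>b\<close>.\<close>

lemma runs_tabulate:
  fixes x y hi hi' :: name and c :: com and b :: nat
  defines "P \<equiv> for_loop x (NConst 0) (NRead hi (NConst 0)) (NConst 1)
    (for_loop y (NConst 0) (NRead hi' (NConst 0)) (NConst 1) c)"
  assumes c: "loop_free c" "overhead c \<le> 100" "x \<notin> nwrites c" "y \<notin> nwrites c" "x \<noteq> y"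
    "{hi, hi'} \<inter> insert x (insert y (nwrites c)) = {}"
    and nm: "nats s hi 0 = n" "nats s hi' 0 = m"
    and step: "\<And>i j s'. i < n \<Longrightarrow> j < m \<Longrightarrow> agree_off P s s' \<Longrightarrow> nats s' x 0 = i \<Longrightarrow> nats s' y 0 = j \<Longrightarrow>
      reals s' z (b + (i * m + j)) = reals s z (b + (i * m + j)) \<Longrightarrow>
      reals (effect c s') z = (reals s' z)(b + (i * m + j) := g i j)"
    and Q: "\<And>s'. (\<And>i j. i < n \<Longrightarrow> j < m \<Longrightarrow> reals s' z (b + (i * m + j)) = g i j) \<Longrightarrow>
      (\<And>a. a < b \<or> b + n * m \<le> a \<Longrightarrow> reals s' z a = reals s z a) \<Longrightarrow> agree_off P s s' \<Longrightarrow> Q s'"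
    and T: "9 + n * (21 + 112 * m) \<le> T"
  shows "runs P s T Q"
proof -
  let ?in = "for_loop y (NConst 0) (NRead hi' (NConst 0)) (NConst 1) c"
  \<comment> \<open>Cells before \<open>(i, j)\<close> in row-major order are final, the others
    still have their initial content. The latter lets a body read the old value of the cell that it
    overwrites.\<close>
  define I where "I = (\<lambda>i j (s' :: state).
    (\<forall>i'<n. \<forall>j'<m. reals s' z (b + (i' * m + j')) =
       (if i' < i \<or> i' = i \<and> j' < j then g i' j' else reals s z (b + (i' * m + j')))) \<and>
    (\<forall>a. a < b \<or> b + n * m \<le> a \<longrightarrow> reals s' z a = reals s z a))"
  have I_next: "I (Suc i) 0 s'" if "I i m s'" for i s'
    using that unfolding I_def by (auto simp: less_Suc_eq)
  have I_upd: "I i j (nat_update r a q s') = I i j s'" for i j r a q s' by (simp add: I_def)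
  show ?thesis unfolding P_def
  proof (rule runs_for[where I = "\<lambda>i. I i 0" and h = n and l = 0 and \<tau> = "9 + 112 * m"])
    fix i s' assume I: "I i 0 s'" and i: "i < n" "nats s' x 0 = i"
      and ag: "agree_off (for_loop x (NConst 0) (NRead hi (NConst 0)) (NConst 1) ?in) s s'"
    note eq = agree_off_nats[OF ag]
    show "runs ?in s' (9 + 112 * m) (I (Suc i) 0)"
    proof (rule runs_for[where I = "I i" and h = m and l = 0 and \<tau> = 100])
      fix j s'' assume I: "I i j s''" and j: "j < m" "nats s'' y 0 = j" and ag': "agree_off ?in s' s''"
      have "agree_off P s s''"
        using ag agree_off_mono[OF ag', of P] unfolding P_def by (auto intro: agree_off_trans)
      moreover have "nats s'' x 0 = i" using agree_off_nats[OF ag', of x] c i by simp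
      moreover have "reals s'' z (b + (i * m + j)) = reals s z (b + (i * m + j))"
        using I i j by (simp add: I_def)
      ultimately have e: "reals (effect c s'') z = (reals s'' z)(b + (i * m + j) := g i j)"
        using step i(1) j by blast
      have "i * m + j < n * m" using i(1) j(1) by (rule row_major_less)
      then have "I i (Suc j) (effect c s'')"
        using I i j unfolding I_def e by (auto simp: row_major_eq_iff less_Suc_eq)
      with c show "runs c s'' 100 (I i (Suc j))" by (intro runs_loop_free)
    qed (use c nm I I_next in \<open>auto simp: I_upd eq\<close>)
  next
    fix s' assume "I n 0 s'" "agree_off (for_loop x (NConst 0) (NRead hi (NConst 0)) (NConst 1) ?in) s s'"
    then show "Q s'" by (intro Q) (auto simp: I_def P_def)
  next
    show "6 + ncost (NConst 0) + ncost (NRead hi (NConst 0)) +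
       (n - 0) * (10 + ncost (NRead hi (NConst 0)) + (9 + 112 * m)) \<le> T" using T by (simp add: algebra_simps)
  qed (use c nm in \<open>auto simp: I_upd I_def\<close>)
qed

lemma runs_Loop_True:
  "bval b s \<Longrightarrow> runs c s T P \<Longrightarrow> (\<And>s'. P s' \<Longrightarrow> agree_off c s s' \<Longrightarrow> runs (Loop b c) s' U Q) \<Longrightarrow>
     1 + bcost b + T + U \<le> V \<Longrightarrow> runs (Loop b c) s V Q"
  unfolding runs_def using exec.Loop_True exec_agree_off
  by (meson add_le_mono le_refl order_trans)

lemma runs_Loop_False: "\<not> bval b s \<Longrightarrow> Q s \<Longrightarrow> 1 + bcost b \<le> V \<Longrightarrow> runs (Loop b c) s V Q"
  unfolding runs_def using exec.Loop_False by blast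

text \<open>The simulation yields the final state, the termination lemma the time; determinism makes
  them statements about one run. The remaining fuel is a trustworthy success flag: if it is positive
  then \<open>Q\<close> holds, and it is 0 only if \<open>F \<le> T\<close>.\<close>

lemma runs_limit:
  assumes "runs c (nat_update x 0 F s) T Q" "x \<notin> com_names c"
    "\<And>s' f. Q s' \<Longrightarrow> Q (nat_update x 0 f s')"
  shows "runs (limit x c) (nat_update x 0 F s) (overhead c * (1 + F))
    (\<lambda>s'. nats s' x 0 = 0 \<and> F \<le> T \<or> 0 < nats s' x 0 \<and> Q s')"
proof -
  let ?s = "nat_update x 0 F s"
  obtain t s' where t: "exec c ?s t s'" "t \<le> T" "Q s'" using assms(1) unfolding runs_def by blast
  obtain u f s2 where u: "exec (limit x c) ?s u s2"
    "F \<le> t \<and> nats s2 x 0 = 0 \<or> F \<le> f + t \<and> s2 = nat_update x 0 f s'"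
    using limit_simulates[OF t(1) assms(2), of F] by auto
  obtain u' s2' where u': "exec (limit x c) ?s u' s2'" "u' \<le> overhead c * (1 + F - nats s2' x 0)"
    using limit_terminates[OF assms(2), of ?s] by auto
  have "u = u'" using exec_deterministic[OF u(1) u'(1)] by simp
  moreover have "overhead c * (1 + F - nats s2' x 0) \<le> overhead c * (1 + F)"
    by (intro mult_le_mono2) simp
  ultimately have "u \<le> overhead c * (1 + F)" using u'(2) by linarith
  moreover have "nats s2 x 0 = 0 \<and> F \<le> T \<or> 0 < nats s2 x 0 \<and> Q s2"
    using u(2)
  proof
    assume "F \<le> f + t \<and> s2 = nat_update x 0 f s'"
    with t(2) assms(3)[OF t(3)] show ?thesis by (cases "f = 0") auto
  qed (use t in auto)
  ultimately show ?thesis using u(1) unfolding runs_def by blast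
qed

text \<open>Repeated addition stands in for multiplication by a constant. The cost grows with
  \<open>m\<close> but not with the data.\<close>

fun scaled :: "nat \<Rightarrow> nexp \<Rightarrow> nexp" where
  "scaled 0 e = NConst 0"
| "scaled (Suc m) e = NAdd e (scaled m e)"

lemma nval_scaled [simp]: "nval (scaled m e) s = m * nval e s"
  by (induction m) auto


subsection \<open>Selection\<close>

text \<open>Breaking ties by index makes this a strict linear order, so every trader has a definite
  position even if prices coincide.\<close>

definition precedes :: "(nat \<Rightarrow> real) \<Rightarrow> nat \<Rightarrow> nat \<Rightarrow> bool" where
  "precedes f t u \<longleftrightarrow> f t < f u \<or> f t = f u \<and> t < u"

text \<open>The value \<open>N\<close> stands for the minimum of the empty set.\<close>

definition is_least :: "(nat \<Rightarrow> real) \<Rightarrow> nat \<Rightarrow> nat set \<Rightarrow> nat \<Rightarrow> bool" where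
  "is_least f N S m \<longleftrightarrow> (S = {} \<and> m = N) \<or> (m \<in> S \<and> (\<forall>t\<in>S. t = m \<or> precedes f m t))"

text \<open>All indices in \<open>S\<close> are smaller than those in \<open>S'\<close>, so a tie
  goes to \<open>S\<close> and the strict comparison of values decides. The tests against
  \<open>N\<close> handle the default of an empty side.\<close>

lemma is_least_union:
  assumes "is_least f N S m" "is_least f N S' m'" "S \<subseteq> {..<N}" "S' \<subseteq> {..<N}"
    "\<And>t u. t \<in> S \<Longrightarrow> u \<in> S' \<Longrightarrow> t < u"
  shows "is_least f N (S \<union> S') (if m' < N \<and> \<not> (m < N \<and> \<not> f m' < f m) then m' else m)"
proof (cases "S = {} \<or> S' = {}")
  case True
  with assms show ?thesis by (auto simp: is_least_def)
next
  case False
  with assms have m: "m \<in> S" "\<And>t. t \<in> S \<Longrightarrow> t = m \<or> precedes f m t"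
    and m': "m' \<in> S'" "\<And>t. t \<in> S' \<Longrightarrow> t = m' \<or> precedes f m' t"
    unfolding is_least_def by blast+
  have "m < N" "m' < N" "m < m'" using m(1) m'(1) assms(3-5) by auto
  with m m' show ?thesis unfolding is_least_def
    by (auto simp: precedes_def) fastforce+
qed

definition selected :: "(nat \<Rightarrow> real) \<Rightarrow> nat \<Rightarrow> nat \<Rightarrow> (nat \<Rightarrow> nat) \<Rightarrow> (nat \<Rightarrow> nat) \<Rightarrow> bool" where
  "selected f N r L p \<longleftrightarrow> (\<forall>q<r. L q < N \<and> p (L q) = q) \<and>
     (\<forall>q<r. \<forall>t<N. t \<notin> L ` {..q} \<longrightarrow> precedes f (L q) t)"

lemma selected_Suc:
  assumes "selected f N r L p" "is_least f N ({..<N} - L ` {..<r}) m" "m < N"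
  shows "selected f N (Suc r) (L(r := m)) (p(m := r))"
proof -
  from assms(2,3) have m: "m \<notin> L ` {..<r}"
    "\<And>t. t < N \<Longrightarrow> t \<notin> L ` {..<r} \<Longrightarrow> t = m \<or> precedes f m t"
    unfolding is_least_def by auto
  have im: "(L(r := m)) ` {..q} = L ` {..q}" if "q < r" for q
    using that by (intro image_cong) auto
  have "(L(r := m)) ` {..r} = insert m (L ` {..<r})"
    by (simp add: lessThan_Suc_atMost[symmetric] lessThan_Suc fun_upd_image del: fun_upd_apply) auto
  note im_r = this
  show ?thesis unfolding selected_def
  proof (intro conjI allI impI)
    fix q assume "q < Suc r"
    then show "(L(r := m)) q < N" "(p(m := r)) ((L(r := m)) q) = q"
      using assms(1,3) m(1) by (cases "q = r"; force simp: selected_def less_Suc_eq)+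
  next
    fix q t assume q: "q < Suc r" and t: "t < N" "t \<notin> (L(r := m)) ` {..q}"
    show "precedes f ((L(r := m)) q) t"
    proof (cases "q = r")
      case True
      with t im_r have "t \<noteq> m" "t \<notin> L ` {..<r}" by blast+
      with m(2)[OF t(1)] True show ?thesis by simp
    next
      case False
      with q have "q < r" by simp
      with t im assms(1) False show ?thesis by (simp add: selected_def)
    qed
  qed
qed

definition sorted_order :: "(nat \<Rightarrow> real) \<Rightarrow> nat \<Rightarrow> (nat \<Rightarrow> nat) \<Rightarrow> (nat \<Rightarrow> nat) \<Rightarrow> bool" where
  "sorted_order f N L p \<longleftrightarrow> (\<forall>q<N. L q < N \<and> p (L q) = q) \<and> (\<forall>t<N. p t < N \<and> L (p t) = t) \<and>
     (\<forall>t<N. \<forall>u<N. p t < p u \<longleftrightarrow> precedes f t u)"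

text \<open>\<open>p\<close> inverts \<open>L\<close>, so \<open>L\<close> is injective on a finite
  set mapped into itself, hence a permutation. An element at a later position was not yet listed
  when an earlier one was chosen, which gives one direction of the order statement; linearity of
  \<open>precedes\<close> gives the other.\<close>

lemma sorted_order_if_selected:
  assumes "selected f N N L p"
  shows "sorted_order f N L p"
proof -
  have L: "\<And>q. q < N \<Longrightarrow> L q < N \<and> p (L q) = q"
    and lt: "\<And>q t. q < N \<Longrightarrow> t < N \<Longrightarrow> t \<notin> L ` {..q} \<Longrightarrow> precedes f (L q) t"
    using assms unfolding selected_def by blast+
  have "inj_on L {..<N}" using L by (intro inj_on_inverseI[of _ p]) auto
  moreover have "L ` {..<N} \<subseteq> {..<N}" using L by auto
  ultimately have im: "L ` {..<N} = {..<N}" by (intro endo_inj_surj) auto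
  have p: "p t < N \<and> L (p t) = t" if "t < N" for t
  proof -
    from that im obtain q where "q < N" "t = L q" by blast
    with L show ?thesis by auto
  qed
  have fwd: "precedes f t u" if "t < N" "u < N" "p t < p u" for t u
  proof -
    have "u \<notin> L ` {..p t}"
    proof
      assume "u \<in> L ` {..p t}"
      then obtain q where q: "q \<le> p t" "u = L q" by blast
      with p[OF that(1)] have "q < N" by linarith
      with L[of q] q that(3) show False by simp
    qed
    with lt[of "p t" u] p that show ?thesis by auto
  qed
  have "p t < p u" if "t < N" "u < N" "precedes f t u" for t u
  proof (rule ccontr)
    assume "\<not> p t < p u"
    then have "p u < p t \<or> t = u" using p that by (metis linorder_neqE_nat)
    with fwd[of u t] that show False by (auto simp: precedes_def)
  qed
  with fwd L p show ?thesis unfolding sorted_order_def by blast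
qed

lemma aligned_block_unique:
  fixes w :: nat
  assumes "w dvd a" "w dvd b" "a \<le> t" "t < a + w" "b \<le> t" "t < b + w"
  shows "a = b"
proof -
  from assms(1,2) obtain i j where ij: "a = w * i" "b = w * j" by (auto elim!: dvdE)
  have "t div w = i" "t div w = j"
    using assms(3-6) ij by (auto intro!: div_nat_eqI simp: algebra_simps)
  with ij show ?thesis by simp
qed


subsection \<open>Sorting the traders of one commodity\<close>

datatype var = Buyers | Commodities | Traders | Width | Fuel | Budget | Done | TimesK | TimesN
  | VarI | VarJ | VarL | VarT | VarR | VarQ | Lo | Alive | BlockMin | Best | BestBlock | Current
  | Order | Position | Val | Present | Pay | Res nat

definition io_names :: "name set" where
  "io_names = {''n'', ''k'', ''A'', ''B'', ''AB'', ''buyer_goods'', ''max_price'',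
     ''seller_goods'', ''reserve_price'', ''C'', ''P'', ''R''}"

text \<open>The multiplication program may use any names for its own purposes, so the surrounding
  arrays are abstract variables named apart from it. For arrays of naturals this covers reading as
  well as writing; it keeps the fuel cell invisible to the program being limited.\<close>

locale fresh_names =
  fixes v :: "var \<Rightarrow> name" and mm :: com
  assumes v_eq_iff [simp]: "v x = v y \<longleftrightarrow> x = y"
    and v_notin_com_names [simp]: "v x \<notin> com_names mm"
    and v_notin_rwrites [simp]: "v x \<notin> rwrites mm"
    and v_notin_io_names: "v x \<notin> io_names"
begin

lemma v_neq_io [simp]:
  "x \<in> io_names \<Longrightarrow> v y \<noteq> x" "x \<in> io_names \<Longrightarrow> x \<noteq> v y"
  using v_notin_io_names by auto

lemma v_notin_nwrites [simp]: "v x \<notin> nwrites mm"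
  using v_notin_com_names nwrites_subset_com_names by blast

abbreviation rd :: "var \<Rightarrow> nexp" where
  "rd x \<equiv> NRead (v x) (NConst 0)"

abbreviation assign :: "var \<Rightarrow> nexp \<Rightarrow> com" where
  "assign x e \<equiv> NAssign (v x) (NConst 0) e"

abbreviation count :: "var \<Rightarrow> var \<Rightarrow> com \<Rightarrow> com" where
  "count x h c \<equiv> for_loop (v x) (NConst 0) (rd h) (NConst 1) c"

text \<open>The sellers are the traders \<open>0, \<dots>, n - 1\<close> and the buyers the traders
  \<open>n, \<dots>, 2n - 1\<close>, so that a seller precedes a buyer naming the same price. Multiples of \<open>k\<close> and
  \<open>n\<close> are tabulated, because the machine does not multiply natural numbers.\<close>

definition sized :: "nat \<Rightarrow> nat \<Rightarrow> state \<Rightarrow> bool" where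
  "sized n k s \<longleftrightarrow> 1 \<le> n \<and> 1 \<le> k \<and>
     nats s (v Buyers) 0 = n \<and> nats s (v Commodities) 0 = k \<and> nats s (v Traders) 0 = 2 * n \<and>
     (\<forall>t\<le>2 * n. nats s (v TimesK) t = t * k) \<and> (\<forall>i\<le>n + k. nats s (v TimesN) i = i * n)"

definition cell :: "nexp \<Rightarrow> nexp" where
  "cell t = NAdd (NRead (v TimesK) t) (rd VarL)"

text \<open>Arrays indexed by a commodity and one of the \<open>2n\<close> traders have rows of length \<open>2n\<close>.\<close>

definition slot :: "nexp \<Rightarrow> nexp" where
  "slot r = NAdd (NAdd (NRead (v TimesN) (rd VarL)) (NRead (v TimesN) (rd VarL))) r"

text \<open>Truncated subtraction turns this into \<open>min (Lo + Width) Traders\<close>.\<close>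

definition block_end :: nexp where
  "block_end = NSub (NAdd (rd Lo) (rd Width)) (NSub (NAdd (rd Lo) (rd Width)) (rd Traders))"

text \<open>The index \<open>2 * n\<close> stands for no candidate and is beaten by everything. A
  candidate with an equal value is not beaten, so scanning upwards keeps the smaller index.\<close>

definition beats :: "nexp \<Rightarrow> nexp \<Rightarrow> bexp" where
  "beats e g = BNot (BAnd (NLess g (rd Traders))
     (BNot (RLess (RRead (v Val) (cell e)) (RRead (v Val) (cell g)))))"

text \<open>A block is named by its first index, and its minimum is stored at that address;
  numbering the blocks would call for a division by \<open>Width\<close>.\<close>

definition rescan :: com where
  "rescan = Seq (assign Current (rd Traders))
    (Seq (for_loop (v VarT) (rd Lo) block_end (NConst 1)
        (Cond (BAnd (NLess (NConst 0) (NRead (v Alive) (rd VarT))) (beats (rd VarT) (rd Current)))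
          (assign Current (rd VarT)) Skip))
      (NAssign (v BlockMin) (rd Lo) (rd Current)))"

definition find_best :: com where
  "find_best = Seq (assign Best (rd Traders))
     (for_loop (v Lo) (NConst 0) (rd Traders) (rd Width)
       (Cond (BAnd (NLess (NRead (v BlockMin) (rd Lo)) (rd Traders))
           (beats (NRead (v BlockMin) (rd Lo)) (rd Best)))
         (Seq (assign Best (NRead (v BlockMin) (rd Lo))) (assign BestBlock (rd Lo))) Skip))"

text \<open>Deleting the minimum invalidates the minimum of its own block only, and
  \<open>BestBlock\<close> remembers which one that is. A selection thus costs a pass over the block
  minima and a pass over one block, instead of a pass over all traders.\<close>

definition select_next :: com where
  "select_next = Seq find_best (Seq
     (Seq (NAssign (v Order) (slot (rd VarR)) (rd Best))
       (Seq (NAssign (v Position) (slot (rd Best)) (rd VarR))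
         (Seq (NAssign (v Alive) (rd Best) (NConst 0)) (assign Lo (rd BestBlock)))))
     rescan)"

definition sort_one :: com where
  "sort_one =
     Seq (count VarT Traders (NAssign (v Alive) (rd VarT) (NConst 1)))
     (Seq (for_loop (v Lo) (NConst 0) (rd Traders) (rd Width) rescan)
       (count VarR Traders select_next))"

definition sort_all :: com where
  "sort_all = count VarL Commodities sort_one"

lemma writes_rescan [simp]:
  "nwrites rescan = {v Current, v VarT, v BlockMin}" "rwrites rescan = {}"
  by (auto simp: rescan_def)

lemma writes_find_best [simp]:
  "nwrites find_best = {v Best, v BestBlock, v Lo}" "rwrites find_best = {}"
  by (auto simp: find_best_def)

lemma writes_select_next [simp]:
  "nwrites select_next = {v Current, v VarT, v BlockMin, v Best, v BestBlock, v Lo, v Order, v Position, v Alive}"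
  "rwrites select_next = {}"
  by (auto simp: select_next_def)

lemma writes_sort_one [simp]:
  "nwrites sort_one = {v Current, v VarT, v BlockMin, v Best, v BestBlock, v Lo, v Order, v Position,
     v Alive, v VarR}" "rwrites sort_one = {}"
  by (auto simp: sort_one_def)

lemma writes_sort_all [simp]:
  "nwrites sort_all = {v Current, v VarT, v BlockMin, v Best, v BestBlock, v Lo, v Order, v Position,
     v Alive, v VarR, v VarL}" "rwrites sort_all = {}"
  by (auto simp: sort_all_def)

definition alive :: "nat \<Rightarrow> state \<Rightarrow> nat set" where
  "alive n s = {t. t < 2 * n \<and> nats s (v Alive) t \<noteq> 0}"

definition valuation :: "nat \<Rightarrow> nat \<Rightarrow> state \<Rightarrow> nat \<Rightarrow> real" where
  "valuation k l s t = reals s (v Val) (t * k + l)"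

text \<open>The search may try widths beyond the number of traders, and a block is cut off at
  \<open>2 * n\<close> in any case; hence \<open>min w (2 * n)\<close> in the time.\<close>

lemma runs_rescan:
  assumes sz: "sized n k s" and vals: "nats s (v Width) 0 = w" "nats s (v VarL) 0 = l"
    "nats s (v Lo) 0 = lo" and lo: "lo < 2 * n"
  shows "runs rescan s (100 + 100 * min w (2 * n)) (\<lambda>s'.
    is_least (valuation k l s) (2 * n) (alive n s \<inter> {lo..<lo + w}) (nats s' (v BlockMin) lo) \<and>
    (\<forall>\<beta>. \<beta> \<noteq> lo \<longrightarrow> nats s' (v BlockMin) \<beta> = nats s (v BlockMin) \<beta>))"
proof -
  let ?f = "valuation k l s" and ?N = "2 * n" and ?S = "alive n s"
  define h where "h = min (lo + w) ?N"
  have h: "lo \<le> h" "h \<le> ?N" "h - lo \<le> min w ?N" using lo by (auto simp: h_def)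
  have Sh: "?S \<inter> {lo..<lo + w} = ?S \<inter> {lo..<h}" by (auto simp: h_def alive_def)
  define I where "I = (\<lambda>p (s' :: state). p \<le> ?N \<and> is_least ?f ?N (?S \<inter> {lo..<p}) (nats s' (v Current) 0))"
  let ?body = "Cond (BAnd (NLess (NConst 0) (NRead (v Alive) (rd VarT))) (beats (rd VarT) (rd Current)))
          (assign Current (rd VarT)) Skip"
  show ?thesis unfolding rescan_def
  proof (rule runs_Seq_loop_free)
    define s1 where "s1 = effect (assign Current (rd Traders)) s"
    have s1: "nats s1 = nats (nat_update (v Current) 0 ?N s)" "reals s1 = reals s"
      using sz by (simp_all add: s1_def sized_def)
    show "runs (Seq (for_loop (v VarT) (rd Lo) block_end (NConst 1) ?body)
       (NAssign (v BlockMin) (rd Lo) (rd Current))) (effect (assign Current (rd Traders)) s)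
      (90 + 100 * min w (2 * n))
      (\<lambda>s'. is_least ?f ?N (?S \<inter> {lo..<lo + w}) (nats s' (v BlockMin) lo) \<and>
        (\<forall>\<beta>. \<beta> \<noteq> lo \<longrightarrow> nats s' (v BlockMin) \<beta> = nats s (v BlockMin) \<beta>))"
      unfolding s1_def[symmetric]
    proof (rule runs_Seq)
      show "runs (for_loop (v VarT) (rd Lo) block_end (NConst 1) ?body) s1 (50 + 100 * min w (2 * n)) (I h)"
      proof (rule runs_for[where I = I and l = lo and h = h and \<tau> = 60])
        show "nval block_end s1 = h" using sz vals unfolding s1 h_def
          by (simp add: block_end_def sized_def s1)
        show "I lo (nat_update (v VarT) 0 lo s1)"
          using lo by (simp add: I_def is_least_def s1)
        fix p s' assume I: "I p s'" and p: "lo \<le> p" "p < h" "nats s' (v VarT) 0 = p"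
          and ag: "agree_off (for_loop (v VarT) (rd Lo) block_end (NConst 1) ?body) s1 s'"
        note eq = agree_off_nats[OF ag] agree_off_reals[OF ag]
        have cur: "is_least ?f ?N (?S \<inter> {lo..<p}) (nats s' (v Current) 0)" using I by (simp add: I_def)
        then have c: "nats s' (v Current) 0 \<le> ?N" by (auto simp: is_least_def alive_def)
        have sz': "nats s' (v Traders) 0 = ?N" "\<And>t. t \<le> ?N \<Longrightarrow> nats s' (v TimesK) t = t * k"
          "nats s' (v VarL) 0 = l"
          using sz vals by (simp_all add: eq s1 sized_def)
        have f: "reals s' (v Val) (t * k + l) = ?f t" for t
          by (simp add: eq s1 valuation_def)
        have al: "nats s' (v Alive) = nats s (v Alive)" by (simp add: eq s1)
        have S: "?S \<inter> {lo..<Suc p} = (?S \<inter> {lo..<p}) \<union> (if nats s (v Alive) p \<noteq> 0 then {p} else {})"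
          using p h by (auto simp: alive_def less_Suc_eq)
        define m where "m = nats s' (v Current) 0"
        have p': "p < ?N" using p h by simp
        have un: "is_least ?f ?N (?S \<inter> {lo..<Suc p})
            (if nats s (v Alive) p \<noteq> 0 \<and> \<not> (m < ?N \<and> \<not> ?f p < ?f m) then p else m)"
        proof (cases "nats s (v Alive) p = 0")
          case True
          with cur show ?thesis unfolding S m_def by simp
        next
          case False
          have "is_least ?f ?N (?S \<inter> {lo..<p} \<union> {p}) (if p < ?N \<and> \<not> (m < ?N \<and> \<not> ?f p < ?f m) then p else m)"
            unfolding m_def
          proof (rule is_least_union[OF cur])
            show "?S \<inter> {lo..<p} \<subseteq> {..<?N}" by (auto simp: alive_def)
          qed (use p' in \<open>auto simp: is_least_def\<close>)
          with False p' show ?thesis unfolding S by simp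
        qed
        have "bval (BAnd (NLess (NConst 0) (NRead (v Alive) (rd VarT))) (beats (rd VarT) (rd Current))) s'
            \<longleftrightarrow> nats s (v Alive) p \<noteq> 0 \<and> \<not> (m < ?N \<and> \<not> ?f p < ?f m)"
          using p' c by (simp add: beats_def cell_def sz' f al p(3) m_def)
        then have eff: "nats (effect ?body s') (v Current) 0 =
            (if nats s (v Alive) p \<noteq> 0 \<and> \<not> (m < ?N \<and> \<not> ?f p < ?f m) then p else m)"
          by (simp add: p(3) m_def)
        show "runs ?body s' 60 (I (Suc p))"
        proof (rule runs_loop_free)
          show "I (Suc p) (effect ?body s')"
            unfolding I_def eff using un p' by (simp only: Suc_le_eq simp_thms)
        qed (simp_all add: beats_def cell_def)
      qed (use vals h in \<open>auto simp: I_def block_end_def s1 intro: order_trans\<close>)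
    next
      fix s2 assume I: "I h s2"
        and ag: "agree_off (for_loop (v VarT) (rd Lo) block_end (NConst 1) ?body) s1 s2"
      note eq = agree_off_nats[OF ag]
      show "runs (NAssign (v BlockMin) (rd Lo) (rd Current)) s2 10
        (\<lambda>s'. is_least ?f ?N (?S \<inter> {lo..<lo + w}) (nats s' (v BlockMin) lo) \<and>
        (\<forall>\<beta>. \<beta> \<noteq> lo \<longrightarrow> nats s' (v BlockMin) \<beta> = nats s (v BlockMin) \<beta>))"
        by (rule runs_loop_free) (use I vals in \<open>auto simp: I_def Sh eq s1\<close>)
    qed simp
  qed simp_all
qed

section \<open>The overall minimum from the minima of the blocks\<close>

definition blocks :: "nat \<Rightarrow> nat \<Rightarrow> nat" where
  "blocks n w = (2 * n + (w - 1)) div w"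

definition block_mins :: "nat \<Rightarrow> nat \<Rightarrow> nat \<Rightarrow> nat \<Rightarrow> state \<Rightarrow> bool" where
  "block_mins n k w l s \<longleftrightarrow> (\<forall>\<beta><2 * n. w dvd \<beta> \<longrightarrow>
     is_least (valuation k l s) (2 * n) (alive n s \<inter> {\<beta>..<\<beta> + w}) (nats s (v BlockMin) \<beta>))"

lemma is_least_le: "is_least f N S m \<Longrightarrow> S \<subseteq> {..<N} \<Longrightarrow> m \<le> N"
  by (auto simp: is_least_def)

lemma alive_subset: "alive n s \<inter> X \<subseteq> {..<2 * n}"
  by (auto simp: alive_def)

lemma runs_find_best:
  assumes sz: "sized n k s" and vals: "nats s (v Width) 0 = w" "0 < w" "nats s (v VarL) 0 = l"
    and mins: "block_mins n k w l s" and ne: "alive n s \<noteq> {}"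
  shows "runs find_best s (50 + 100 * blocks n w) (\<lambda>s'.
    is_least (valuation k l s) (2 * n) (alive n s) (nats s' (v Best) 0) \<and>
    (let \<beta> = nats s' (v BestBlock) 0; m = nats s' (v Best) 0 in
       w dvd \<beta> \<and> \<beta> < 2 * n \<and> \<beta> \<le> m \<and> m < \<beta> + w))"
proof -
  let ?f = "valuation k l s" and ?N = "2 * n" and ?S = "alive n s"
  define I where "I = (\<lambda>p (s' :: state). w dvd p \<and>
    is_least ?f ?N (?S \<inter> {..<p}) (nats s' (v Best) 0) \<and>
    (?S \<inter> {..<p} \<noteq> {} \<longrightarrow> (let \<beta> = nats s' (v BestBlock) 0; m = nats s' (v Best) 0 in
       w dvd \<beta> \<and> \<beta> \<le> m \<and> m < \<beta> + w)))"
  let ?body = "Cond (BAnd (NLess (NRead (v BlockMin) (rd Lo)) (rd Traders))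
           (beats (NRead (v BlockMin) (rd Lo)) (rd Best)))
         (Seq (assign Best (NRead (v BlockMin) (rd Lo))) (assign BestBlock (rd Lo))) Skip"
  show ?thesis unfolding find_best_def
  proof (rule runs_Seq_loop_free)
    define s1 where "s1 = effect (assign Best (rd Traders)) s"
    have s1: "nats s1 = nats (nat_update (v Best) 0 ?N s)" "reals s1 = reals s"
      using sz by (simp_all add: s1_def sized_def)
    show "runs (for_loop (v Lo) (NConst 0) (rd Traders) (rd Width) ?body)
        (effect (assign Best (rd Traders)) s) (40 + 100 * blocks n w)
     (\<lambda>s'. is_least (valuation k l s) (2 * n) (alive n s) (nats s' (v Best) 0) \<and>
       (let \<beta> = nats s' (v BestBlock) 0; m = nats s' (v Best) 0 in
       w dvd \<beta> \<and> \<beta> < 2 * n \<and> \<beta> \<le> m \<and> m < \<beta> + w))"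
      unfolding s1_def[symmetric]
    proof (rule runs_for_step[where I = I and h = ?N and \<delta> = w and \<tau> = 80])
      show "nval (rd Traders) s1 = ?N" using sz by (simp add: s1 sized_def)
      show "I (nval (NConst 0) s1) (nat_update (v Lo) 0 (nval (NConst 0) s1) s1)"
        by (simp add: I_def is_least_def s1)
    next
      fix p s' assume I: "I p s'" and p: "p < ?N" "nats s' (v Lo) 0 = p"
        and ag: "agree_off (for_loop (v Lo) (NConst 0) (rd Traders) (rd Width) ?body) s1 s'"
      note eq = agree_off_nats[OF ag] agree_off_reals[OF ag]
      define m m' where "m = nats s' (v Best) 0" and "m' = nats s (v BlockMin) p"
      have bm: "nats s' (v BlockMin) = nats s (v BlockMin)" by (simp add: eq s1)
      have w: "w dvd p" and cur: "is_least ?f ?N (?S \<inter> {..<p}) m" using I by (simp_all add: I_def m_def)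
      have blk: "is_least ?f ?N (?S \<inter> {p..<p + w}) m'"
        using mins w p unfolding block_mins_def m'_def by blast
      have le: "m \<le> ?N" "m' \<le> ?N" using is_least_le[OF cur alive_subset] is_least_le[OF blk alive_subset] .
      have sz': "nats s' (v Traders) 0 = ?N" "\<And>t. t \<le> ?N \<Longrightarrow> nats s' (v TimesK) t = t * k"
        "nats s' (v VarL) 0 = l"
        using sz vals by (simp_all add: eq s1 sized_def)
      have f: "reals s' (v Val) (t * k + l) = ?f t" for t
        by (simp add: eq s1 valuation_def)
      define c where "c \<longleftrightarrow> m' < ?N \<and> \<not> (m < ?N \<and> \<not> ?f m' < ?f m)"
      have split: "?S \<inter> {..<p + w} = ?S \<inter> {..<p} \<union> ?S \<inter> {p..<p + w}" by auto
      then have un: "is_least ?f ?N (?S \<inter> {..<p + w}) (if c then m' else m)"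
        using is_least_union[OF cur blk alive_subset alive_subset, folded c_def] by auto
      have "bval (BAnd (NLess (NRead (v BlockMin) (rd Lo)) (rd Traders))
           (beats (NRead (v BlockMin) (rd Lo)) (rd Best))) s' \<longleftrightarrow> c"
        using le by (simp add: c_def beats_def cell_def sz' f p(2) bm m_def m'_def)
      note cond = this
      have eff: "nats (effect ?body s') (v Best) 0 = (if c then m' else m)"
        "nats (effect ?body s') (v BestBlock) 0 = (if c then p else nats s' (v BestBlock) 0)"
        unfolding effect.simps cond by (simp_all add: p(2) m_def m'_def bm)
      have "w dvd (if c then p else nats s' (v BestBlock) 0) \<and>
          (if c then p else nats s' (v BestBlock) 0) \<le> (if c then m' else m) \<and>
          (if c then m' else m) < (if c then p else nats s' (v BestBlock) 0) + w"
        if ne': "?S \<inter> {..<p + w} \<noteq> {}"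
      proof (cases c)
        case True
        then have "m' < ?N" by (simp add: c_def)
        then have "m' \<in> ?S \<inter> {p..<p + w}" using blk by (auto simp: is_least_def)
        with True w show ?thesis by auto
      next
        case False
        \<comment> \<open>With nothing alive before \<open>p\<close>, \<open>m\<close> is the
          default \<open>2 * n\<close>; then a rejected \<open>m'\<close> is the default too and the
          block is empty.\<close>
        have "?S \<inter> {..<p} \<noteq> {}"
        proof
          assume e: "?S \<inter> {..<p} = {}"
          with cur have "m = ?N" by (simp add: is_least_def)
          with False le have "m' = ?N" by (auto simp: c_def)
          with blk have "?S \<inter> {p..<p + w} = {}" using alive_subset[of n s "{p..<p + w}"]
            unfolding is_least_def by blast
          with e ne' split show False by simp
        qed
        with I False show ?thesis by (auto simp: I_def Let_def m_def)
      qed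
      with un w have "I (p + w) (effect ?body s')"
        unfolding I_def eff Let_def by simp
      then show "runs ?body s' 80 (I (p + w))"
        by (intro runs_loop_free) (simp_all add: beats_def cell_def)
    next
      fix p s' assume "I p s'" "?N \<le> p"
      moreover from \<open>?N \<le> p\<close> have "?S \<inter> {..<p} = ?S" by (auto simp: alive_def)
      ultimately have P: "is_least ?f ?N ?S (nats s' (v Best) 0)"
        "let \<beta> = nats s' (v BestBlock) 0; m = nats s' (v Best) 0 in w dvd \<beta> \<and> \<beta> \<le> m \<and> m < \<beta> + w"
        using ne unfolding I_def by simp_all
      from P(1) ne have "nats s' (v Best) 0 \<in> ?S" unfolding is_least_def by blast
      then have "nats s' (v Best) 0 < ?N" by (simp add: alive_def)
      with P show "is_least ?f ?N ?S (nats s' (v Best) 0) \<and>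
        (let \<beta> = nats s' (v BestBlock) 0; m = nats s' (v Best) 0 in
          w dvd \<beta> \<and> \<beta> < ?N \<and> \<beta> \<le> m \<and> m < \<beta> + w)"
        unfolding Let_def by (meson order_le_less_trans)
    qed (use vals in \<open>auto simp: I_def s1 blocks_def\<close>)
  qed simp_all
qed

definition order_of :: "nat \<Rightarrow> nat \<Rightarrow> state \<Rightarrow> nat \<Rightarrow> nat" where
  "order_of n l s q = nats s (v Order) (l * (2 * n) + q)"

definition position_of :: "nat \<Rightarrow> nat \<Rightarrow> state \<Rightarrow> nat \<Rightarrow> nat" where
  "position_of n l s t = nats s (v Position) (l * (2 * n) + t)"

text \<open>The keys are taken from the state \<open>s0\<close> before sorting. The last conjunct
  protects the commodities already sorted, whose entries occupy the lower addresses of the same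
  arrays.\<close>

definition selection_inv :: "nat \<Rightarrow> nat \<Rightarrow> nat \<Rightarrow> nat \<Rightarrow> state \<Rightarrow> nat \<Rightarrow> state \<Rightarrow> bool" where
  "selection_inv n k w l s0 r s \<longleftrightarrow>
     selected (valuation k l s0) (2 * n) r (order_of n l s) (position_of n l s) \<and>
     alive n s = {..<2 * n} - order_of n l s ` {..<r} \<and>
     (\<forall>\<beta><2 * n. w dvd \<beta> \<longrightarrow> is_least (valuation k l s0) (2 * n)
        (alive n s \<inter> {\<beta>..<\<beta> + w}) (nats s (v BlockMin) \<beta>)) \<and>
     (\<forall>a<l * (2 * n). nats s (v Order) a = nats s0 (v Order) a \<and>
        nats s (v Position) a = nats s0 (v Position) a)"

lemma selection_inv_cong:
  assumes "nats s' (v Order) = nats s (v Order)" "nats s' (v Position) = nats s (v Position)"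
    "nats s' (v Alive) = nats s (v Alive)" "nats s' (v BlockMin) = nats s (v BlockMin)"
  shows "selection_inv n k w l s0 r s' = selection_inv n k w l s0 r s"
proof -
  have "order_of n l s' = order_of n l s" "position_of n l s' = position_of n l s" "alive n s' = alive n s"
    using assms by (simp_all add: order_of_def position_of_def alive_def fun_eq_iff)
  then show ?thesis unfolding selection_inv_def assms by (simp only:)
qed

lemma runs_select_next:
  assumes sz: "sized n k s" and vals: "nats s (v Width) 0 = w" "0 < w" "nats s (v VarL) 0 = l"
    "l < k" "nats s (v VarR) 0 = r" "r < 2 * n"
    and f: "reals s (v Val) = reals s0 (v Val)"
    and inv: "selection_inv n k w l s0 r s"
  shows "runs select_next s (250 + 100 * blocks n w + 100 * min w (2 * n)) (selection_inv n k w l s0 (Suc r))"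
proof -
  let ?f = "valuation k l s0" and ?N = "2 * n" and ?S = "alive n s"
  let ?upd = "Seq (NAssign (v Order) (slot (rd VarR)) (rd Best))
       (Seq (NAssign (v Position) (slot (rd Best)) (rd VarR))
         (Seq (NAssign (v Alive) (rd Best) (NConst 0)) (assign Lo (rd BestBlock))))"
  have val: "valuation k l s = ?f" by (simp add: valuation_def f fun_eq_iff)
  have S: "?S = {..<?N} - order_of n l s ` {..<r}" using inv by (simp add: selection_inv_def)
  have mins: "block_mins n k w l s" using inv unfolding block_mins_def selection_inv_def val by blast
  \<comment> \<open>Only \<open>r < 2 * n\<close> traders have been chosen, so one is still alive
    and the default does not occur as a minimum.\<close>
  have "card (order_of n l s ` {..<r}) \<le> r" using card_image_le[of "{..<r}" "order_of n l s"] by simp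
  then have ne: "?S \<noteq> {}" using vals(6) card_mono[of "order_of n l s ` {..<r}" "{..<?N}"] unfolding S by auto
  show ?thesis unfolding select_next_def
  proof (rule runs_Seq[OF runs_find_best[OF sz vals(1-3) mins ne, unfolded val]])
    fix s1 assume P: "is_least ?f ?N ?S (nats s1 (v Best) 0) \<and>
       (let \<beta> = nats s1 (v BestBlock) 0; m = nats s1 (v Best) 0
        in w dvd \<beta> \<and> \<beta> < 2 * n \<and> \<beta> \<le> m \<and> m < \<beta> + w)"
      and ag: "agree_off find_best s s1"
    note eq = agree_off_nats[OF ag] agree_off_reals[OF ag]
    have rs: "reals s1 = reals s" using ag by (auto simp: agree_off_def)
    define m \<beta> where "m = nats s1 (v Best) 0" and "\<beta> = nats s1 (v BestBlock) 0"
    have m: "is_least ?f ?N ?S m" and \<beta>: "w dvd \<beta>" "\<beta> < ?N" "\<beta> \<le> m" "m < \<beta> + w"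
      using P by (simp_all add: Let_def m_def \<beta>_def)
    have mS: "m \<in> ?S" using m ne by (auto simp: is_least_def)
    then have mN: "m < ?N" by (simp add: alive_def)
    define s2 where "s2 = effect ?upd s1"
    have TN: "nats s (v TimesN) l = l * n" using sz vals(4) by (simp add: sized_def)
    have dbl: "l * n + l * n = l * (2 * n)" by simp
    have s2: "nats s2 = (nats s1)(v Order := (nats s (v Order))(l * ?N + r := m),
        v Position := (nats s (v Position))(l * ?N + m := r),
        v Alive := (nats s (v Alive))(m := 0), v Lo := (nats s1 (v Lo))(0 := \<beta>))"
      "reals s2 = reals s"
      by (simp_all add: s2_def slot_def eq rs TN m_def \<beta>_def vals dbl)
    have sz2: "sized n k s2" using sz by (simp add: sized_def s2 eq)
    have al2: "alive n s2 = ?S - {m}" by (auto simp: alive_def s2)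
    have ord2: "order_of n l s2 = (order_of n l s)(r := m)"
      by (auto simp: order_of_def s2 fun_eq_iff)
    have pos2: "position_of n l s2 = (position_of n l s)(m := r)"
      by (auto simp: position_of_def s2 fun_eq_iff)
    have sel: "selected ?f ?N (Suc r) (order_of n l s2) (position_of n l s2)"
      unfolding ord2 pos2
      by (rule selected_Suc) (use inv m mN S in \<open>simp_all add: selection_inv_def\<close>)
    show "runs (Seq ?upd rescan) s1 (200 + 100 * min w (2 * n)) (selection_inv n k w l s0 (Suc r))"
    proof (rule runs_Seq_loop_free)
      have "runs rescan s2 (100 + 100 * min w ?N) (\<lambda>s'.
        is_least (valuation k l s2) ?N (alive n s2 \<inter> {\<beta>..<\<beta> + w}) (nats s' (v BlockMin) \<beta>) \<and>
        (\<forall>\<beta>'. \<beta>' \<noteq> \<beta> \<longrightarrow> nats s' (v BlockMin) \<beta>' = nats s2 (v BlockMin) \<beta>'))"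
        by (rule runs_rescan[OF sz2]) (use vals \<beta> in \<open>simp_all add: s2 eq\<close>)
      then show "runs rescan (effect ?upd s1) (100 + 100 * min w ?N) (selection_inv n k w l s0 (Suc r))"
        unfolding s2_def[symmetric]
      proof (rule runs_conseq)
        fix s3
        assume P: "is_least (valuation k l s2) ?N (alive n s2 \<inter> {\<beta>..<\<beta> + w}) (nats s3 (v BlockMin) \<beta>) \<and>
          (\<forall>\<beta>'. \<beta>' \<noteq> \<beta> \<longrightarrow> nats s3 (v BlockMin) \<beta>' = nats s2 (v BlockMin) \<beta>')"
          and ag: "agree_off rescan s2 s3"
        note eq3 = agree_off_nats[OF ag] agree_off_reals[OF ag]
        have val2: "valuation k l s2 = ?f" by (simp add: valuation_def s2 f fun_eq_iff)
        have same: "order_of n l s3 = order_of n l s2" "position_of n l s3 = position_of n l s2"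
          "alive n s3 = alive n s2"
          by (simp_all add: order_of_def position_of_def alive_def eq3 fun_eq_iff)
        have "is_least ?f ?N (alive n s3 \<inter> {b..<b + w}) (nats s3 (v BlockMin) b)"
          if b: "b < ?N" "w dvd b" for b
        proof (cases "b = \<beta>")
          case True
          with P same val2 show ?thesis by simp
        next
          case False
          \<comment> \<open>Aligned blocks are disjoint, so the deleted \<open>m\<close> lay in no
            block but its own and the other minima stay valid.\<close>
          then have "\<not> (b \<le> m \<and> m < b + w)"
            using aligned_block_unique[OF b(2) \<beta>(1) _ _ \<beta>(3,4)] by blast
          then have "alive n s3 \<inter> {b..<b + w} = ?S \<inter> {b..<b + w}" unfolding same al2 by auto
          moreover have "nats s3 (v BlockMin) b = nats s (v BlockMin) b"
            using P False by (simp add: s2 eq)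
          moreover have "is_least ?f ?N (?S \<inter> {b..<b + w}) (nats s (v BlockMin) b)"
            using inv b unfolding selection_inv_def by blast
          ultimately show ?thesis by (simp only:)
        qed
        moreover have "alive n s3 = {..<?N} - order_of n l s3 ` {..<Suc r}"
          unfolding same al2 S ord2 by (auto simp: image_iff less_Suc_eq)
        moreover have "nats s3 (v Order) a = nats s0 (v Order) a \<and>
            nats s3 (v Position) a = nats s0 (v Position) a" if "a < l * ?N" for a
          using inv that by (simp add: eq3 s2 eq selection_inv_def)
        ultimately show "selection_inv n k w l s0 (Suc r) s3"
          using sel unfolding selection_inv_def same by blast
      qed simp
    qed (simp_all add: slot_def)
  qed simp
qed


section \<open>Sorting one commodity, then all of them\<close>

lemma blocks_le: "1 \<le> n \<Longrightarrow> 0 < w \<Longrightarrow> blocks n w \<le> 2 * n"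
proof -
  assume "1 \<le> n" "0 < w"
  then have "1 * (w - 1) \<le> 2 * n * (w - 1)" by (intro mult_le_mono1) simp
  then have "2 * n + (w - 1) \<le> 2 * n + 2 * n * (w - 1)" by simp
  also have "\<dots> = 2 * n * w" using \<open>0 < w\<close> by (cases w) auto
  finally have "blocks n w \<le> 2 * n * w div w" unfolding blocks_def by (rule div_le_mono)
  with \<open>0 < w\<close> show ?thesis by simp
qed

text \<open>At most of the order \<open>n * (n / w + w + 1)\<close>. Over all \<open>k\<close>
  commodities the part with \<open>w\<close> is of the order \<open>n * k * w\<close>; the part with
  \<open>n / w\<close>, which is \<open>n * k\<close> per block, is charged to the matrix products
  by means of \<open>n * k \<le> M n k\<close>.\<close>

definition sort_time :: "nat \<Rightarrow> nat \<Rightarrow> nat" where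
  "sort_time n w = 2 * n * (blocks n w + min w (2 * n) + 1)"

lemma runs_sort_one:
  assumes sz: "sized n k s" and vals: "nats s (v Width) 0 = w" "0 < w" "nats s (v VarL) 0 = l" "l < k"
  shows "runs sort_one s (1000 * sort_time n w) (\<lambda>s'.
    sorted_order (valuation k l s) (2 * n) (order_of n l s') (position_of n l s') \<and>
    (\<forall>a<l * (2 * n). nats s' (v Order) a = nats s (v Order) a \<and>
        nats s' (v Position) a = nats s (v Position) a))"
proof -
  let ?N = "2 * n" and ?f = "valuation k l s" and ?b = "min w (2 * n)"
  have n: "1 \<le> n" using sz by (simp add: sized_def)
  have N: "nval (rd Traders) s = ?N" using sz by (simp add: sized_def)
  let ?post = "\<lambda>s'. sorted_order ?f ?N (order_of n l s') (position_of n l s') \<and> (\<forall>a<l * (2 * n). nats s' (v Order) a = nats s (v Order) a \<and> nats s' (v Position) a = nats s (v Position) a)"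
  let ?init = "count VarT Traders (NAssign (v Alive) (rd VarT) (NConst 1))"
  let ?mins = "for_loop (v Lo) (NConst 0) (rd Traders) (rd Width) rescan"
  let ?main = "count VarR Traders select_next"
  show ?thesis unfolding sort_one_def
  proof (rule runs_Seq)
    show "runs ?init s (10 + 30 * ?N) (\<lambda>s'. \<forall>t<?N. nats s' (v Alive) t = 1)"
    proof (rule runs_for[where I = "\<lambda>p (s' :: state). \<forall>t<p. nats s' (v Alive) t = 1" and \<tau> = 10])
      fix p and s' :: state assume "\<forall>t<p. nats s' (v Alive) t = 1" "nats s' (v VarT) 0 = p"
      then show "runs (NAssign (v Alive) (rd VarT) (NConst 1)) s' 10
          (\<lambda>s'. \<forall>t<Suc p. nats s' (v Alive) t = 1)"
        by (intro runs_loop_free) (auto simp: less_Suc_eq)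
    qed (use N in auto)
  next
    fix s1 assume al: "\<forall>t<?N. nats s1 (v Alive) t = 1" and ag: "agree_off ?init s s1"
    note eq1 = agree_off_nats[OF ag] agree_off_reals[OF ag]
    have al1: "alive n s1 = {..<?N}" using al by (auto simp: alive_def)
    show "runs (Seq ?mins ?main) s1 (30 + blocks n w * (200 + 100 * ?b) + ?N * (300 + 100 * blocks n w + 100 * ?b)) ?post"
    proof (rule runs_Seq)
      define I where "I = (\<lambda>p (s' :: state). w dvd p \<and> (\<forall>\<beta><p. \<beta> < ?N \<longrightarrow> w dvd \<beta> \<longrightarrow>
         is_least ?f ?N ({..<?N} \<inter> {\<beta>..<\<beta> + w}) (nats s' (v BlockMin) \<beta>)))"
      show "runs ?mins s1 (10 + blocks n w * (200 + 100 * ?b)) (\<lambda>s'. \<exists>p\<ge>?N. I p s')"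
      proof (rule runs_for_step[where I = I and h = ?N and \<delta> = w and \<tau> = "100 + 100 * ?b"])
        fix p s' assume I: "I p s'" and p: "p < ?N" "nats s' (v Lo) 0 = p" and ag: "agree_off ?mins s1 s'"
        note eq = agree_off_nats[OF ag] agree_off_reals[OF ag]
        have "sized n k s'" using sz by (simp add: sized_def eq eq1)
        note R = runs_rescan[OF this _ _ p(2,1), of w l]
        have al': "alive n s' = {..<?N}" using al1 by (simp add: alive_def eq)
        have f': "valuation k l s' = ?f" by (simp add: valuation_def eq eq1 fun_eq_iff)
        show "runs rescan s' (100 + 100 * ?b) (I (p + w))"
        proof (rule runs_conseq[OF R])
          fix s2 :: state assume P: "is_least (valuation k l s') ?N (alive n s' \<inter> {p..<p + w}) (nats s2 (v BlockMin) p) \<and>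
            (\<forall>\<beta>. \<beta> \<noteq> p \<longrightarrow> nats s2 (v BlockMin) \<beta> = nats s' (v BlockMin) \<beta>)"
          \<comment> \<open>From \<open>p\<close> up to \<open>p + w\<close> (exclusive) the only
            multiple of \<open>w\<close> is \<open>p\<close> itself, so the block just scanned is
            the only new one.\<close>
          have "\<beta> < p" if "\<beta> < p + w" "w dvd \<beta>" "\<beta> \<noteq> p" for \<beta>
          proof (rule ccontr)
            assume "\<not> \<beta> < p"
            with that aligned_block_unique[of w \<beta> p \<beta>] I vals(2) show False by (auto simp: I_def)
          qed
          then show "I (p + w) s2" using I P unfolding I_def al' f' by (metis dvd_add dvd_refl)
        qed (use vals in \<open>simp_all add: eq eq1\<close>)
      next
        show "6 + ncost (NConst 0) + ncost (rd Traders) + (?N - nval (NConst 0) s1 + (w - 1)) div w *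
            (9 + ncost (rd Traders) + ncost (rd Width) + (100 + 100 * ?b))
            \<le> 10 + blocks n w * (200 + 100 * ?b)"
          by (simp add: blocks_def) (rule le_SucI, rule mult_le_mono2, simp)
      qed (use N vals in \<open>auto simp: I_def eq1\<close>)
    next
      fix s2 :: state assume P: "\<exists>p\<ge>?N. w dvd p \<and> (\<forall>\<beta><p. \<beta> < ?N \<longrightarrow> w dvd \<beta> \<longrightarrow>
         is_least ?f ?N ({..<?N} \<inter> {\<beta>..<\<beta> + w}) (nats s2 (v BlockMin) \<beta>))"
        and ag: "agree_off ?mins s1 s2"
      note eq2 = agree_off_nats[OF ag] agree_off_reals[OF ag]
      show "runs ?main s2 (10 + ?N * (300 + 100 * blocks n w + 100 * ?b)) ?post"
      proof (rule runs_for[where I = "selection_inv n k w l s" and \<tau> = "250 + 100 * blocks n w + 100 * ?b"])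
        have "selection_inv n k w l s 0 s2"
          using P al1 unfolding selection_inv_def
          by (auto simp: selected_def alive_def eq2 eq1 dest: order_less_le_trans)
        then show "selection_inv n k w l s 0 (nat_update (v VarR) 0 0 s2)"
          by (subst selection_inv_cong[of _ s2]) simp_all
      next
        fix p s' assume "selection_inv n k w l s p s'" "p < ?N" "nats s' (v VarR) 0 = p"
          and ag: "agree_off ?main s2 s'"
        moreover note eq = agree_off_nats[OF ag] agree_off_reals[OF ag]
        moreover have "sized n k s'" using sz by (simp add: sized_def eq eq1 eq2)
        ultimately show "runs select_next s' (250 + 100 * blocks n w + 100 * ?b) (selection_inv n k w l s (Suc p))"
          using vals by (intro runs_select_next) (simp_all add: eq eq1 eq2)
      next
        fix p m s' assume "selection_inv n k w l s p s'"
        then show "selection_inv n k w l s p (nat_update (v VarR) 0 m s')"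
          by (subst selection_inv_cong[of _ s']) simp_all
      next
        fix s' assume "selection_inv n k w l s ?N s'"
        then show "sorted_order ?f ?N (order_of n l s') (position_of n l s') \<and>
          (\<forall>a<l * (2 * n). nats s' (v Order) a = nats s (v Order) a \<and>
          nats s' (v Position) a = nats s (v Position) a)"
          by (simp add: selection_inv_def sorted_order_if_selected)
      next
        show "6 + ncost (NConst 0) + ncost (rd Traders) +
            (?N - 0) * (10 + ncost (rd Traders) + (250 + 100 * blocks n w + 100 * ?b))
            \<le> 10 + ?N * (300 + 100 * blocks n w + 100 * ?b)"
          by simp (rule le_SucI, rule mult_le_mono2, simp)
      qed (use N in \<open>auto simp: eq1 eq2\<close>)
    qed simp
  next
    have "blocks n w * (200 + 100 * ?b) \<le> ?N * (200 + 100 * ?b)"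
      by (rule mult_le_mono1[OF blocks_le[OF n vals(2)]])
    then show "10 + 30 * ?N + (30 + blocks n w * (200 + 100 * ?b) + ?N * (300 + 100 * blocks n w + 100 * ?b))
       \<le> 1000 * sort_time n w"
      using n unfolding sort_time_def by (simp add: algebra_simps)
  qed
qed

lemma sorted_order_cong:
  assumes "sorted_order f N L p" "\<And>q. q < N \<Longrightarrow> L' q = L q \<and> p' q = p q"
  shows "sorted_order f N L' p'"
  using assms unfolding sorted_order_def by (metis (no_types, lifting))

definition sorted_all :: "nat \<Rightarrow> nat \<Rightarrow> state \<Rightarrow> bool" where
  "sorted_all n k s \<longleftrightarrow>
     (\<forall>l<k. sorted_order (valuation k l s) (2 * n) (order_of n l s) (position_of n l s))"

lemma runs_sort_all:
  assumes sz: "sized n k s" and vals: "nats s (v Width) 0 = w" "0 < w"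
  shows "runs sort_all s (2000 * (k * sort_time n w)) (sorted_all n k)"
proof -
  let ?N = "2 * n"
  define I where "I = (\<lambda>p (s' :: state). \<forall>l<p. sorted_order (valuation k l s) ?N (order_of n l s') (position_of n l s'))"
  show ?thesis unfolding sort_all_def
  proof (rule runs_for[where I = I and h = k and l = 0 and \<tau> = "1000 * sort_time n w"])
    fix p s' assume I: "I p s'" and p: "p < k" "nats s' (v VarL) 0 = p"
      and ag: "agree_off (count VarL Commodities sort_one) s s'"
    note eq = agree_off_nats[OF ag] agree_off_reals[OF ag]
    have "sized n k s'" using sz by (simp add: sized_def eq)
    note R = runs_sort_one[OF this _ vals(2) p(2,1)]
    show "runs sort_one s' (1000 * sort_time n w) (I (Suc p))"
    proof (rule runs_conseq[OF R])
      fix s2 :: state assume P: "sorted_order (valuation k p s') ?N (order_of n p s2) (position_of n p s2) \<and>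
        (\<forall>a<p * ?N. nats s2 (v Order) a = nats s' (v Order) a \<and> nats s2 (v Position) a = nats s' (v Position) a)"
      have val: "valuation k p s' = valuation k p s" by (simp add: valuation_def eq fun_eq_iff)
      have "sorted_order (valuation k l s) ?N (order_of n l s2) (position_of n l s2)" if "l < Suc p" for l
      proof (cases "l = p")
        case True
        with P val show ?thesis by simp
      next
        case False
        with that have l: "l < p" by simp
        with I have "sorted_order (valuation k l s) ?N (order_of n l s') (position_of n l s')"
          by (simp add: I_def)
        then show ?thesis
          by (rule sorted_order_cong)
            (use P row_major_less[OF l, of _ ?N] in \<open>auto simp: order_of_def position_of_def\<close>)
      qed
      then show "I (Suc p) s2" by (simp add: I_def)
    qed (use vals in \<open>simp_all add: eq\<close>)
  next
    fix s' assume "I k s'"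
      and ag: "agree_off (count VarL Commodities sort_one) s s'"
    note eq = agree_off_nats[OF ag] agree_off_reals[OF ag]
    have val: "valuation k l s' = valuation k l s" for l by (simp add: valuation_def eq fun_eq_iff)
    from \<open>I k s'\<close> show "sorted_all n k s'" by (simp add: I_def sorted_all_def val)
  next
    have "1 \<le> sort_time n w" "1 \<le> k" using sz by (auto simp: sized_def sort_time_def)
    define X where "X = k * sort_time n w"
    have "k * 1 \<le> X" unfolding X_def using \<open>1 \<le> sort_time n w\<close> by (rule mult_le_mono2)
    moreover have "(k - 0) * (10 + ncost (rd Commodities) + 1000 * sort_time n w) = 12 * k + 1000 * X"
      by (simp add: X_def algebra_simps)
    ultimately show "6 + ncost (NConst 0) + ncost (rd Commodities) +
        (k - 0) * (10 + ncost (rd Commodities) + 1000 * sort_time n w) \<le> 2000 * (k * sort_time n w)"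
      using \<open>1 \<le> k\<close> unfolding X_def[symmetric] by simp
  qed (use sz in \<open>auto simp: I_def sized_def order_of_def[abs_def] position_of_def[abs_def]\<close>)
qed

subsection \<open>Weighted dominance sums\<close>

definition weight :: "nat \<Rightarrow> var \<Rightarrow> state \<Rightarrow> nat \<Rightarrow> nat \<Rightarrow> real" where
  "weight k x s l t = reals s (v x) (t * k + l)"

definition pair_cell :: nexp where
  "pair_cell = NAdd (NRead (v TimesN) (rd VarI)) (rd VarJ)"

definition clear :: "nat \<Rightarrow> com" where
  "clear d = count VarI Buyers
     (count VarJ Buyers (RAssign (v (Res d)) pair_cell RZero))"

definition fill_left :: "var \<Rightarrow> com" where
  "fill_left wb = (let t = NAdd (rd Buyers) (rd VarI); p = NRead (v Position) (slot t) in
     count VarI Buyers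
     (count VarL Commodities
       (Cond (BAnd (BNot (NLess p (rd Lo))) (NLess p (NAdd (rd Lo) (rd Width))))
         (RAssign ''A'' (cell (rd VarI)) (RRead (v wb) (cell t)))
         (RAssign ''A'' (cell (rd VarI)) RZero))))"

definition fill_right :: "var \<Rightarrow> com" where
  "fill_right ws = (let a = NAdd (NRead (v TimesN) (rd VarL)) (rd VarJ) in
     count VarL Commodities
     (count VarJ Buyers
       (Cond (NLess (NRead (v Position) (slot (rd VarJ))) (rd Lo))
         (RAssign ''B'' a (RRead (v ws) (cell (rd VarJ)))) (RAssign ''B'' a RZero))))"

text \<open>The sizes are rewritten on every call, because an earlier call may have changed
  them.\<close>

definition multiply :: com where
  "multiply = Seq (Seq (NAssign ''n'' (NConst 0) (rd Buyers)) (NAssign ''k'' (NConst 0) (rd Commodities))) mm"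

definition accumulate :: "nat \<Rightarrow> com" where
  "accumulate d = count VarI Buyers
     (count VarJ Buyers
       (RAssign (v (Res d)) pair_cell (RAdd (RRead (v (Res d)) pair_cell) (RRead ''AB'' pair_cell))))"

text \<open>\<open>across\<close> treats the pairs of a buyer in the current bucket and a seller in an earlier one,
  \<open>inside\<close> the pairs within the current bucket.\<close>

definition across :: "var \<Rightarrow> var \<Rightarrow> nat \<Rightarrow> com" where
  "across ws wb d = Seq (fill_left wb) (Seq (fill_right ws) (Seq multiply (accumulate d)))"

text \<open>The pairs of a bucket are enumerated by positions, the seller at the smaller one, so the
  sorted order takes the place of the price comparison. Buyers are numbered from \<open>n\<close>
  among the traders but from 0 in the result, hence the subtraction.\<close>

definition add_pair :: "var \<Rightarrow> var \<Rightarrow> nat \<Rightarrow> com" where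
  "add_pair ws wb d = (let t = NRead (v Order) (slot (rd VarR)); u = NRead (v Order) (slot (rd VarQ));
     a = NAdd (NRead (v TimesN) (NSub t (rd Buyers))) u in
     Cond (NLess u (rd Buyers))
      (RAssign (v (Res d)) a (RAdd (RRead (v (Res d)) a)
        (RMul (RRead (v wb) (cell t)) (RRead (v ws) (cell u))))) Skip)"

definition inside :: "var \<Rightarrow> var \<Rightarrow> nat \<Rightarrow> com" where
  "inside ws wb d = count VarL Commodities
    (for_loop (v VarR) (rd Lo) block_end (NConst 1)
      (Cond (BNot (NLess (NRead (v Order) (slot (rd VarR))) (rd Buyers)))
        (for_loop (v VarQ) (rd Lo) (rd VarR) (NConst 1) (add_pair ws wb d)) Skip))"

text \<open>The first bucket has no predecessor and is treated apart, without a product. This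
  matters when one bucket holds all traders: no product is then computed, and the number
  \<open>r\<close> of products satisfies \<open>r * w \<le> 2 * n\<close> for every positive
  width.\<close>

definition phase :: "var \<Rightarrow> var \<Rightarrow> nat \<Rightarrow> com" where
  "phase ws wb d = Seq sort_all (Seq (clear d) (Seq (assign Lo (NConst 0)) (Seq (inside ws wb d)
     (for_loop (v Lo) (rd Width) (rd Traders) (rd Width) (Seq (across ws wb d) (inside ws wb d))))))"

lemma writes_parts [simp]:
  "nwrites (clear d) = {v VarI, v VarJ}" "rwrites (clear d) = {v (Res d)}"
  "nwrites (fill_left wb) = {v VarI, v VarL}" "rwrites (fill_left wb) = {''A''}"
  "nwrites (fill_right ws) = {v VarL, v VarJ}" "rwrites (fill_right ws) = {''B''}"
  "nwrites multiply = insert ''n'' (insert ''k'' (nwrites mm))" "rwrites multiply = rwrites mm"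
  "nwrites (accumulate d) = {v VarI, v VarJ}" "rwrites (accumulate d) = {v (Res d)}"
  "nwrites (add_pair ws wb d) = {}" "rwrites (add_pair ws wb d) = {v (Res d)}"
  "nwrites (inside ws wb d) = {v VarL, v VarR, v VarQ}" "rwrites (inside ws wb d) = {v (Res d)}"
  by (auto simp: clear_def fill_left_def fill_right_def multiply_def accumulate_def add_pair_def
      inside_def Let_def)

lemma writes_across [simp]:
  "nwrites (across ws wb d) = {v VarI, v VarL, v VarJ, ''n'', ''k''} \<union> nwrites mm"
  "rwrites (across ws wb d) = {''A'', ''B'', v (Res d)} \<union> rwrites mm"
  by (auto simp: across_def)

lemma io_names_mem [simp]:
  "''n'' \<in> io_names" "''k'' \<in> io_names" "''A'' \<in> io_names" "''B'' \<in> io_names" "''AB'' \<in> io_names"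
  "''buyer_goods'' \<in> io_names" "''max_price'' \<in> io_names" "''seller_goods'' \<in> io_names"
  "''reserve_price'' \<in> io_names" "''C'' \<in> io_names" "''P'' \<in> io_names" "''R'' \<in> io_names"
  by (simp_all add: io_names_def)

lemma runs_clear:
  assumes sz: "sized n k s"
  shows "runs (clear d) s (9 + n * (21 + 112 * n)) (\<lambda>s'. \<forall>i<n. \<forall>j<n. reals s' (v (Res d)) (i * n + j) = 0)"
  unfolding clear_def
proof (rule runs_tabulate[where b = 0 and g = "\<lambda>_ _. 0" and n = n and m = n and z = "v (Res d)"])
  fix i j s'
  assume ij: "i < n" "j < n" and ag: "agree_off (count VarI Buyers
     (count VarJ Buyers (RAssign (v (Res d)) pair_cell RZero))) s s'"
    and vars: "nats s' (v VarI) 0 = i" "nats s' (v VarJ) 0 = j"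
  have "nats s' (v TimesN) i = i * n"
    using sz ij agree_off_nats[OF ag, of "v TimesN"] by (simp add: sized_def)
  with vars show "reals (effect (RAssign (v (Res d)) pair_cell RZero) s') (v (Res d)) =
      (reals s' (v (Res d)))(0 + (i * n + j) := 0)"
    by (simp add: pair_cell_def)
qed (use sz in \<open>auto simp: sized_def pair_cell_def\<close>)

lemma runs_accumulate:
  assumes sz: "sized n k s"
  shows "runs (accumulate d) s (9 + n * (21 + 112 * n)) (\<lambda>s'. \<forall>i<n. \<forall>j<n.
    reals s' (v (Res d)) (i * n + j) = reals s (v (Res d)) (i * n + j) + reals s ''AB'' (i * n + j))"
  unfolding accumulate_def
proof (rule runs_tabulate[where b = 0 and n = n and m = n and z = "v (Res d)" and
    g = "\<lambda>i j. reals s (v (Res d)) (i * n + j) + reals s ''AB'' (i * n + j)"])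
  let ?c = "RAssign (v (Res d)) pair_cell (RAdd (RRead (v (Res d)) pair_cell) (RRead ''AB'' pair_cell))"
  fix i j s'
  assume ij: "i < n" "j < n" and ag: "agree_off (count VarI Buyers
     (count VarJ Buyers ?c)) s s'"
    and vars: "nats s' (v VarI) 0 = i" "nats s' (v VarJ) 0 = j"
    and old: "reals s' (v (Res d)) (0 + (i * n + j)) = reals s (v (Res d)) (0 + (i * n + j))"
  have "nats s' (v TimesN) i = i * n"
    using sz ij agree_off_nats[OF ag, of "v TimesN"] by (simp add: sized_def)
  moreover have "reals s' ''AB'' = reals s ''AB''"
    using agree_off_reals[OF ag, of "''AB''"] by simp
  ultimately show "reals (effect ?c s') (v (Res d)) = (reals s' (v (Res d)))
      (0 + (i * n + j) := reals s (v (Res d)) (i * n + j) + reals s ''AB'' (i * n + j))"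
    using vars old by (simp add: pair_cell_def)
qed (use sz in \<open>auto simp: sized_def pair_cell_def\<close>)

lemma nval_slot:
  assumes "sized n k s" "nats s (v VarL) 0 = l" "l < k"
  shows "nval (slot e) s = l * (2 * n) + nval e s"
  using assms by (simp add: slot_def sized_def)

lemma nval_cell:
  assumes "sized n k s" "nats s (v VarL) 0 = l" "nval e s \<le> 2 * n"
  shows "nval (cell e) s = nval e s * k + l"
  using assms by (simp add: cell_def sized_def)

lemma runs_fill_left:
  assumes sz: "sized n k s" and vals: "nats s (v Lo) 0 = p" "nats s (v Width) 0 = w"
  shows "runs (fill_left wb) s (9 + n * (21 + 112 * k)) (\<lambda>s'. \<forall>i<n. \<forall>l<k.
    reals s' ''A'' (i * k + l) = (let q = position_of n l s (n + i) in
      if p \<le> q \<and> q < p + w then weight k wb s l (n + i) else 0))"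
  unfolding fill_left_def Let_def
proof (rule runs_tabulate[where b = 0 and n = n and m = k and z = "''A''" and
    g = "\<lambda>i l. if p \<le> position_of n l s (n + i) \<and> position_of n l s (n + i) < p + w
      then weight k wb s l (n + i) else 0"])
  let ?t = "NAdd (rd Buyers) (rd VarI)"
  let ?p = "NRead (v Position) (slot ?t)"
  let ?c = "Cond (BAnd (BNot (NLess ?p (rd Lo))) (NLess ?p (NAdd (rd Lo) (rd Width))))
         (RAssign ''A'' (cell (rd VarI)) (RRead (v wb) (cell ?t)))
         (RAssign ''A'' (cell (rd VarI)) RZero)"
  fix i l s'
  assume il: "i < n" "l < k" and ag: "agree_off (count VarI Buyers
     (count VarL Commodities ?c)) s s'"
    and vars: "nats s' (v VarI) 0 = i" "nats s' (v VarL) 0 = l"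
  note eq = agree_off_nats[OF ag] agree_off_reals[OF ag]
  have sz': "sized n k s'" using sz by (simp add: sized_def eq)
  have t: "nval ?t s' = n + i" using sz' vars by (simp add: sized_def)
  have a: "nval (slot ?t) s' = l * (2 * n) + (n + i)" "nval (cell ?t) s' = (n + i) * k + l"
    "nval (cell (rd VarI)) s' = i * k + l"
    using nval_slot[OF sz' vars(2) il(2), of ?t] nval_cell[OF sz' vars(2), of ?t]
      nval_cell[OF sz' vars(2), of "rd VarI"] t vars il by simp_all
  have "reals s' (v wb) = reals s (v wb)" by (simp add: eq)
  with a show "reals (effect ?c s') ''A'' = (reals s' ''A'')(0 + (i * k + l) :=
      if p \<le> position_of n l s (n + i) \<and> position_of n l s (n + i) < p + w
      then weight k wb s l (n + i) else 0)"
    using vals by (auto simp: eq position_of_def weight_def)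
qed (use sz in \<open>auto simp: sized_def cell_def slot_def\<close>)

lemma runs_fill_right:
  assumes sz: "sized n k s" and vals: "nats s (v Lo) 0 = p"
  shows "runs (fill_right ws) s (9 + k * (21 + 112 * n)) (\<lambda>s'. \<forall>l<k. \<forall>j<n.
    reals s' ''B'' (l * n + j) = (if position_of n l s j < p then weight k ws s l j else 0))"
  unfolding fill_right_def Let_def
proof (rule runs_tabulate[where b = 0 and n = k and m = n and z = "''B''" and
    g = "\<lambda>l j. if position_of n l s j < p then weight k ws s l j else 0"])
  let ?a = "NAdd (NRead (v TimesN) (rd VarL)) (rd VarJ)"
  let ?c = "Cond (NLess (NRead (v Position) (slot (rd VarJ))) (rd Lo))
         (RAssign ''B'' ?a (RRead (v ws) (cell (rd VarJ)))) (RAssign ''B'' ?a RZero)"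
  fix l j s'
  assume lj: "l < k" "j < n" and ag: "agree_off (count VarL Commodities
     (count VarJ Buyers ?c)) s s'"
    and vars: "nats s' (v VarL) 0 = l" "nats s' (v VarJ) 0 = j"
  note eq = agree_off_nats[OF ag] agree_off_reals[OF ag]
  have sz': "sized n k s'" using sz by (simp add: sized_def eq)
  have a: "nval (slot (rd VarJ)) s' = l * (2 * n) + j" "nval (cell (rd VarJ)) s' = j * k + l"
    "nval ?a s' = l * n + j"
    using nval_slot[OF sz' vars(1) lj(1), of "rd VarJ"] nval_cell[OF sz' vars(1), of "rd VarJ"]
      vars lj sz' by (simp_all add: sized_def)
  have "reals s' (v ws) = reals s (v ws)" by (simp add: eq)
  with a show "reals (effect ?c s') ''B'' = (reals s' ''B'')(0 + (l * n + j) :=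
      if position_of n l s j < p then weight k ws s l j else 0)"
    using vals by (auto simp: eq position_of_def weight_def)
qed (use sz in \<open>auto simp: sized_def cell_def slot_def\<close>)

lemma runs_multiply:
  assumes mm: "multiplies_within mm M" and sz: "sized n k s"
    and A: "\<And>i l. i < n \<Longrightarrow> l < k \<Longrightarrow> reals s ''A'' (i * k + l) = a i l"
    and B: "\<And>l j. l < k \<Longrightarrow> j < n \<Longrightarrow> reals s ''B'' (l * n + j) = b l j"
  shows "runs multiply s (20 + nat \<lfloor>M n k\<rfloor>) (\<lambda>s'. \<forall>i<n. \<forall>j<n.
    reals s' ''AB'' (i * n + j) = (\<Sum>l<k. a i l * b l j))"
  unfolding multiply_def
proof (rule runs_Seq_loop_free)
  let ?pre = "Seq (NAssign ''n'' (NConst 0) (rd Buyers)) (NAssign ''k'' (NConst 0) (rd Commodities))"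
  define s1 where "s1 = effect ?pre s"
  define mA mB where "mA = mat n k (\<lambda>(i, l). a i l)" and "mB = mat k n (\<lambda>(l, j). b l j)"
  have nk: "1 \<le> n" "1 \<le> k" using sz by (auto simp: sized_def)
  have "holds_sizes s1 n k" "holds_matrix s1 ''A'' mA" "holds_matrix s1 ''B'' mB"
    using sz A B by (auto simp: s1_def holds_sizes_def holds_matrix_def mA_def mB_def sized_def)
  moreover have "mA \<in> carrier_mat n k" "mB \<in> carrier_mat k n" by (auto simp: mA_def mB_def)
  ultimately obtain t s' where t: "exec mm s1 t s'" "real t \<le> M n k" "holds_matrix s' ''AB'' (mA * mB)"
    using mm nk unfolding multiplies_within_def by meson
  have "reals s' ''AB'' (i * n + j) = (\<Sum>l<k. a i l * b l j)" if "i < n" "j < n" for i j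
  proof -
    have "reals s' ''AB'' (i * n + j) = (mA * mB) $$ (i, j)"
      using t(3) that by (simp add: holds_matrix_def mA_def mB_def)
    also have "\<dots> = row mA i \<bullet> col mB j" using that by (simp add: mA_def mB_def)
    also have "\<dots> = (\<Sum>l\<in>{0..<k}. row mA i $ l * col mB j $ l)" by (simp add: scalar_prod_def mB_def)
    also have "\<dots> = (\<Sum>l<k. a i l * b l j)"
      using that by (intro sum.cong) (auto simp: mA_def mB_def)
    finally show ?thesis .
  qed
  \<comment> \<open>Running times are integers, so rounding \<open>M n k\<close> down loses
    nothing.\<close>
  moreover have "t \<le> nat \<lfloor>M n k\<rfloor>" using t(2) by linarith
  ultimately show "runs mm (effect ?pre s) (nat \<lfloor>M n k\<rfloor>) (\<lambda>s'. \<forall>i<n. \<forall>j<n.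
      reals s' ''AB'' (i * n + j) = (\<Sum>l<k. a i l * b l j))"
    using t(1) unfolding runs_def s1_def by blast
qed auto

definition across_time :: "(nat \<Rightarrow> nat \<Rightarrow> real) \<Rightarrow> nat \<Rightarrow> nat \<Rightarrow> nat" where
  "across_time M n k = 50 + n * (21 + 112 * k) + k * (21 + 112 * n) + n * (21 + 112 * n) + nat \<lfloor>M n k\<rfloor>"

lemma runs_across:
  assumes mm: "multiplies_within mm M" and sz: "sized n k s"
    and vals: "nats s (v Lo) 0 = p" "nats s (v Width) 0 = w"
  shows "runs (across ws wb d) s (across_time M n k) (\<lambda>s'. \<forall>i<n. \<forall>j<n.
    reals s' (v (Res d)) (i * n + j) = reals s (v (Res d)) (i * n + j) +
     (\<Sum>l<k. (let q = position_of n l s (n + i) in if p \<le> q \<and> q < p + w then weight k wb s l (n + i) else 0) *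
       (if position_of n l s j < p then weight k ws s l j else 0)))"
  unfolding across_def
proof (rule runs_Seq[OF runs_fill_left[OF sz vals]])
  let ?a = "\<lambda>i l. let q = position_of n l s (n + i) in if p \<le> q \<and> q < p + w then weight k wb s l (n + i) else 0"
  let ?b = "\<lambda>l j. if position_of n l s j < p then weight k ws s l j else 0"
  let ?post = "\<lambda>s'. \<forall>i<n. \<forall>j<n. reals s' (v (Res d)) (i * n + j) =
    reals s (v (Res d)) (i * n + j) + (\<Sum>l<k. ?a i l * ?b l j)"
  fix s1 assume A: "\<forall>i<n. \<forall>l<k. reals s1 ''A'' (i * k + l) = ?a i l"
    and ag1: "agree_off (fill_left wb) s s1"
  note eq1 = agree_off_nats[OF ag1] agree_off_reals[OF ag1]
  have sz1: "sized n k s1" using sz by (simp add: sized_def eq1)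
  have vals1: "nats s1 (v Lo) 0 = p" using vals by (simp add: eq1)
  show "runs (Seq (fill_right ws) (Seq multiply (accumulate d))) s1
      (38 + k * (21 + 112 * n) + n * (21 + 112 * n) + nat \<lfloor>M n k\<rfloor>) ?post"
  proof (rule runs_Seq[OF runs_fill_right[OF sz1 vals1]])
    fix s2 assume B: "\<forall>l<k. \<forall>j<n. reals s2 ''B'' (l * n + j) =
        (if position_of n l s1 j < p then weight k ws s1 l j else 0)"
      and ag2: "agree_off (fill_right ws) s1 s2"
    note eq2 = agree_off_nats[OF ag2] agree_off_reals[OF ag2]
    have sz2: "sized n k s2" using sz1 by (simp add: sized_def eq2)
    show "runs (Seq multiply (accumulate d)) s2 (29 + n * (21 + 112 * n) + nat \<lfloor>M n k\<rfloor>) ?post"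
    proof (rule runs_Seq[OF runs_multiply[OF mm sz2, of ?a ?b]])
      fix s3 assume C: "\<forall>i<n. \<forall>j<n. reals s3 ''AB'' (i * n + j) = (\<Sum>l<k. ?a i l * ?b l j)"
        and ag3: "agree_off multiply s2 s3"
      note eq3 = agree_off_nats[OF ag3] agree_off_reals[OF ag3]
      have sz3: "sized n k s3" using sz2 by (simp add: sized_def eq3)
      show "runs (accumulate d) s3 (9 + n * (21 + 112 * n)) ?post"
        by (rule runs_conseq[OF runs_accumulate[OF sz3]]) (use C in \<open>simp_all add: eq3 eq2 eq1\<close>)
    qed (use A B in \<open>simp_all add: eq2 eq1 position_of_def weight_def\<close>)
  qed simp
qed (simp add: across_time_def)

section \<open>Pairs within one bucket\<close>

lemma position_bij:
  assumes "sorted_all n k s" "l < k"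
  shows "t < 2 * n \<Longrightarrow> position_of n l s t < 2 * n"
    and "q < 2 * n \<Longrightarrow> order_of n l s q < 2 * n"
    and "t < 2 * n \<Longrightarrow> q < 2 * n \<Longrightarrow> position_of n l s t = q \<longleftrightarrow> t = order_of n l s q"
    and "t < 2 * n \<Longrightarrow> u < 2 * n \<Longrightarrow>
      position_of n l s t < position_of n l s u \<longleftrightarrow> precedes (valuation k l s) t u"
  using assms unfolding sorted_all_def sorted_order_def by auto

text \<open>With the buyer at position \<open>r\<close> fixed, position \<open>q\<close> contributes
  to at most one cell, in the column of the seller found there. Order and position are inverse to
  each other, so the cell of seller \<open>j\<close> receives its term exactly when \<open>q\<close>
  reaches the position of \<open>j\<close>.\<close>

lemma runs_add_pairs:
  assumes sz: "sized n k s" and sorted: "sorted_all n k s" and l: "nats s (v VarL) 0 = l" "l < k"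
    and pr: "nats s (v Lo) 0 = p" "nats s (v VarR) 0 = r" "p \<le> r" "r < 2 * n"
    and t: "n \<le> order_of n l s r" and ne: "wb \<noteq> Res d" "ws \<noteq> Res d"
  shows "runs (for_loop (v VarQ) (rd Lo) (rd VarR) (NConst 1) (add_pair ws wb d)) s (10 + 212 * (r - p))
    (\<lambda>s'. \<forall>i<n. \<forall>j<n. reals s' (v (Res d)) (i * n + j) = reals s (v (Res d)) (i * n + j) +
      (if n + i = order_of n l s r \<and> p \<le> position_of n l s j \<and> position_of n l s j < r
       then weight k wb s l (n + i) * weight k ws s l j else 0))"
proof -
  let ?P = "for_loop (v VarQ) (rd Lo) (rd VarR) (NConst 1) (add_pair ws wb d)"
  let ?t = "order_of n l s r"
  define I where "I = (\<lambda>q (s' :: state). \<forall>i<n. \<forall>j<n.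
    reals s' (v (Res d)) (i * n + j) = reals s (v (Res d)) (i * n + j) +
      (if n + i = ?t \<and> p \<le> position_of n l s j \<and> position_of n l s j < q
       then weight k wb s l (n + i) * weight k ws s l j else 0))"
  have tN: "?t < 2 * n" using position_bij(2)[OF sorted l(2)] pr by simp
  show ?thesis
  proof (rule runs_for[where I = I and l = p and h = r and \<tau> = 200])
    fix q s' assume I: "I q s'" and q: "p \<le> q" "q < r" "nats s' (v VarQ) 0 = q" and ag: "agree_off ?P s s'"
    note eq = agree_off_nats[OF ag] agree_off_reals[OF ag]
    have sz': "sized n k s'" using sz by (simp add: sized_def eq)
    have l': "nats s' (v VarL) 0 = l" using l by (simp add: eq)
    define u where "u = order_of n l s q"
    have uN: "u < 2 * n" using position_bij(2)[OF sorted l(2), of q] q pr by (simp add: u_def)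
    have ord: "nats s' (v Order) (l * (2 * n) + q) = u" "nats s' (v Order) (l * (2 * n) + r) = ?t"
      by (simp_all add: eq u_def order_of_def)
    have a: "nval (slot (rd VarR)) s' = l * (2 * n) + r" "nval (slot (rd VarQ)) s' = l * (2 * n) + q"
      using nval_slot[OF sz' l' l(2)] pr q by (simp_all add: eq)
    have c: "nval (cell (NRead (v Order) (slot (rd VarR)))) s' = ?t * k + l"
      "nval (cell (NRead (v Order) (slot (rd VarQ)))) s' = u * k + l"
      by (subst nval_cell[OF sz' l'], use a ord tN uN in simp_all)+
    have B: "nats s' (v Buyers) 0 = n" "nats s' (v TimesN) (?t - n) = (?t - n) * n"
      using sz' tN by (simp_all add: sized_def)
    have wt: "reals s' (v wb) (?t * k + l) = weight k wb s l ?t" "reals s' (v ws) (u * k + l) = weight k ws s l u"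
      using ne by (simp_all add: weight_def eq)
    have eff: "effect (add_pair ws wb d) s' = (if u < n then
        real_update (v (Res d)) ((?t - n) * n + u) (reals s' (v (Res d)) ((?t - n) * n + u) +
          weight k wb s l ?t * weight k ws s l u) s' else s')"
      by (simp add: add_pair_def Let_def a c ord B wt)
    have "I (Suc q) (effect (add_pair ws wb d) s')"
      unfolding I_def
    proof (intro allI impI)
      fix i j assume ij: "i < n" "j < n"
      have pos: "position_of n l s j = q \<longleftrightarrow> j = u"
        using position_bij(3)[OF sorted l(2), of j q] ij q pr by (simp add: u_def)
      \<comment> \<open>The trader at position \<open>r\<close> is a buyer, so the subtraction does
        not truncate.\<close>
      have it: "n + i = ?t \<longleftrightarrow> i = ?t - n" using t by auto
      have old: "reals s' (v (Res d)) (i * n + j) = reals s (v (Res d)) (i * n + j) +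
        (if n + i = ?t \<and> p \<le> position_of n l s j \<and> position_of n l s j < q
         then weight k wb s l (n + i) * weight k ws s l j else 0)" using I ij by (simp add: I_def)
      show "reals (effect (add_pair ws wb d) s') (v (Res d)) (i * n + j) = reals s (v (Res d)) (i * n + j) +
        (if n + i = ?t \<and> p \<le> position_of n l s j \<and> position_of n l s j < Suc q
         then weight k wb s l (n + i) * weight k ws s l j else 0)"
      proof (cases "i = ?t - n \<and> j = u")
        case True
        then have "n + i = ?t" "u < n" "position_of n l s j = q" using it pos ij by auto
        with old True q(1) show ?thesis unfolding eff by simp
      next
        case False
        have "reals (effect (add_pair ws wb d) s') (v (Res d)) (i * n + j) = reals s' (v (Res d)) (i * n + j)"
          using False ij row_major_eq_iff[of j n u i "?t - n"] unfolding eff by auto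
        moreover have "(n + i = ?t \<and> p \<le> position_of n l s j \<and> position_of n l s j < Suc q) \<longleftrightarrow>
          (n + i = ?t \<and> p \<le> position_of n l s j \<and> position_of n l s j < q)"
          using False it pos by (auto simp: less_Suc_eq)
        ultimately show ?thesis using old by simp
      qed
    qed
    then show "runs (add_pair ws wb d) s' 200 (I (Suc q))"
      by (intro runs_loop_free) (simp_all add: add_pair_def Let_def slot_def cell_def)
  qed (use pr in \<open>auto simp: I_def\<close>)
qed

definition inside_time :: "nat \<Rightarrow> nat \<Rightarrow> nat \<Rightarrow> nat" where
  "inside_time n k w = 9 + k * (34 + min w (2 * n) * (54 + 212 * min w (2 * n)))"

lemma runs_inside:
  assumes sz: "sized n k s" and sorted: "sorted_all n k s"
    and vals: "nats s (v Lo) 0 = p" "p < 2 * n" "nats s (v Width) 0 = w"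
    and ne: "wb \<noteq> Res d" "ws \<noteq> Res d"
  shows "runs (inside ws wb d) s (inside_time n k w) (\<lambda>s'. \<forall>i<n. \<forall>j<n.
    reals s' (v (Res d)) (i * n + j) = reals s (v (Res d)) (i * n + j) +
     (\<Sum>l<k. if p \<le> position_of n l s j \<and> position_of n l s j < position_of n l s (n + i) \<and>
        position_of n l s (n + i) < p + w
       then weight k wb s l (n + i) * weight k ws s l j else 0))"
proof -
  define h where "h = min (p + w) (2 * n)"
  have h: "p \<le> h" "h \<le> 2 * n" "h - p \<le> min w (2 * n)" using vals by (auto simp: h_def)
  let ?b = "min w (2 * n)"
  \<comment> \<open>\<open>R\<close> bounds the position of the buyer: the inner loop raises it from
    \<open>p\<close>, where the term is 0, to the end of the bucket.\<close>
  define e where "e = (\<lambda>l i j R. if p \<le> position_of n l s j \<and>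
      position_of n l s j < position_of n l s (n + i) \<and> position_of n l s (n + i) < R
      then weight k wb s l (n + i) * weight k ws s l j else 0)"
  define I where "I = (\<lambda>l (s' :: state). \<forall>i<n. \<forall>j<n.
    reals s' (v (Res d)) (i * n + j) = reals s (v (Res d)) (i * n + j) + (\<Sum>l'<l. e l' i j (p + w)))"
  define J where "J = (\<lambda>l r (s' :: state). \<forall>i<n. \<forall>j<n.
    reals s' (v (Res d)) (i * n + j) = reals s (v (Res d)) (i * n + j) + (\<Sum>l'<l. e l' i j (p + w)) + e l i j r)"
  let ?pairs = "for_loop (v VarQ) (rd Lo) (rd VarR) (NConst 1) (add_pair ws wb d)"
  let ?body = "Cond (BNot (NLess (NRead (v Order) (slot (rd VarR))) (rd Buyers))) ?pairs Skip"
  let ?mid = "for_loop (v VarR) (rd Lo) block_end (NConst 1) ?body"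
  show ?thesis unfolding inside_def
  proof (rule runs_for[where I = I and l = 0 and h = k and \<tau> = "22 + ?b * (54 + 212 * ?b)"])
    fix l s1 assume I: "I l s1" and l: "l < k" "nats s1 (v VarL) 0 = l"
      and ag: "agree_off (count VarL Commodities ?mid) s s1"
    note eq1 = agree_off_nats[OF ag] agree_off_reals[OF ag]
    have end1: "nval block_end s1 = h"
      using sz vals by (simp add: block_end_def eq1 sized_def h_def)
    show "runs ?mid s1 (22 + ?b * (54 + 212 * ?b)) (I (Suc l))"
    proof (rule runs_for[where I = "J l" and l = p and h = h and \<tau> = "30 + 212 * ?b"])
      show "J l p (nat_update (v VarR) 0 p s1)" using I by (simp add: I_def J_def e_def)
    next
      fix r s2 assume J: "J l r s2" and r: "p \<le> r" "r < h" "nats s2 (v VarR) 0 = r"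
        and ag: "agree_off ?mid s1 s2"
      note eq2 = agree_off_nats[OF ag] agree_off_reals[OF ag]
      have sz2: "sized n k s2" using sz by (simp add: sized_def eq2 eq1)
      have same: "valuation k l' s2 = valuation k l' s" "order_of n l' s2 = order_of n l' s"
        "position_of n l' s2 = position_of n l' s" "weight k wb s2 l' = weight k wb s l'"
        "weight k ws s2 l' = weight k ws s l'" for l'
        using ne by (simp_all add: fun_eq_iff valuation_def order_of_def position_of_def weight_def eq2 eq1)
      have sorted2: "sorted_all n k s2" using sorted by (simp add: sorted_all_def same)
      have vals2: "nats s2 (v VarL) 0 = l" "nats s2 (v Lo) 0 = p" using l vals by (simp_all add: eq2 eq1)
      have rN: "r < 2 * n" using r h by simp
      let ?post = "\<lambda>s'. \<forall>i<n. \<forall>j<n. reals s' (v (Res d)) (i * n + j) = reals s2 (v (Res d)) (i * n + j) +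
      (if n + i = order_of n l s2 r \<and> p \<le> position_of n l s2 j \<and> position_of n l s2 j < r
       then weight k wb s2 l (n + i) * weight k ws s2 l j else 0)"
      have "runs ?body s2 (30 + 212 * ?b) ?post"
      proof (rule runs_Cond)
        have g: "bval (BNot (NLess (NRead (v Order) (slot (rd VarR))) (rd Buyers))) s2 \<longleftrightarrow> n \<le> order_of n l s2 r"
          using nval_slot[OF sz2 vals2(1) l(1)] sz2 r(3) by (auto simp: order_of_def sized_def)
        show "runs ?pairs s2 (10 + 212 * ?b) ?post"
          if "bval (BNot (NLess (NRead (v Order) (slot (rd VarR))) (rd Buyers))) s2"
          by (rule runs_conseq[OF runs_add_pairs[OF sz2 sorted2 vals2(1) l(1) vals2(2) r(3,1) rN that[unfolded g] ne]])
            (use r h in auto)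
        show "runs Skip s2 (10 + 212 * ?b) ?post"
          if "\<not> bval (BNot (NLess (NRead (v Order) (slot (rd VarR))) (rd Buyers))) s2"
          by (rule runs_loop_free) (use that[unfolded g] in auto)
      qed (simp add: slot_def)
      then show "runs ?body s2 (30 + 212 * ?b) (J l (Suc r))"
      proof (rule runs_conseq)
        fix s3 :: state assume post: "?post s3"
        show "J l (Suc r) s3" unfolding J_def
        proof (intro allI impI)
          fix i j assume ij: "i < n" "j < n"
          \<comment> \<open>Exactly one trader sits at position \<open>r\<close>, so raising the
            bound by one adds the pairs of that trader only.\<close>
          have "position_of n l s (n + i) = r \<longleftrightarrow> n + i = order_of n l s r"
            using position_bij(3)[OF sorted l(1), of "n + i" r] ij rN by simp
          then have "e l i j (Suc r) = e l i j r +
            (if n + i = order_of n l s r \<and> p \<le> position_of n l s j \<and> position_of n l s j < r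
             then weight k wb s l (n + i) * weight k ws s l j else 0)"
            by (auto simp: e_def less_Suc_eq)
          moreover have "reals s3 (v (Res d)) (i * n + j) = reals s2 (v (Res d)) (i * n + j) +
            (if n + i = order_of n l s r \<and> p \<le> position_of n l s j \<and> position_of n l s j < r
             then weight k wb s l (n + i) * weight k ws s l j else 0)"
            using post ij unfolding same by blast
          moreover have "reals s2 (v (Res d)) (i * n + j) =
              reals s (v (Res d)) (i * n + j) + (\<Sum>l'<l. e l' i j (p + w)) + e l i j r"
            using J ij by (simp add: J_def)
          ultimately show "reals s3 (v (Res d)) (i * n + j) =
              reals s (v (Res d)) (i * n + j) + (\<Sum>l'<l. e l' i j (p + w)) + e l i j (Suc r)"
            by linarith
        qed
      qed simp
    next
      fix s2 assume J: "J l h s2"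
      \<comment> \<open>Positions are below \<open>2 * n\<close>, so cutting the last bucket off
        changes no term.\<close>
      have "e l i j h = e l i j (p + w)" if "i < n" for i j
        using position_bij(1)[OF sorted l(1), of "n + i"] that by (simp add: e_def h_def)
      with J show "I (Suc l) s2" by (simp add: I_def J_def)
    next
      have "(h - p) * (54 + 212 * ?b) \<le> ?b * (54 + 212 * ?b)" by (rule mult_le_mono1[OF h(3)])
      then show "6 + ncost (rd Lo) + ncost block_end + (h - p) * (10 + ncost block_end + (30 + 212 * ?b))
          \<le> 22 + ?b * (54 + 212 * ?b)" by (simp add: block_end_def del: mult_le_cancel1 mult_le_cancel2)
    qed (use vals h end1 in \<open>auto simp: eq1 J_def block_end_def\<close>)
  next
    fix s' assume "I k s'"
    then show "\<forall>i<n. \<forall>j<n.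
    reals s' (v (Res d)) (i * n + j) = reals s (v (Res d)) (i * n + j) +
     (\<Sum>l<k. if p \<le> position_of n l s j \<and> position_of n l s j < position_of n l s (n + i) \<and>
        position_of n l s (n + i) < p + w
       then weight k wb s l (n + i) * weight k ws s l j else 0)"
      by (simp add: I_def e_def)
  qed (use sz in \<open>auto simp: I_def sized_def inside_time_def algebra_simps\<close>)
qed

section \<open>One pass with a fixed bucket size\<close>

definition phase_time :: "(nat \<Rightarrow> nat \<Rightarrow> real) \<Rightarrow> nat \<Rightarrow> nat \<Rightarrow> nat \<Rightarrow> nat" where
  "phase_time M n k w = 2000 * (k * sort_time n w) + n * (21 + 112 * n) + 50 + inside_time n k w +
     (2 * n - w + (w - 1)) div w * (20 + across_time M n k + inside_time n k w)"

text \<open>With seller and buyer weights 1 and 1 this becomes an entry of C, with 1 and the maximum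
  price one of P, with the reserve price and 1 one of R. The three matrices share the comparison and
  differ in the weights alone.\<close>

definition dominance :: "nat \<Rightarrow> nat \<Rightarrow> var \<Rightarrow> var \<Rightarrow> state \<Rightarrow> nat \<Rightarrow> nat \<Rightarrow> real" where
  "dominance n k ws wb s i j = (\<Sum>l<k. if valuation k l s j \<le> valuation k l s (n + i)
     then weight k wb s l (n + i) * weight k ws s l j else 0)"

lemma writes_phase [simp]:
  "nwrites (phase ws wb d) = {v Current, v VarT, v BlockMin, v Best, v BestBlock, v Lo, v Order, v Position,
     v Alive, v VarR, v VarL, v VarI, v VarJ, v VarQ, ''n'', ''k''} \<union> nwrites mm"
  "rwrites (phase ws wb d) = {''A'', ''B'', v (Res d)} \<union> rwrites mm"
  by (auto simp: phase_def)

lemma runs_phase: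
  assumes mm: "multiplies_within mm M" and sz: "sized n k s"
    and w: "nats s (v Width) 0 = w" "0 < w" and wts: "wb \<in> {Present, Pay}" "ws \<in> {Present, Pay}"
  shows "runs (phase ws wb d) s (phase_time M n k w) (\<lambda>s'. \<forall>i<n. \<forall>j<n.
    reals s' (v (Res d)) (i * n + j) = dominance n k ws wb s i j)"
  unfolding phase_def
proof (rule runs_Seq[OF runs_sort_all[OF sz w]])
  have ne: "wb \<noteq> Res d" "ws \<noteq> Res d" using wts by auto
  let ?post = "\<lambda>s'. \<forall>i<n. \<forall>j<n. reals s' (v (Res d)) (i * n + j) = dominance n k ws wb s i j"
  let ?loop = "for_loop (v Lo) (rd Width) (rd Traders) (rd Width) (Seq (across ws wb d) (inside ws wb d))"
  let ?rest = "(2 * n - w + (w - 1)) div w"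
  have n: "1 \<le> n" using sz by (simp add: sized_def)
  fix s1 assume sorted1: "sorted_all n k s1" and ag1: "agree_off sort_all s s1"
  note eq1 = agree_off_nats[OF ag1] agree_off_reals[OF ag1]
  have sz1: "sized n k s1" using sz by (simp add: sized_def eq1)
  show "runs (Seq (clear d) (Seq (assign Lo (NConst 0)) (Seq (inside ws wb d) ?loop))) s1
     (n * (21 + 112 * n) + 50 + inside_time n k w + ?rest * (20 + across_time M n k + inside_time n k w)) ?post"
  proof (rule runs_Seq[OF runs_clear[OF sz1]])
    fix s2 assume zero: "\<forall>i<n. \<forall>j<n. reals s2 (v (Res d)) (i * n + j) = 0" and ag2: "agree_off (clear d) s1 s2"
    note eq2 = agree_off_nats[OF ag2] agree_off_reals[OF ag2]
    define s3 where "s3 = effect (assign Lo (NConst 0)) s2"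
    have s3: "nats s3 = nats (nat_update (v Lo) 0 0 s2)" "reals s3 = reals s2" by (simp_all add: s3_def)
    have sz3: "sized n k s3" using sz1 by (simp add: sized_def eq2 s3)
    have same3: "valuation k l s3 = valuation k l s" "order_of n l s3 = order_of n l s1"
      "position_of n l s3 = position_of n l s1" "weight k wb s3 l = weight k wb s l"
      "weight k ws s3 l = weight k ws s l" "valuation k l s1 = valuation k l s" for l
      using ne by (simp_all add: fun_eq_iff valuation_def order_of_def position_of_def weight_def s3 eq2 eq1)
    have sorted3: "sorted_all n k s3" using sorted1 by (simp add: sorted_all_def same3)
    have w3: "nats s3 (v Lo) 0 = 0" "nats s3 (v Width) 0 = w" using w by (simp_all add: s3 eq2 eq1)
    \<comment> \<open>The progress made once the buckets below \<open>R\<close> are done: all pairs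
      whose buyer sits before position \<open>R\<close>.\<close>
    define part where "part = (\<lambda>i j R. \<Sum>l<k. if position_of n l s1 j < position_of n l s1 (n + i) \<and>
      position_of n l s1 (n + i) < R then weight k wb s l (n + i) * weight k ws s l j else 0)"
    define I where "I = (\<lambda>p (s' :: state). \<forall>i<n. \<forall>j<n. reals s' (v (Res d)) (i * n + j) = part i j p)"
    show "runs (Seq (assign Lo (NConst 0)) (Seq (inside ws wb d) ?loop)) s2
      (30 + inside_time n k w + ?rest * (20 + across_time M n k + inside_time n k w)) ?post"
    proof (rule runs_Seq_loop_free)
      have "runs (inside ws wb d) s3 (inside_time n k w) (I w)"
        by (rule runs_conseq[OF runs_inside[OF sz3 sorted3 w3(1) _ w3(2) ne]])
          (use n zero in \<open>simp_all add: I_def part_def same3 s3 cong: if_cong\<close>)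
      then show "runs (Seq (inside ws wb d) ?loop) (effect (assign Lo (NConst 0)) s2)
        (20 + inside_time n k w + ?rest * (20 + across_time M n k + inside_time n k w)) ?post"
        unfolding s3_def[symmetric]
      proof (rule runs_Seq)
        fix s4 assume I4: "I w s4" and ag4: "agree_off (inside ws wb d) s3 s4"
        note eq4 = agree_off_nats[OF ag4] agree_off_reals[OF ag4]
        show "runs ?loop s4 (20 + ?rest * (20 + across_time M n k + inside_time n k w)) ?post"
        proof (rule runs_for_step[where I = I and h = "2 * n" and \<delta> = w and
              \<tau> = "across_time M n k + inside_time n k w"])
          fix p s5 assume I: "I p s5" and p: "p < 2 * n" "nats s5 (v Lo) 0 = p" and ag: "agree_off ?loop s4 s5"
          note eq5 = agree_off_nats[OF ag] agree_off_reals[OF ag]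
          have sz5: "sized n k s5" using sz3 by (simp add: sized_def eq5 eq4)
          have w5: "nats s5 (v Width) 0 = w" using w3 by (simp add: eq5 eq4)
          have same5: "valuation k l s5 = valuation k l s" "order_of n l s5 = order_of n l s1"
            "position_of n l s5 = position_of n l s1" "weight k wb s5 l = weight k wb s l"
            "weight k ws s5 l = weight k ws s l" for l
            unfolding same3[symmetric] using wts
            by (auto simp: fun_eq_iff valuation_def order_of_def position_of_def weight_def eq5 eq4)
          show "runs (Seq (across ws wb d) (inside ws wb d)) s5
            (across_time M n k + inside_time n k w) (I (p + w))"
          proof (rule runs_Seq[OF runs_across[OF mm sz5 p(2) w5]])
            fix s6 assume A: "\<forall>i<n. \<forall>j<n.
              reals s6 (v (Res d)) (i * n + j) = reals s5 (v (Res d)) (i * n + j) +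
              (\<Sum>l<k. (let q = position_of n l s5 (n + i) in if p \<le> q \<and> q < p + w then weight k wb s5 l (n + i) else 0) *
                (if position_of n l s5 j < p then weight k ws s5 l j else 0))"
              and ag: "agree_off (across ws wb d) s5 s6"
            note eq6 = agree_off_nats[OF ag] agree_off_reals[OF ag]
            have sz6: "sized n k s6" using sz5 by (simp add: sized_def eq6)
            have w6: "nats s6 (v Width) 0 = w" "nats s6 (v Lo) 0 = p" using w5 p by (simp_all add: eq6)
            have same6: "valuation k l s6 = valuation k l s" "order_of n l s6 = order_of n l s1"
              "position_of n l s6 = position_of n l s1" "weight k wb s6 l = weight k wb s l"
              "weight k ws s6 l = weight k ws s l" for l
              unfolding same5[symmetric] using wts
              by (auto simp: fun_eq_iff valuation_def order_of_def position_of_def weight_def eq6)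
            have sorted6: "sorted_all n k s6" using sorted1 by (simp add: sorted_all_def same6 same3)
            show "runs (inside ws wb d) s6 (inside_time n k w) (I (p + w))"
            proof (rule runs_conseq[OF runs_inside[OF sz6 sorted6 w6(2) p(1) w6(1) ne]])
              fix s7 :: state assume B: "\<forall>i<n. \<forall>j<n.
                reals s7 (v (Res d)) (i * n + j) = reals s6 (v (Res d)) (i * n + j) +
                (\<Sum>l<k. if p \<le> position_of n l s6 j \<and> position_of n l s6 j < position_of n l s6 (n + i) \<and>
                  position_of n l s6 (n + i) < p + w
                  then weight k wb s6 l (n + i) * weight k ws s6 l j else 0)"
              show "I (p + w) s7" unfolding I_def
              proof (intro allI impI)
                fix i j assume ij: "i < n" "j < n"
                have "reals s7 (v (Res d)) (i * n + j) = part i j p +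
                   (\<Sum>l<k. (let q = position_of n l s1 (n + i) in if p \<le> q \<and> q < p + w then weight k wb s l (n + i) else 0) *
                     (if position_of n l s1 j < p then weight k ws s l j else 0)) +
                   (\<Sum>l<k. if p \<le> position_of n l s1 j \<and> position_of n l s1 j < position_of n l s1 (n + i) \<and>
                     position_of n l s1 (n + i) < p + w
                     then weight k wb s l (n + i) * weight k ws s l j else 0)"
                  using A B I ij unfolding I_def same5 same6 by (simp cong: if_cong)
                \<comment> \<open>A buyer placed in \<open>[p, p + w)\<close> meets the sellers
                  before it either below \<open>p\<close>, counted by the product, or inside the
                  bucket, counted directly; the three sums cover disjoint cases.\<close>
                also have "\<dots> = part i j (p + w)"
                  unfolding part_def sum.distrib[symmetric] by (rule sum.cong) (auto simp: Let_def)
                finally show "reals s7 (v (Res d)) (i * n + j) = part i j (p + w)" .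
              qed
            qed simp
          qed simp
        next
          fix p s5 assume p: "2 * n \<le> p" and I: "I p s5"
          show "?post s5"
          proof (intro allI impI)
            fix i j assume ij: "i < n" "j < n"
            have "part i j p = dominance n k ws wb s i j"
              unfolding part_def dominance_def
            proof (rule sum.cong)
              fix l assume "l \<in> {..<k}"
              then have l: "l < k" by simp
              have "position_of n l s1 (n + i) < p"
                using position_bij(1)[OF sorted1 l, of "n + i"] ij p by simp
              \<comment> \<open>Seller numbers are below buyer numbers, so the tie-break turns the
                strict order into the non-strict price comparison.\<close>
              moreover have "position_of n l s1 j < position_of n l s1 (n + i) \<longleftrightarrow>
                  valuation k l s j \<le> valuation k l s (n + i)"
                using position_bij(4)[OF sorted1 l, of j "n + i"] ij by (auto simp: same3 precedes_def)
              ultimately show "(if position_of n l s1 j < position_of n l s1 (n + i) \<and>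
                position_of n l s1 (n + i) < p then weight k wb s l (n + i) * weight k ws s l j else 0) =
                (if valuation k l s j \<le> valuation k l s (n + i)
                 then weight k wb s l (n + i) * weight k ws s l j else 0)" by simp
            qed simp
            with I ij show "reals s5 (v (Res d)) (i * n + j) = dominance n k ws wb s i j"
              by (simp add: I_def)
          qed
        next
          have "nval (rd Width) s4 = w" using w3 by (simp add: eq4)
          moreover have "?rest * (9 + ncost (rd Traders) + ncost (rd Width) + (across_time M n k + inside_time n k w))
            \<le> ?rest * (20 + across_time M n k + inside_time n k w)" by (rule mult_le_mono2) simp
          ultimately show "6 + ncost (rd Width) + ncost (rd Traders) + (2 * n - nval (rd Width) s4 + (w - 1)) div w *
            (9 + ncost (rd Traders) + ncost (rd Width) + (across_time M n k + inside_time n k w))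
            \<le> 20 + ?rest * (20 + across_time M n k + inside_time n k w)"
            by (simp only: ncost.simps)
        qed (use w3 sz3 w(2) I4 in \<open>auto simp: I_def eq4 sized_def\<close>)
      qed simp
    qed simp_all
  qed simp
qed (simp add: phase_time_def)

subsection \<open>Searching for the bucket size\<close>

text \<open>Let \<open>r\<close> be the number of buckets beyond the first, so
  \<open>r * w \<le> 2 * n\<close>, and \<open>\<mu>\<close> the bound \<open>M n k\<close> rounded
  down. The assumption \<open>3 * \<mu> \<le> k * w * w\<close> puts the cost
  \<open>r * \<mu>\<close> of all products below \<open>X = n * k * w\<close>. Overheads of size
  \<open>n * n\<close> or \<open>n * k\<close> per product are multiples of \<open>\<mu>\<close> and
  covered by the same estimate; the remaining terms are multiples of \<open>X\<close>. The 30000 is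
  a round number above the sum of these constants.\<close>

lemma phase_time_le:
  assumes nk: "1 \<le> n" "1 \<le> k" "1 \<le> w"
    and Mu: "n * n \<le> nat \<lfloor>M n k\<rfloor>" "n * k \<le> nat \<lfloor>M n k\<rfloor>" "3 * nat \<lfloor>M n k\<rfloor> \<le> k * w * w"
  shows "phase_time M n k w \<le> 30000 * (n * k * w)"
proof -
  define \<mu> r b X where "\<mu> = nat \<lfloor>M n k\<rfloor>" and "r = (2 * n - w + (w - 1)) div w"
    and "b = min w (2 * n)" and "X = n * k * w"
  note \<mu> = Mu[folded \<mu>_def]
  have rw: "r * w \<le> 2 * n"
  proof (cases "w \<le> 2 * n")
    case True
    then have "r = (2 * n - 1) div w" using nk by (simp add: r_def)
    then have "r * w \<le> 2 * n - 1" by simp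
    then show ?thesis by simp
  qed (use nk in \<open>simp add: r_def\<close>)
  have blk: "blocks n w \<le> r + 1"
  proof (cases "w \<le> 2 * n")
    case True
    then have "2 * n + (w - 1) = (2 * n - w + (w - 1)) + w" by simp
    then have "blocks n w = (2 * n - w + (w - 1) + w) div w" by (simp only: blocks_def)
    also have "\<dots> = r + 1" using nk by (simp only: r_def div_add_self2[of w])
    finally show ?thesis by simp
  next
    case False
    then have "2 * n + (w - 1) < 2 * w" using nk by simp
    then have "blocks n w < 2" unfolding blocks_def by (rule less_mult_imp_div_less)
    then show ?thesis by simp
  qed
  have b: "b \<le> w" "b \<le> 2 * n" by (auto simp: b_def)
  have X1: "n * k \<le> X" "k * w \<le> X" "n * w \<le> X" using nk by (simp_all add: X_def)
  have X2: "n \<le> X" "k \<le> X" "w \<le> X" "1 \<le> X"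
  proof -
    have "n * 1 \<le> n * k" "1 * k \<le> n * k" "1 * w \<le> k * w" "1 * 1 \<le> n * k"
      using nk by (intro mult_le_mono; simp)+
    with X1 show "n \<le> X" "k \<le> X" "w \<le> X" "1 \<le> X" by linarith+
  qed
  have R: "r * \<mu> \<le> X"
  proof -
    have "3 * (r * \<mu>) \<le> r * (k * w * w)" using mult_le_mono2[OF \<mu>(3), of r] by (simp only: mult.left_commute)
    also have "\<dots> = (r * w) * (k * w)" by simp
    also have "\<dots> \<le> (2 * n) * (k * w)" by (rule mult_le_mono1[OF rw])
    also have "\<dots> = 2 * X" by (simp add: X_def)
    finally show ?thesis by simp
  qed
  \<comment> \<open>If \<open>k * w < n\<close>, then
    \<open>k * w * w \<le> (k * w) * (k * w) < n * n \<le> \<mu>\<close> contradicts the assumption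
    on \<open>w\<close>.\<close>
  have nn: "n * n \<le> X"
  proof -
    have "n \<le> k * w"
    proof (rule ccontr)
      assume "\<not> n \<le> k * w"
      then have "k * w < n" by simp
      then have "(k * w) * (k * w) < n * n" by (intro mult_strict_mono) auto
      moreover have "k * w * w \<le> (k * w) * (k * w)" using nk by simp
      ultimately show False using \<mu> by linarith
    qed
    from mult_le_mono2[OF this, of n] show ?thesis by (simp add: X_def)
  qed
  have r1: "r * (n * k) \<le> X" "r * (n * n) \<le> X"
    using mult_le_mono2[OF \<mu>(2), of r] mult_le_mono2[OF \<mu>(1), of r] R by linarith+
  have "n * 1 \<le> n * n" "1 * k \<le> n * k" "1 * 1 \<le> n * n" using nk by (intro mult_le_mono; simp)+
  then have le: "n \<le> n * n" "k \<le> n * k" "1 \<le> n * n" by auto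
  have r2: "r * n \<le> X" "r * k \<le> X" "r * 1 \<le> X"
    using mult_le_mono2[OF le(1), of r] mult_le_mono2[OF le(2), of r] mult_le_mono2[OF le(3), of r] r1
    by linarith+
  \<comment> \<open>In \<open>b * b\<close> one factor is estimated by \<open>w\<close>, the other
    by \<open>2 * n\<close>; summed over the buckets, \<open>r * b \<le> r * w \<le> 2 * n\<close>
    takes the place of the latter.\<close>
  have kb: "k * b \<le> X" "k * b * b \<le> 2 * X"
  proof -
    have "k * b \<le> k * w" using b(1) by (rule mult_le_mono2)
    with X1 show "k * b \<le> X" by linarith
    have "k * b * b \<le> k * w * (2 * n)" using b by (intro mult_le_mono) auto
    then show "k * b * b \<le> 2 * X" by (simp add: X_def mult_ac)
  qed
  have rb: "r * (k * b) \<le> 2 * X" "r * (k * b * b) \<le> 2 * X"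
  proof -
    have "r * b \<le> r * w" using b(1) by (rule mult_le_mono2)
    with rw have rb: "r * b \<le> 2 * n" by linarith
    have "r * (k * b) = r * b * k" by simp
    also have "\<dots> \<le> 2 * n * k" using rb by (rule mult_le_mono1)
    finally have "r * (k * b) \<le> 2 * (n * k)" by (simp only: mult.assoc)
    with X1(1) show "r * (k * b) \<le> 2 * X" by linarith
    have "r * (k * b * b) = r * b * (k * b)" by simp
    also have "\<dots> \<le> 2 * n * (k * b)" using rb by (rule mult_le_mono1)
    also have "\<dots> \<le> 2 * n * (k * w)" using b(1) by simp
    finally show "r * (k * b * b) \<le> 2 * X" by (simp add: X_def mult_ac)
  qed
  have "k * sort_time n w \<le> k * (2 * n * (r + 1 + w + 1))"
    unfolding sort_time_def using blk by (intro mult_le_mono2) simp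
  also have "\<dots> = 2 * (r * (n * k)) + 2 * X + 4 * (n * k)" by (simp add: X_def algebra_simps)
  finally have 1: "k * sort_time n w \<le> 8 * X" using r1 X1 by linarith
  have "inside_time n k w = 9 + 34 * k + 54 * (k * b) + 212 * (k * b * b)"
    by (simp add: inside_time_def b_def algebra_simps)
  then have 2: "inside_time n k w \<le> 600 * X" and "r * inside_time n k w =
      9 * (r * 1) + 34 * (r * k) + 54 * (r * (k * b)) + 212 * (r * (k * b * b))"
    using X2 kb by (simp_all add: algebra_simps)
  then have 3: "r * inside_time n k w \<le> 700 * X" using r2 rb by linarith
  have "r * across_time M n k =
      50 * (r * 1) + 42 * (r * n) + 224 * (r * (n * k)) + 21 * (r * k) + 112 * (r * (n * n)) + r * \<mu>"
    by (simp add: across_time_def \<mu>_def algebra_simps)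
  then have 4: "r * across_time M n k \<le> 500 * X" using r1 r2 R by linarith
  have "phase_time M n k w = 2000 * (k * sort_time n w) + 21 * n + 112 * (n * n) + 50 + inside_time n k w +
     20 * (r * 1) + r * across_time M n k + r * inside_time n k w"
    by (simp add: phase_time_def r_def algebra_simps)
  then show ?thesis using 1 2 3 4 X2 nn r2 unfolding X_def[symmetric] by linarith
qed

lemma dominance_cong:
  assumes "reals s' (v Val) = reals s (v Val)" "reals s' (v ws) = reals s (v ws)"
    "reals s' (v wb) = reals s (v wb)"
  shows "dominance n k ws wb s' i j = dominance n k ws wb s i j"
  by (simp only: dominance_def valuation_def weight_def assms)

text \<open>\<open>Budget\<close> carries \<open>n * k * w\<close> and is doubled together with
  \<open>Width\<close>, so no product of sizes is computed. The fuel is one more than the time bound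
  of a phase with sufficient width, so that such a phase leaves some over; the leftover is the
  success flag \<open>Done\<close>.\<close>

definition attempt :: "var \<Rightarrow> var \<Rightarrow> nat \<Rightarrow> com" where
  "attempt ws wb d = Seq (assign Fuel (NAdd (scaled 30000 (rd Budget)) (NConst 1)))
     (Seq (limit (v Fuel) (phase ws wb d))
       (Seq (assign Done (rd Fuel))
         (Seq (assign Width (NAdd (rd Width) (rd Width))) (assign Budget (NAdd (rd Budget) (rd Budget))))))"

definition search :: "var \<Rightarrow> var \<Rightarrow> nat \<Rightarrow> com" where
  "search ws wb d =
     Seq (Seq (assign Width (NConst 1)) (Seq (assign Budget (NRead (v TimesK) (rd Buyers))) (assign Done (NConst 0))))
       (Loop (NLess (rd Done) (NConst 1)) (attempt ws wb d))"

lemma Fuel_notin_com_names_phase: "v Fuel \<notin> com_names (phase ws wb d)"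
  by (simp add: phase_def sort_all_def sort_one_def select_next_def find_best_def rescan_def clear_def
      inside_def across_def fill_left_def fill_right_def multiply_def accumulate_def add_pair_def
      Let_def cell_def slot_def beats_def block_end_def pair_cell_def)

lemma notin_nwrites_limit_phase [simp]:
  "x \<noteq> v Fuel \<Longrightarrow> x \<notin> nwrites (phase ws wb d) \<Longrightarrow> x \<notin> nwrites (limit (v Fuel) (phase ws wb d))"
  using nwrites_limit by blast

text \<open>Determined by the program, not by the sizes or by \<open>M\<close>. The factor 30002
  comes from \<open>1 + F \<le> 30002 * X\<close> for the fuel \<open>F = 30000 * X + 1\<close> and
  \<open>X \<ge> 1\<close>.\<close>

definition attempt_cost :: "var \<Rightarrow> var \<Rightarrow> nat \<Rightarrow> nat" where
  "attempt_cost ws wb d = 100 + ncost (scaled 30000 (rd Budget)) + 30002 * overhead (phase ws wb d)"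

text \<open>The ten units saved pay for the test of the surrounding loop.\<close>

lemma runs_attempt:
  assumes mm: "multiplies_within mm M" and sz: "sized n k s"
    and Mu: "n * n \<le> nat \<lfloor>M n k\<rfloor>" "n * k \<le> nat \<lfloor>M n k\<rfloor>"
    and w: "nats s (v Width) 0 = w" "0 < w" "nats s (v Budget) 0 = n * k * w"
    and wts: "wb \<in> {Present, Pay}" "ws \<in> {Present, Pay}"
  shows "runs (attempt ws wb d) s (attempt_cost ws wb d * (n * k * w) - 10) (\<lambda>s'.
    nats s' (v Width) 0 = 2 * w \<and> nats s' (v Budget) 0 = n * k * (2 * w) \<and>
    (if nats s' (v Done) 0 = 0 then k * w * w < 3 * nat \<lfloor>M n k\<rfloor>
     else \<forall>i<n. \<forall>j<n. reals s' (v (Res d)) (i * n + j) = dominance n k ws wb s i j))"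
proof -
  let ?X = "n * k * w" and ?\<mu> = "nat \<lfloor>M n k\<rfloor>" and ?ph = "phase ws wb d"
  let ?good = "\<lambda>s'. \<forall>i<n. \<forall>j<n. reals s' (v (Res d)) (i * n + j) = dominance n k ws wb s i j"
  define F where "F = 30000 * ?X + 1"
  have X: "1 \<le> ?X" using sz w(2) by (simp add: sized_def)
  define s1 where "s1 = nat_update (v Fuel) 0 F s"
  have eff: "effect (assign Fuel (NAdd (scaled 30000 (rd Budget)) (NConst 1))) s = s1"
    by (simp add: s1_def F_def w)
  have sz1: "sized n k s1" using sz by (simp add: sized_def s1_def)
  have dom1: "dominance n k ws wb s1 i j = dominance n k ws wb s i j" for i j
    by (rule dominance_cong) (simp_all add: s1_def)
  have "runs ?ph s1 (phase_time M n k w) ?good"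
    by (rule runs_conseq[OF runs_phase[OF mm sz1 _ w(2) wts]]) (use w in \<open>simp_all add: s1_def dom1[unfolded s1_def]\<close>)
  then have lim: "runs (limit (v Fuel) ?ph) s1 (overhead ?ph * (1 + F))
      (\<lambda>s'. nats s' (v Fuel) 0 = 0 \<and> F \<le> phase_time M n k w \<or> 0 < nats s' (v Fuel) 0 \<and> ?good s')"
    unfolding s1_def by (intro runs_limit Fuel_notin_com_names_phase) simp_all
  \<comment> \<open>The contrapositive of the time bound: once the width suffices, the fuel cannot
    run out.\<close>
  have fail: "k * w * w < 3 * ?\<mu>" if "F \<le> phase_time M n k w"
  proof (rule ccontr)
    assume "\<not> k * w * w < 3 * ?\<mu>"
    then have "phase_time M n k w \<le> 30000 * ?X"
      using sz w(2) Mu by (intro phase_time_le) (auto simp: sized_def)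
    with that show False by (simp add: F_def)
  qed
  let ?fin = "Seq (assign Done (rd Fuel))
     (Seq (assign Width (NAdd (rd Width) (rd Width))) (assign Budget (NAdd (rd Budget) (rd Budget))))"
  let ?post = "\<lambda>s'. nats s' (v Width) 0 = 2 * w \<and> nats s' (v Budget) 0 = n * k * (2 * w) \<and>
    (if nats s' (v Done) 0 = 0 then k * w * w < 3 * ?\<mu> else ?good s')"
  have "runs (Seq (limit (v Fuel) ?ph) ?fin) s1 (overhead ?ph * (1 + F) + 30) ?post"
  proof (rule runs_Seq[OF lim])
    fix s2 assume P: "nats s2 (v Fuel) 0 = 0 \<and> F \<le> phase_time M n k w \<or> 0 < nats s2 (v Fuel) 0 \<and> ?good s2"
      and ag: "agree_off (limit (v Fuel) ?ph) s1 s2"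
    note eq = agree_off_nats[OF ag]
    show "runs ?fin s2 30 ?post"
      by (rule runs_loop_free) (use P fail w in \<open>auto simp: eq s1_def\<close>)
  qed simp
  then show ?thesis unfolding attempt_def eff[symmetric]
  proof (rule runs_Seq_loop_free[rotated])
    have "overhead ?ph * (1 + F) \<le> overhead ?ph * (30002 * ?X)"
      using X by (intro mult_le_mono2) (simp add: F_def)
    moreover have "100 + ncost (scaled 30000 (rd Budget)) \<le> (100 + ncost (scaled 30000 (rd Budget))) * ?X"
      using mult_le_mono2[OF X, of "100 + ncost (scaled 30000 (rd Budget))"] by simp
    moreover have "attempt_cost ws wb d * ?X =
        (100 + ncost (scaled 30000 (rd Budget))) * ?X + overhead ?ph * (30002 * ?X)"
      by (simp add: attempt_cost_def algebra_simps)
    ultimately show "overhead (assign Fuel (NAdd (scaled 30000 (rd Budget)) (NConst 1))) +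
        (overhead ?ph * (1 + F) + 30) \<le> attempt_cost ws wb d * ?X - 10"
      unfolding overhead.simps ncost.simps by linarith
  qed simp
qed

lemma writes_attempt:
  "nwrites (attempt ws wb d) \<subseteq> nwrites (phase ws wb d) \<union> {v Fuel, v Done, v Width, v Budget}"
  "rwrites (attempt ws wb d) = rwrites (phase ws wb d)"
  using nwrites_limit[of "v Fuel" "phase ws wb d"] by (auto simp: attempt_def)

lemma notin_nwrites_attempt:
  "x \<notin> nwrites (phase ws wb d) \<Longrightarrow> x \<notin> {v Fuel, v Done, v Width, v Budget} \<Longrightarrow> x \<notin> nwrites (attempt ws wb d)"
  using writes_attempt(1) by blast

lemma writes_search:
  "nwrites (search ws wb d) \<subseteq> nwrites (phase ws wb d) \<union> {v Fuel, v Done, v Width, v Budget}"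
  "rwrites (search ws wb d) = rwrites (phase ws wb d)"
  using writes_attempt[of ws wb d] by (auto simp: search_def)

text \<open>The bound works as a potential: when \<open>w\<close> becomes \<open>2 * w\<close>, its
  last factor drops by exactly \<open>w\<close>, the cost of the round in the same units, which sums
  the geometric series. A failed round has \<open>w \<le> Z\<close>, so the next width is at most
  \<open>2 * Z\<close>; a successful one is paid for because \<open>w \<le> 2 * Z + 2\<close>. The 2
  admits the initial width 1 even if \<open>Z = 0\<close>.\<close>

lemma runs_search_loop:
  assumes mm: "multiplies_within mm M"
    and Mu: "n * n \<le> nat \<lfloor>M n k\<rfloor>" "n * k \<le> nat \<lfloor>M n k\<rfloor>"
    and Z: "\<And>w. k * w * w < 3 * nat \<lfloor>M n k\<rfloor> \<Longrightarrow> w \<le> Z"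
    and wts: "wb \<in> {Present, Pay}" "ws \<in> {Present, Pay}"
    and s: "sized n k s" "nats s (v Width) 0 = w" "0 < w" "nats s (v Budget) 0 = n * k * w"
      "nats s (v Done) 0 = 0" "w \<le> 2 * Z + 2"
  shows "runs (Loop (NLess (rd Done) (NConst 1)) (attempt ws wb d)) s
     (attempt_cost ws wb d * (n * k * (4 * Z + 4 - w)))
     (\<lambda>s'. \<forall>i<n. \<forall>j<n. reals s' (v (Res d)) (i * n + j) = dominance n k ws wb s i j)"
  using s
proof (induction "2 * Z + 2 - w" arbitrary: w s rule: less_induct)
  case less
  let ?C = "attempt_cost ws wb d" and ?X = "n * k * w"
  note sz = less.prems(1) and w = less.prems(2-4)
  have X: "1 \<le> ?X" using sz w(2) by (simp add: sized_def)
  have C: "100 * 1 \<le> ?C * ?X" using X by (intro mult_le_mono) (auto simp: attempt_cost_def)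
  define U where "U = ?C * (n * k * (4 * Z + 4 - w)) - ?C * ?X"
  have le: "?C * ?X \<le> ?C * (n * k * (4 * Z + 4 - w))"
    using less.prems(6) by (intro mult_le_mono) auto
  show ?case
  proof (rule runs_Loop_True[OF _ runs_attempt[OF mm sz Mu w wts]])
    \<comment> \<open>Of the ten units saved, five pay for this test of the guard and five, passed
      on in \<open>U + 5\<close>, for the test that ends the loop after a success.\<close>
    show "1 + bcost (NLess (rd Done) (NConst 1)) + (?C * ?X - 10) + (U + 5) \<le> ?C * (n * k * (4 * Z + 4 - w))"
      using C le unfolding U_def bcost.simps ncost.simps by linarith
    fix s1 assume P: "nats s1 (v Width) 0 = 2 * w \<and> nats s1 (v Budget) 0 = n * k * (2 * w) \<and>
      (if nats s1 (v Done) 0 = 0 then k * w * w < 3 * nat \<lfloor>M n k\<rfloor>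
       else \<forall>i<n. \<forall>j<n. reals s1 (v (Res d)) (i * n + j) = dominance n k ws wb s i j)"
      and ag: "agree_off (attempt ws wb d) s s1"
    show "runs (Loop (NLess (rd Done) (NConst 1)) (attempt ws wb d)) s1 (U + 5)
      (\<lambda>s'. \<forall>i<n. \<forall>j<n. reals s' (v (Res d)) (i * n + j) = dominance n k ws wb s i j)"
    proof (cases "nats s1 (v Done) 0 = 0")
      case True
      with P Z have wZ: "w \<le> Z" by simp
      have nat1: "nats s1 (v x) = nats s (v x)" if "x \<in> {Buyers, Commodities, Traders, TimesK, TimesN}" for x
        using that by (intro agree_off_nats[OF ag] notin_nwrites_attempt) auto
      have real1: "reals s1 (v x) = reals s (v x)" if "x \<in> {Val, Present, Pay}" for x
        using that by (intro agree_off_reals[OF ag]) (auto simp: writes_attempt(2))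
      have sz1: "sized n k s1" using sz by (simp add: sized_def nat1)
      have dom1: "dominance n k ws wb s1 i j = dominance n k ws wb s i j" for i j
        using real1 wts by (intro dominance_cong) auto
      have "runs (Loop (NLess (rd Done) (NConst 1)) (attempt ws wb d)) s1
         (?C * (n * k * (4 * Z + 4 - 2 * w)))
         (\<lambda>s'. \<forall>i<n. \<forall>j<n. reals s' (v (Res d)) (i * n + j) = dominance n k ws wb s1 i j)"
        using P True wZ w(2) by (intro less.hyps[OF _ sz1]) simp_all
      then show ?thesis
      proof (rule runs_conseq)
        have D: "4 * Z + 4 - w = w + (4 * Z + 4 - 2 * w)" using wZ by simp
        have "?C * (n * k * (4 * Z + 4 - w)) = ?C * ?X + ?C * (n * k * (4 * Z + 4 - 2 * w))"
          unfolding D by (simp only: add_mult_distrib2)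
        then show "?C * (n * k * (4 * Z + 4 - 2 * w)) \<le> U + 5" unfolding U_def by linarith
      qed (simp add: dom1)
    next
      case False
      with P show ?thesis by (intro runs_Loop_False) auto
    qed
  qed (use less.prems(5) in simp)
qed

lemma runs_search:
  assumes mm: "multiplies_within mm M" and sz: "sized n k s"
    and Mu: "n * n \<le> nat \<lfloor>M n k\<rfloor>" "n * k \<le> nat \<lfloor>M n k\<rfloor>"
    and Z: "\<And>w. k * w * w < 3 * nat \<lfloor>M n k\<rfloor> \<Longrightarrow> w \<le> Z"
    and wts: "wb \<in> {Present, Pay}" "ws \<in> {Present, Pay}"
  shows "runs (search ws wb d) s (20 + attempt_cost ws wb d * (n * k * (4 * Z + 4)))
     (\<lambda>s'. \<forall>i<n. \<forall>j<n. reals s' (v (Res d)) (i * n + j) = dominance n k ws wb s i j)"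
  unfolding search_def
proof (rule runs_Seq_loop_free)
  let ?pre = "Seq (assign Width (NConst 1)) (Seq (assign Budget (NRead (v TimesK) (rd Buyers))) (assign Done (NConst 0)))"
  define s1 where "s1 = effect ?pre s"
  have sz1: "sized n k s1" using sz by (simp add: sized_def s1_def)
  have dom1: "dominance n k ws wb s1 i j = dominance n k ws wb s i j" for i j
    by (rule dominance_cong) (simp_all add: s1_def)
  have "runs (Loop (NLess (rd Done) (NConst 1)) (attempt ws wb d)) s1
     (attempt_cost ws wb d * (n * k * (4 * Z + 4 - 1)))
     (\<lambda>s'. \<forall>i<n. \<forall>j<n. reals s' (v (Res d)) (i * n + j) = dominance n k ws wb s1 i j)"
    by (rule runs_search_loop[OF mm Mu Z wts sz1]) (use sz in \<open>auto simp: s1_def sized_def\<close>)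
  then show "runs (Loop (NLess (rd Done) (NConst 1)) (attempt ws wb d)) (effect ?pre s)
     (attempt_cost ws wb d * (n * k * (4 * Z + 4)))
     (\<lambda>s'. \<forall>i<n. \<forall>j<n. reals s' (v (Res d)) (i * n + j) = dominance n k ws wb s i j)"
    unfolding s1_def[symmetric] by (rule runs_conseq) (simp_all add: dom1)
qed simp_all

subsection \<open>Copying the input and the output\<close>

definition multiples :: "var \<Rightarrow> var \<Rightarrow> nexp \<Rightarrow> com" where
  "multiples x y hi = Seq (NAssign (v x) (NConst 0) (NConst 0))
     (for_loop (v VarT) (NConst 0) hi (NConst 1)
       (NAssign (v x) (NAdd (rd VarT) (NConst 1)) (NAdd (NRead (v x) (rd VarT)) (rd y))))"

lemma writes_multiples [simp]:
  "nwrites (multiples x y hi) = {v x, v VarT}" "rwrites (multiples x y hi) = {}"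
  by (auto simp: multiples_def)

lemma runs_multiples:
  assumes ne: "x \<noteq> VarT" "y \<noteq> VarT" "x \<noteq> y" and hi: "nexp_names hi \<inter> {v VarT, v x} = {}" "nval hi s = h"
    "ncost hi \<le> 10" and y: "nats s (v y) 0 = m"
  shows "runs (multiples x y hi) s (40 + 50 * h) (\<lambda>s'. \<forall>i\<le>h. nats s' (v x) i = i * m)"
  unfolding multiples_def
proof (rule runs_Seq_loop_free)
  let ?c = "NAssign (v x) (NAdd (rd VarT) (NConst 1)) (NAdd (NRead (v x) (rd VarT)) (rd y))"
  define s1 where "s1 = effect (NAssign (v x) (NConst 0) (NConst 0)) s"
  have s1: "nats s1 = nats (nat_update (v x) 0 0 s)" by (simp add: s1_def)
  have "nval hi s1 = nval hi s" using hi by (intro nval_cong) (auto simp: s1)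
  then show "runs (for_loop (v VarT) (NConst 0) hi (NConst 1) ?c)
     (effect (NAssign (v x) (NConst 0) (NConst 0)) s) (30 + 50 * h) (\<lambda>s'. \<forall>i\<le>h. nats s' (v x) i = i * m)"
    unfolding s1_def[symmetric]
  proof (intro runs_for[where I = "\<lambda>p (s' :: state). \<forall>i\<le>p. nats s' (v x) i = i * m" and h = h and l = 0 and \<tau> = 20])
    fix p s' assume I: "\<forall>i\<le>p. nats s' (v x) i = i * m" and p: "nats s' (v VarT) 0 = p"
      and ag: "agree_off (for_loop (v VarT) (NConst 0) hi (NConst 1) ?c) s1 s'"
    have "nats s' (v y) 0 = m" using agree_off_nats[OF ag, of "v y"] ne y by (simp add: s1)
    then show "runs ?c s' 20 (\<lambda>s'. \<forall>i\<le>Suc p. nats s' (v x) i = i * m)"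
      using I p by (intro runs_loop_free) (auto simp: le_Suc_eq)
  next
    have "h * (10 + ncost hi + 20) \<le> h * 50" using hi(3) by (intro mult_le_mono2) simp
    then show "6 + ncost (NConst 0) + ncost hi + (h - 0) * (10 + ncost hi + 20) \<le> 30 + 50 * h"
      using hi(3) unfolding ncost.simps diff_zero by linarith
  qed (use hi ne in \<open>auto simp: s1\<close>)
qed simp_all

definition setup_sizes :: com where
  "setup_sizes = Seq (Seq (assign Buyers (NRead ''n'' (NConst 0)))
       (Seq (assign Commodities (NRead ''k'' (NConst 0))) (assign Traders (NAdd (rd Buyers) (rd Buyers)))))
     (Seq (multiples TimesK Commodities (rd Traders)) (multiples TimesN Buyers (NAdd (rd Buyers) (rd Commodities))))"

lemma writes_setup_sizes [simp]:
  "nwrites setup_sizes = {v Buyers, v Commodities, v Traders, v TimesK, v TimesN, v VarT}"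
  "rwrites setup_sizes = {}"
  by (auto simp: setup_sizes_def)

lemma runs_setup_sizes:
  assumes "holds_sizes s n k" "1 \<le> n" "1 \<le> k"
  shows "runs setup_sizes s (200 + 150 * n + 50 * k) (sized n k)"
  unfolding setup_sizes_def
proof (rule runs_Seq_loop_free)
  let ?pre = "Seq (assign Buyers (NRead ''n'' (NConst 0)))
       (Seq (assign Commodities (NRead ''k'' (NConst 0))) (assign Traders (NAdd (rd Buyers) (rd Buyers))))"
  define s1 where "s1 = effect ?pre s"
  have s1: "nats s1 (v Buyers) 0 = n" "nats s1 (v Commodities) 0 = k" "nats s1 (v Traders) 0 = 2 * n"
    using assms by (simp_all add: s1_def holds_sizes_def)
  show "runs (Seq (multiples TimesK Commodities (rd Traders)) (multiples TimesN Buyers (NAdd (rd Buyers) (rd Commodities))))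
     (effect ?pre s) (80 + 150 * n + 50 * k) (sized n k)" unfolding s1_def[symmetric]
  proof (rule runs_Seq)
    show "runs (multiples TimesK Commodities (rd Traders)) s1 (40 + 100 * n) (\<lambda>s'. \<forall>i\<le>2 * n. nats s' (v TimesK) i = i * k)"
      using runs_multiples[of TimesK Commodities "rd Traders" s1 "2 * n" k] s1 by simp
    fix s2 assume K: "\<forall>i\<le>2 * n. nats s2 (v TimesK) i = i * k"
      and ag: "agree_off (multiples TimesK Commodities (rd Traders)) s1 s2"
    note eq = agree_off_nats[OF ag]
    show "runs (multiples TimesN Buyers (NAdd (rd Buyers) (rd Commodities))) s2 (40 + 50 * (n + k)) (sized n k)"
    proof (rule runs_conseq[OF runs_multiples[where h = "n + k" and m = n]])
      fix s3 assume "\<forall>i\<le>n + k. nats s3 (v TimesN) i = i * n"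
        and ag: "agree_off (multiples TimesN Buyers (NAdd (rd Buyers) (rd Commodities))) s2 s3"
      with K s1 assms show "sized n k s3" by (simp add: sized_def agree_off_nats[OF ag] eq)
    qed (use s1 in \<open>simp_all add: eq\<close>)
  qed simp
qed simp_all

text \<open>Price cells of untraded commodities hold arbitrary reals, so they become 0 in the copy.
  Copying also moves the data to arrays that the multiplication program cannot write.\<close>

definition load :: "var \<Rightarrow> name \<Rightarrow> nexp \<Rightarrow> rexp \<Rightarrow> com" where
  "load x goods t e = count VarI Buyers
     (count VarL Commodities
       (Cond (NLess (NConst 0) (NRead goods (cell (rd VarI))))
         (RAssign (v x) (cell t) e) (RAssign (v x) (cell t) RZero)))"

lemma writes_load [simp]:
  "nwrites (load x goods t e) = {v VarI, v VarL}" "rwrites (load x goods t e) = {v x}"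
  by (auto simp: load_def)

text \<open>\<open>off\<close> selects the half of the table: sellers fill the rows from 0, buyers
  those from \<open>n\<close>. The second conjunct keeps the half that was filled before.\<close>

lemma runs_load:
  assumes sz: "sized n k s" and io: "goods \<in> io_names"
    and goods: "\<And>i l. i < n \<Longrightarrow> l < k \<Longrightarrow> nats s goods (i * k + l) = (if l \<in> fst (a i) then 1 else 0)"
    and t: "t = (if off = 0 then rd VarI else NAdd (rd Buyers) (rd VarI))" "off = 0 \<or> off = n"
    and e: "e = ROne \<and> (\<forall>i l. h i l = 1) \<or> (\<exists>y\<in>io_names. e = RRead y (cell (rd VarI)) \<and>
      (\<forall>i<n. \<forall>l<k. l \<in> fst (a i) \<longrightarrow> reals s y (i * k + l) = h i l))"
  shows "runs (load x goods t e) s (9 + n * (21 + 112 * k)) (\<lambda>s'.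
    (\<forall>i<n. \<forall>l<k. reals s' (v x) ((off + i) * k + l) = (if l \<in> fst (a i) then h i l else 0)) \<and>
    (\<forall>c. c < off * k \<or> off * k + n * k \<le> c \<longrightarrow> reals s' (v x) c = reals s (v x) c))"
  unfolding load_def
proof (rule runs_tabulate[where b = "off * k" and n = n and m = k and z = "v x" and
    g = "\<lambda>i l. if l \<in> fst (a i) then h i l else 0"])
  let ?c = "Cond (NLess (NConst 0) (NRead goods (cell (rd VarI))))
         (RAssign (v x) (cell t) e) (RAssign (v x) (cell t) RZero)"
  fix i l s'
  assume il: "i < n" "l < k" and ag: "agree_off (count VarI Buyers
     (count VarL Commodities ?c)) s s'"
    and vars: "nats s' (v VarI) 0 = i" "nats s' (v VarL) 0 = l"
  note eq = agree_off_nats[OF ag] agree_off_reals[OF ag]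
  have sz': "sized n k s'" using sz by (simp add: sized_def eq)
  have tv: "nval t s' = off + i" using t sz' vars by (auto simp: sized_def)
  have c: "nval (cell t) s' = off * k + (i * k + l)" "nval (cell (rd VarI)) s' = i * k + l"
    using nval_cell[OF sz' vars(2), of t] nval_cell[OF sz' vars(2), of "rd VarI"] tv vars il t(2)
    by (auto simp: algebra_simps)
  have g: "nats s' goods (i * k + l) = (if l \<in> fst (a i) then 1 else 0)"
    using goods[OF il] io by (simp add: eq)
  have "rval e s' = h i l" if "l \<in> fst (a i)"
    using e that il c(2) by (auto simp: eq)
  with c g show "reals (effect ?c s') (v x) = (reals s' (v x))
      (off * k + (i * k + l) := if l \<in> fst (a i) then h i l else 0)"
    by simp
next
  fix s' assume P: "\<And>i j. i < n \<Longrightarrow> j < k \<Longrightarrow>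
      reals s' (v x) (off * k + (i * k + j)) = (if j \<in> fst (a i) then h i j else 0)"
    "\<And>a. a < off * k \<or> off * k + n * k \<le> a \<Longrightarrow> reals s' (v x) a = reals s (v x) a"
  have addr: "(off + i) * k + l = off * k + (i * k + l)" for i l by (simp add: algebra_simps)
  show "(\<forall>i<n. \<forall>l<k. reals s' (v x) ((off + i) * k + l) = (if l \<in> fst (a i) then h i l else 0)) \<and>
    (\<forall>c. c < off * k \<or> off * k + n * k \<le> c \<longrightarrow> reals s' (v x) c = reals s (v x) c)"
    unfolding addr using P by auto
qed (use sz io t e in \<open>auto simp: sized_def cell_def\<close>)

definition load_both :: "var \<Rightarrow> rexp \<Rightarrow> rexp \<Rightarrow> com" where
  "load_both x e f = Seq (load x ''seller_goods'' (rd VarI) e)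
     (load x ''buyer_goods'' (NAdd (rd Buyers) (rd VarI)) f)"

lemma writes_load_both [simp]:
  "nwrites (load_both x e f) = {v VarI, v VarL}" "rwrites (load_both x e f) = {v x}"
  by (auto simp: load_both_def)

definition stored :: "nat \<Rightarrow> nat \<Rightarrow> (nat \<Rightarrow> trader) \<Rightarrow> (nat \<Rightarrow> trader) \<Rightarrow> (trader \<Rightarrow> nat \<Rightarrow> real) \<Rightarrow> var \<Rightarrow> state \<Rightarrow> bool" where
  "stored n k b s f x \<sigma> \<longleftrightarrow> (\<forall>i<n. \<forall>l<k.
     reals \<sigma> (v x) (i * k + l) = (if l \<in> fst (s i) then f (s i) l else 0) \<and>
     reals \<sigma> (v x) ((n + i) * k + l) = (if l \<in> fst (b i) then f (b i) l else 0))"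

definition input_tables :: "nat \<Rightarrow> nat \<Rightarrow> (nat \<Rightarrow> trader) \<Rightarrow> (nat \<Rightarrow> trader) \<Rightarrow> state \<Rightarrow> bool" where
  "input_tables n k b s \<sigma> \<longleftrightarrow> holds_traders \<sigma> ''buyer_goods'' ''max_price'' n k b \<and>
     holds_traders \<sigma> ''seller_goods'' ''reserve_price'' n k s"

lemma runs_load_both:
  assumes sz: "sized n k \<sigma>" and inp: "input_tables n k b s \<sigma>"
    and ef: "e = ROne \<and> f = ROne \<and> g = (\<lambda>_ _. 1) \<or>
      e = RRead ''reserve_price'' (cell (rd VarI)) \<and> f = RRead ''max_price'' (cell (rd VarI)) \<and> g = snd"
  shows "runs (load_both x e f) \<sigma> (2 * (9 + n * (21 + 112 * k))) (stored n k b s g x)"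
  unfolding load_both_def
proof (rule runs_Seq)
  show "runs (load x ''seller_goods'' (rd VarI) e) \<sigma> (9 + n * (21 + 112 * k)) (\<lambda>s'.
    (\<forall>i<n. \<forall>l<k. reals s' (v x) ((0 + i) * k + l) = (if l \<in> fst (s i) then g (s i) l else 0)) \<and>
    (\<forall>c. c < 0 * k \<or> 0 * k + n * k \<le> c \<longrightarrow> reals s' (v x) c = reals \<sigma> (v x) c))"
  proof (rule runs_load[OF sz])
    show "e = ROne \<and> (\<forall>i l. g (s i) l = 1) \<or> (\<exists>y\<in>io_names. e = RRead y (cell (rd VarI)) \<and>
      (\<forall>i<n. \<forall>l<k. l \<in> fst (s i) \<longrightarrow> reals \<sigma> y (i * k + l) = g (s i) l))"
      using ef
    proof
      assume "e = RRead ''reserve_price'' (cell (rd VarI)) \<and> f = RRead ''max_price'' (cell (rd VarI)) \<and> g = snd"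
      with inp show ?thesis
        by (intro disjI2 bexI[of _ "''reserve_price''"]) (simp_all add: input_tables_def holds_traders_def)
    qed simp
  qed (use inp in \<open>simp_all add: input_tables_def holds_traders_def\<close>)
  fix \<sigma>1 assume S: "(\<forall>i<n. \<forall>l<k. reals \<sigma>1 (v x) ((0 + i) * k + l) = (if l \<in> fst (s i) then g (s i) l else 0)) \<and>
    (\<forall>c. c < 0 * k \<or> 0 * k + n * k \<le> c \<longrightarrow> reals \<sigma>1 (v x) c = reals \<sigma> (v x) c)"
    and ag: "agree_off (load x ''seller_goods'' (rd VarI) e) \<sigma> \<sigma>1"
  note eq = agree_off_nats[OF ag] agree_off_reals[OF ag]
  have sz1: "sized n k \<sigma>1" using sz by (simp add: sized_def eq)
  have inp1: "input_tables n k b s \<sigma>1" using inp by (simp add: input_tables_def holds_traders_def eq)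
  have "runs (load x ''buyer_goods'' (NAdd (rd Buyers) (rd VarI)) f) \<sigma>1 (9 + n * (21 + 112 * k)) (\<lambda>s'.
    (\<forall>i<n. \<forall>l<k. reals s' (v x) ((n + i) * k + l) = (if l \<in> fst (b i) then g (b i) l else 0)) \<and>
    (\<forall>c. c < n * k \<or> n * k + n * k \<le> c \<longrightarrow> reals s' (v x) c = reals \<sigma>1 (v x) c))"
  proof (rule runs_load[OF sz1])
    show "f = ROne \<and> (\<forall>i l. g (b i) l = 1) \<or> (\<exists>y\<in>io_names. f = RRead y (cell (rd VarI)) \<and>
      (\<forall>i<n. \<forall>l<k. l \<in> fst (b i) \<longrightarrow> reals \<sigma>1 y (i * k + l) = g (b i) l))"
      using ef
    proof
      assume "e = RRead ''reserve_price'' (cell (rd VarI)) \<and> f = RRead ''max_price'' (cell (rd VarI)) \<and> g = snd"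
      with inp1 show ?thesis
        by (intro disjI2 bexI[of _ "''max_price''"]) (simp_all add: input_tables_def holds_traders_def)
    qed simp
    have "n \<noteq> 0" using sz by (simp add: sized_def)
    then show "NAdd (rd Buyers) (rd VarI) = (if n = 0 then rd VarI else NAdd (rd Buyers) (rd VarI))" by simp
  qed (use inp1 in \<open>simp_all add: input_tables_def holds_traders_def\<close>)
  then show "runs (load x ''buyer_goods'' (NAdd (rd Buyers) (rd VarI)) f) \<sigma>1 (9 + n * (21 + 112 * k)) (stored n k b s g x)"
  proof (rule runs_conseq)
    fix \<sigma>2 :: state assume "(\<forall>i<n. \<forall>l<k. reals \<sigma>2 (v x) ((n + i) * k + l) = (if l \<in> fst (b i) then g (b i) l else 0)) \<and>
      (\<forall>c. c < n * k \<or> n * k + n * k \<le> c \<longrightarrow> reals \<sigma>2 (v x) c = reals \<sigma>1 (v x) c)"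
    with S show "stored n k b s g x \<sigma>2"
      by (auto simp: stored_def row_major_less)
  qed simp
qed simp

text \<open>\<open>Val\<close> serves as the sorting key and \<open>Pay\<close> as a weight: the
  same prices in two roles.\<close>

definition loads :: com where
  "loads = (let r = RRead ''reserve_price'' (cell (rd VarI)); m = RRead ''max_price'' (cell (rd VarI)) in
     Seq (load_both Val r m) (Seq (load_both Present ROne ROne) (load_both Pay r m)))"

definition searches :: com where
  "searches = Seq (search Present Present 0) (Seq (search Present Pay 1) (search Pay Present 2))"

definition copy_out :: "nat \<Rightarrow> name \<Rightarrow> com" where
  "copy_out d x = count VarI Buyers
     (count VarJ Buyers (RAssign x pair_cell (RRead (v (Res d)) pair_cell)))"

definition buyer_seller :: com where
  "buyer_seller = Seq setup_sizes (Seq loads (Seq searches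
     (Seq (copy_out 0 ''C'') (Seq (copy_out 1 ''P'') (copy_out 2 ''R'')))))"

lemma writes_copy_out [simp]:
  "nwrites (copy_out d x) = {v VarI, v VarJ}" "rwrites (copy_out d x) = {x}"
  by (auto simp: copy_out_def)

lemma writes_loads [simp]:
  "nwrites loads = {v VarI, v VarL}" "rwrites loads = {v Val, v Present, v Pay}"
  by (auto simp: loads_def Let_def)

lemma runs_copy_out:
  assumes sz: "sized n k s" and x: "x \<in> io_names"
  shows "runs (copy_out d x) s (9 + n * (21 + 112 * n))
    (\<lambda>s'. \<forall>i<n. \<forall>j<n. reals s' x (i * n + j) = reals s (v (Res d)) (i * n + j))"
  unfolding copy_out_def
proof (rule runs_tabulate[where b = 0 and n = n and m = n and z = x and
    g = "\<lambda>i j. reals s (v (Res d)) (i * n + j)"])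
  let ?c = "RAssign x pair_cell (RRead (v (Res d)) pair_cell)"
  fix i j s'
  assume ij: "i < n" "j < n" and ag: "agree_off (count VarI Buyers
     (count VarJ Buyers ?c)) s s'"
    and vars: "nats s' (v VarI) 0 = i" "nats s' (v VarJ) 0 = j"
  have "nats s' (v TimesN) i = i * n"
    using sz ij agree_off_nats[OF ag, of "v TimesN"] by (simp add: sized_def)
  moreover have "reals s' (v (Res d)) = reals s (v (Res d))"
    using agree_off_reals[OF ag, of "v (Res d)"] x by simp
  ultimately show "reals (effect ?c s') x = (reals s' x) (0 + (i * n + j) := reals s (v (Res d)) (i * n + j))"
    using vars by (simp add: pair_cell_def)
qed (use sz x in \<open>auto simp: sized_def pair_cell_def\<close>)

lemma runs_loads:
  assumes sz: "sized n k \<sigma>" and inp: "input_tables n k b s \<sigma>"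
  shows "runs loads \<sigma> (6 * (9 + n * (21 + 112 * k))) (\<lambda>\<sigma>'. stored n k b s snd Val \<sigma>' \<and>
    stored n k b s (\<lambda>_ _. 1) Present \<sigma>' \<and> stored n k b s snd Pay \<sigma>')"
  unfolding loads_def Let_def
proof (rule runs_Seq[OF runs_load_both[OF sz inp, where g = snd]])
  let ?post = "\<lambda>\<sigma>'. stored n k b s snd Val \<sigma>' \<and>
    stored n k b s (\<lambda>_ _. 1) Present \<sigma>' \<and> stored n k b s snd Pay \<sigma>'"
  let ?T = "9 + n * (21 + 112 * k)"
  let ?r = "RRead ''reserve_price'' (cell (rd VarI))" and ?m = "RRead ''max_price'' (cell (rd VarI))"
  fix \<sigma>1 assume S1: "stored n k b s snd Val \<sigma>1" and ag: "agree_off (load_both Val ?r ?m) \<sigma> \<sigma>1"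
  note eq1 = agree_off_nats[OF ag] agree_off_reals[OF ag]
  have sz1: "sized n k \<sigma>1" using sz by (simp add: sized_def eq1)
  have inp1: "input_tables n k b s \<sigma>1" using inp by (simp add: input_tables_def holds_traders_def eq1)
  show "runs (Seq (load_both Present ROne ROne) (load_both Pay ?r ?m)) \<sigma>1 (4 * ?T) ?post"
  proof (rule runs_Seq[OF runs_load_both[OF sz1 inp1, where g = "\<lambda>_ _. 1"]])
    fix \<sigma>2 assume S2: "stored n k b s (\<lambda>_ _. 1) Present \<sigma>2" and ag: "agree_off (load_both Present ROne ROne) \<sigma>1 \<sigma>2"
    note eq2 = agree_off_nats[OF ag] agree_off_reals[OF ag]
    have sz2: "sized n k \<sigma>2" using sz1 by (simp add: sized_def eq2)
    have inp2: "input_tables n k b s \<sigma>2" using inp1 by (simp add: input_tables_def holds_traders_def eq2)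
    show "runs (load_both Pay ?r ?m) \<sigma>2 (2 * ?T) ?post"
    proof (rule runs_conseq[OF runs_load_both[OF sz2 inp2, where g = snd]])
      fix \<sigma>3 assume S3: "stored n k b s snd Pay \<sigma>3" and ag: "agree_off (load_both Pay ?r ?m) \<sigma>2 \<sigma>3"
      note eq3 = agree_off_nats[OF ag] agree_off_reals[OF ag]
      show "?post \<sigma>3"
        using S1 S2 S3 by (simp add: stored_def eq3 eq2)
    qed auto
  qed auto
qed auto

text \<open>A commodity that one of the two does not trade has weight 0 there, so its term vanishes
  however its default key 0 compares. What remains are the commodities of both that satisfy the
  price condition.\<close>

lemma dominance_eq_sum_transactions:
  assumes inst: "buyer_seller_instance n k b s" and ij: "i < n" "j < n"
    and st: "stored n k b s snd Val \<sigma>" "stored n k b s f wb \<sigma>" "stored n k b s g ws \<sigma>"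
  shows "dominance n k ws wb \<sigma> i j = (\<Sum>l\<in>transaction_set (b i) (s j). f (b i) l * g (s j) l)"
proof -
  have sub: "transaction_set (b i) (s j) \<subseteq> {..<k}"
    using inst ij by (auto simp: buyer_seller_instance_def trader_on_def transaction_set_def)
  have "dominance n k ws wb \<sigma> i j =
      (\<Sum>l<k. if l \<in> transaction_set (b i) (s j) then f (b i) l * g (s j) l else 0)"
    unfolding dominance_def
    by (rule sum.cong)
      (use st ij in \<open>auto simp: stored_def weight_def valuation_def transaction_set_def\<close>)
  also have "\<dots> = (\<Sum>l\<in>{..<k} \<inter> transaction_set (b i) (s j). f (b i) l * g (s j) l)"
    by (simp add: sum.inter_restrict)
  also have "{..<k} \<inter> transaction_set (b i) (s j) = transaction_set (b i) (s j)" using sub by auto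
  finally show ?thesis .
qed

lemma notin_nwrites_search:
  "x \<notin> nwrites (phase ws wb d) \<Longrightarrow> x \<notin> {v Fuel, v Done, v Width, v Budget} \<Longrightarrow> x \<notin> nwrites (search ws wb d)"
  using writes_search(1) by blast

definition search_cost :: nat where
  "search_cost = attempt_cost Present Present 0 + attempt_cost Present Pay 1 + attempt_cost Pay Present 2"

lemma runs_searches:
  assumes mm: "multiplies_within mm M" and sz: "sized n k \<sigma>"
    and Mu: "n * n \<le> nat \<lfloor>M n k\<rfloor>" "n * k \<le> nat \<lfloor>M n k\<rfloor>"
    and Z: "\<And>w. k * w * w < 3 * nat \<lfloor>M n k\<rfloor> \<Longrightarrow> w \<le> Z"
  shows "runs searches \<sigma> (60 + search_cost * (n * k * (4 * Z + 4))) (\<lambda>\<sigma>'. sized n k \<sigma>' \<and> (\<forall>i<n. \<forall>j<n.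
     reals \<sigma>' (v (Res 0)) (i * n + j) = dominance n k Present Present \<sigma> i j \<and>
     reals \<sigma>' (v (Res 1)) (i * n + j) = dominance n k Present Pay \<sigma> i j \<and>
     reals \<sigma>' (v (Res 2)) (i * n + j) = dominance n k Pay Present \<sigma> i j))"
proof -
  let ?Y = "n * k * (4 * Z + 4)"
  let ?post = "\<lambda>\<sigma>'. sized n k \<sigma>' \<and> (\<forall>i<n. \<forall>j<n.
     reals \<sigma>' (v (Res 0)) (i * n + j) = dominance n k Present Present \<sigma> i j \<and>
     reals \<sigma>' (v (Res 1)) (i * n + j) = dominance n k Present Pay \<sigma> i j \<and>
     reals \<sigma>' (v (Res 2)) (i * n + j) = dominance n k Pay Present \<sigma> i j)"
  \<comment> \<open>A search writes no input table and no result array but its own, so all three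
    results can be expressed through the initial state.\<close>
  have step: "sized n k \<tau>' \<and> (\<forall>ws wb i j. ws \<in> {Present, Pay} \<longrightarrow> wb \<in> {Present, Pay} \<longrightarrow>
      dominance n k ws wb \<tau>' i j = dominance n k ws wb \<tau> i j) \<and>
      (\<forall>d'. d' \<noteq> d \<longrightarrow> reals \<tau>' (v (Res d')) = reals \<tau> (v (Res d')))"
    if "sized n k \<tau>" and ag: "agree_off (search ws wb d) \<tau> \<tau>'" for ws wb d \<tau> \<tau>'
  proof (intro conjI allI impI)
    have "nats \<tau>' (v x) = nats \<tau> (v x)" if "x \<in> {Buyers, Commodities, Traders, TimesK, TimesN}" for x
      using that by (intro agree_off_nats[OF ag] notin_nwrites_search) auto
    with \<open>sized n k \<tau>\<close> show "sized n k \<tau>'" by (simp add: sized_def)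
    have re: "reals \<tau>' (v x) = reals \<tau> (v x)" if "x \<in> {Val, Present, Pay}" for x
      using that by (intro agree_off_reals[OF ag]) (auto simp: writes_search(2))
    show "dominance n k ws wb \<tau>' i j = dominance n k ws wb \<tau> i j"
      if "ws \<in> {Present, Pay}" "wb \<in> {Present, Pay}" for ws wb i j
      using that re by (intro dominance_cong) auto
    show "reals \<tau>' (v (Res d')) = reals \<tau> (v (Res d'))" if "d' \<noteq> d" for d'
      using that by (intro agree_off_reals[OF ag]) (auto simp: writes_search(2))
  qed
  show ?thesis unfolding searches_def
  proof (rule runs_Seq[OF runs_search[OF mm sz Mu Z]])
    fix \<sigma>1 assume P1: "\<forall>i<n. \<forall>j<n. reals \<sigma>1 (v (Res 0)) (i * n + j) = dominance n k Present Present \<sigma> i j"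
      and ag1: "agree_off (search Present Present 0) \<sigma> \<sigma>1"
    note step1 = step[OF sz ag1]
    have sz1: "sized n k \<sigma>1" using step1 by simp
    show "runs (Seq (search Present Pay 1) (search Pay Present 2)) \<sigma>1
      (40 + attempt_cost Present Pay 1 * ?Y + attempt_cost Pay Present 2 * ?Y) ?post"
    proof (rule runs_Seq[OF runs_search[OF mm sz1 Mu Z]])
      fix \<sigma>2 assume P2: "\<forall>i<n. \<forall>j<n. reals \<sigma>2 (v (Res 1)) (i * n + j) = dominance n k Present Pay \<sigma>1 i j"
        and ag2: "agree_off (search Present Pay 1) \<sigma>1 \<sigma>2"
      note step2 = step[OF sz1 ag2]
      have sz2: "sized n k \<sigma>2" using step2 by simp
      show "runs (search Pay Present 2) \<sigma>2 (20 + attempt_cost Pay Present 2 * ?Y) ?post"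
      proof (rule runs_conseq[OF runs_search[OF mm sz2 Mu Z]])
        fix \<sigma>3 assume P3: "\<forall>i<n. \<forall>j<n. reals \<sigma>3 (v (Res 2)) (i * n + j) = dominance n k Pay Present \<sigma>2 i j"
          and ag3: "agree_off (search Pay Present 2) \<sigma>2 \<sigma>3"
        from P1 P2 P3 step1 step2 step[OF sz2 ag3] show "?post \<sigma>3"
          by simp
      qed auto
    qed auto
  qed (auto simp: search_cost_def add_mult_distrib)
qed

lemma runs_buyer_seller:
  assumes mm: "multiplies_within mm M" and nk: "1 \<le> n" "1 \<le> k"
    and Mu: "n * n \<le> nat \<lfloor>M n k\<rfloor>" "n * k \<le> nat \<lfloor>M n k\<rfloor>"
    and Z: "\<And>w. k * w * w < 3 * nat \<lfloor>M n k\<rfloor> \<Longrightarrow> w \<le> Z"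
    and inst: "buyer_seller_instance n k b s" and inp: "holds_sizes \<sigma> n k" "input_tables n k b s \<sigma>"
  shows "runs buyer_seller \<sigma> (2000 * (n * n) + 2000 * (n * k) + search_cost * (n * k * (4 * Z + 4))) (\<lambda>\<sigma>'.
    holds_matrix \<sigma>' ''C'' (map_mat real (transaction_matrix n b s)) \<and>
    holds_matrix \<sigma>' ''P'' (price_matrix n b s) \<and> holds_matrix \<sigma>' ''R'' (reserve_matrix n b s))"
proof -
  let ?S = "search_cost * (n * k * (4 * Z + 4))" and ?U = "9 + n * (21 + 112 * n)"
  let ?out = "Seq (copy_out 0 ''C'') (Seq (copy_out 1 ''P'') (copy_out 2 ''R''))"
  let ?post = "\<lambda>\<sigma>'. holds_matrix \<sigma>' ''C'' (map_mat real (transaction_matrix n b s)) \<and>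
    holds_matrix \<sigma>' ''P'' (price_matrix n b s) \<and> holds_matrix \<sigma>' ''R'' (reserve_matrix n b s)"
  show ?thesis unfolding buyer_seller_def
  proof (rule runs_Seq[OF runs_setup_sizes[OF inp(1) nk]])
    fix \<sigma>1 assume sz1: "sized n k \<sigma>1" and ag1: "agree_off setup_sizes \<sigma> \<sigma>1"
    note eq1 = agree_off_nats[OF ag1] agree_off_reals[OF ag1]
    have inp1: "input_tables n k b s \<sigma>1" using inp(2) by (simp add: input_tables_def holds_traders_def eq1)
    show "runs (Seq loads (Seq searches ?out)) \<sigma>1 (6 * (9 + n * (21 + 112 * k)) + (60 + ?S) + 3 * ?U) ?post"
    proof (rule runs_Seq[OF runs_loads[OF sz1 inp1]])
      fix \<sigma>2 assume st: "stored n k b s snd Val \<sigma>2 \<and> stored n k b s (\<lambda>_ _. 1) Present \<sigma>2 \<and> stored n k b s snd Pay \<sigma>2"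
        and ag2: "agree_off loads \<sigma>1 \<sigma>2"
      have sz2: "sized n k \<sigma>2" using sz1 by (simp add: sized_def agree_off_nats[OF ag2])
      show "runs (Seq searches ?out) \<sigma>2 ((60 + ?S) + 3 * ?U) ?post"
      proof (rule runs_Seq[OF runs_searches[OF mm sz2 Mu Z]])
        fix \<sigma>3 assume P3: "sized n k \<sigma>3 \<and> (\<forall>i<n. \<forall>j<n.
          reals \<sigma>3 (v (Res 0)) (i * n + j) = dominance n k Present Present \<sigma>2 i j \<and>
          reals \<sigma>3 (v (Res 1)) (i * n + j) = dominance n k Present Pay \<sigma>2 i j \<and>
          reals \<sigma>3 (v (Res 2)) (i * n + j) = dominance n k Pay Present \<sigma>2 i j)"
        then have sz3: "sized n k \<sigma>3" by simp
        have D: "reals \<sigma>3 (v (Res 0)) (i * n + j) = (\<Sum>l\<in>transaction_set (b i) (s j). 1)"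
          "reals \<sigma>3 (v (Res 1)) (i * n + j) = (\<Sum>l\<in>transaction_set (b i) (s j). snd (b i) l)"
          "reals \<sigma>3 (v (Res 2)) (i * n + j) = (\<Sum>l\<in>transaction_set (b i) (s j). snd (s j) l)"
          if ij: "i < n" "j < n" for i j
          using P3 ij st dominance_eq_sum_transactions[OF inst ij, of \<sigma>2 "\<lambda>_ _. 1" Present "\<lambda>_ _. 1" Present]
            dominance_eq_sum_transactions[OF inst ij, of \<sigma>2 snd Pay "\<lambda>_ _. 1" Present]
            dominance_eq_sum_transactions[OF inst ij, of \<sigma>2 "\<lambda>_ _. 1" Present snd Pay] by simp_all
        show "runs ?out \<sigma>3 (3 * ?U) ?post"
        proof (rule runs_Seq[OF runs_copy_out[OF sz3]])
          fix \<sigma>4 assume P4: "\<forall>i<n. \<forall>j<n. reals \<sigma>4 ''C'' (i * n + j) = reals \<sigma>3 (v (Res 0)) (i * n + j)"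
            and ag4: "agree_off (copy_out 0 ''C'') \<sigma>3 \<sigma>4"
          note eq4 = agree_off_nats[OF ag4] agree_off_reals[OF ag4]
          have sz4: "sized n k \<sigma>4" using sz3 by (simp add: sized_def eq4)
          show "runs (Seq (copy_out 1 ''P'') (copy_out 2 ''R'')) \<sigma>4 (2 * ?U) ?post"
          proof (rule runs_Seq[OF runs_copy_out[OF sz4]])
            fix \<sigma>5 assume P5: "\<forall>i<n. \<forall>j<n. reals \<sigma>5 ''P'' (i * n + j) = reals \<sigma>4 (v (Res 1)) (i * n + j)"
              and ag5: "agree_off (copy_out 1 ''P'') \<sigma>4 \<sigma>5"
            note eq5 = agree_off_nats[OF ag5] agree_off_reals[OF ag5]
            have sz5: "sized n k \<sigma>5" using sz4 by (simp add: sized_def eq5)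
            show "runs (copy_out 2 ''R'') \<sigma>5 ?U ?post"
            proof (rule runs_conseq[OF runs_copy_out[OF sz5]])
              fix \<sigma>6 assume P6: "\<forall>i<n. \<forall>j<n. reals \<sigma>6 ''R'' (i * n + j) = reals \<sigma>5 (v (Res 2)) (i * n + j)"
                and ag6: "agree_off (copy_out 2 ''R'') \<sigma>5 \<sigma>6"
              note eq6 = agree_off_reals[OF ag6]
              show "?post \<sigma>6"
                using P4 P5 P6 D
                by (simp add: eq6 eq5 eq4 holds_matrix_def transaction_matrix_def price_matrix_def reserve_matrix_def)
            qed auto
          qed auto
        qed auto
      qed auto
    qed auto
  next
    define A B S where "A = n * n" and "B = n * k" and "S = ?S"
    have "1 * 1 \<le> A" "n * 1 \<le> A" "1 * k \<le> B"
      unfolding A_def B_def using nk by (intro mult_le_mono; simp)+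
    moreover have "n * (21 + 112 * k) = 21 * n + 112 * B" "n * (21 + 112 * n) = 21 * n + 112 * A"
      by (simp_all add: A_def B_def algebra_simps)
    ultimately show "200 + 150 * n + 50 * k + (6 * (9 + n * (21 + 112 * k)) + (60 + ?S) + 3 * ?U)
        \<le> 2000 * (n * n) + 2000 * (n * k) + ?S"
      unfolding A_def[symmetric] B_def[symmetric] S_def[symmetric] by simp
  qed
qed

end

section \<open>Fresh names and the final estimate\<close>

instance var :: countable
  by countable_datatype

text \<open>Distinct variables get words of distinct lengths, all longer than any word in
  \<open>F\<close>.\<close>

lemma ex_fresh_naming:
  fixes F :: "name set"
  assumes "finite F"
  shows "\<exists>v :: var \<Rightarrow> name. (\<forall>x y. v x = v y \<longleftrightarrow> x = y) \<and> (\<forall>x. v x \<notin> F)"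
proof -
  define m where "m = Suc (\<Sum>y\<in>F. length y)"
  define v :: "var \<Rightarrow> name" where "v = (\<lambda>x. replicate (m + to_nat x) (CHR ''x''))"
  have "length y < m" if "y \<in> F" for y
    using member_le_sum[OF that, of length] assms by (simp add: m_def)
  then have "v x \<notin> F" for x by (force simp: v_def)
  moreover have "v x = v y \<longleftrightarrow> x = y" for x y by (simp add: v_def)
  ultimately show ?thesis by blast
qed

text \<open>The principal filter asks for one constant valid at all sizes
  \<open>n, k \<ge> 1\<close>. The program is built from \<open>mm\<close> alone; the bound
  \<open>M\<close> enters only the analysis.\<close>

theorem theorem2p4:
  fixes mm :: com and M :: "nat \<Rightarrow> nat \<Rightarrow> real"
  assumes "multiplies_within mm M"
  shows "\<exists>bs T. determines_transactions_within bs T \<and>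
    (\<lambda>(n, k). T n k) \<in> O[principal {(n, k). 1 \<le> n \<and> 1 \<le> k}](\<lambda>(n, k). real n * sqrt (real k * M n k))"
proof -
  obtain v :: "var \<Rightarrow> name" where v: "\<And>x y. v x = v y \<longleftrightarrow> x = y"
    "\<And>x. v x \<notin> com_names mm \<union> rwrites mm \<union> io_names"
    using ex_fresh_naming[of "com_names mm \<union> rwrites mm \<union> io_names"] by (auto simp: io_names_def)
  interpret fresh_names v mm
    by unfold_locales (use v in auto)
  \<comment> \<open>With \<open>Q = n * sqrt (k * M n k)\<close>, the 4000 covers
    \<open>n * n\<close> and \<open>n * k\<close>, each at most \<open>Q\<close> with factor 2000;
    the 12 comes from \<open>4 * Z + 4\<close>, as \<open>n * k * Z \<le> 2 * Q\<close> and
    \<open>n * k \<le> Q\<close>.\<close>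
  define K :: real where "K = 4000 + 12 * real search_cost"
  define T where "T = (\<lambda>n k. K * (real n * sqrt (real k * M n k)))"
  have "determines_transactions_within buyer_seller T"
    unfolding determines_transactions_within_def
  proof (intro allI impI)
    fix n k :: nat and b s \<sigma>
    assume n: "1 \<le> n" and k: "1 \<le> k" and inp: "buyer_seller_instance n k b s \<and> holds_sizes \<sigma> n k \<and>
        holds_traders \<sigma> ''buyer_goods'' ''max_price'' n k b \<and>
        holds_traders \<sigma> ''seller_goods'' ''reserve_price'' n k s"
    define \<mu> where "\<mu> = nat \<lfloor>M n k\<rfloor>"
    have M: "real (n * n) \<le> M n k" "real (n * k) \<le> M n k"
      using multiplies_within_output_bound[OF assms n k] multiplies_within_input_bound[OF assms n k] .
    then have \<mu>: "n * n \<le> \<mu>" "n * k \<le> \<mu>" unfolding \<mu>_def by linarith+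
    have "0 \<le> M n k" using M(1) by (rule order_trans[rotated]) simp
    then have \<mu>M: "real \<mu> \<le> M n k" by (simp add: \<mu>_def)
    define Q where "Q = real n * sqrt (real k * M n k)"
    \<comment> \<open>The largest width with \<open>k * w * w \<le> 3 * M n k\<close>; beyond it
      every round succeeds.\<close>
    define Z where "Z = nat \<lfloor>sqrt (3 * M n k / k)\<rfloor>"
    have "w \<le> Z" if "k * w * w < 3 * \<mu>" for w
    proof -
      have "real (k * w * w) \<le> 3 * M n k"
      proof -
        have "real (k * w * w) \<le> real (3 * \<mu>)" using that by (simp only: of_nat_le_iff less_imp_le)
        then show ?thesis using \<mu>M by linarith
      qed
      then have "(real w)\<^sup>2 \<le> 3 * M n k / k" using k by (simp add: field_simps power2_eq_square)
      then have "real w \<le> sqrt (3 * M n k / k)" by (rule real_le_rsqrt)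
      then show ?thesis unfolding Z_def by linarith
    qed
    then have "runs buyer_seller \<sigma> (2000 * (n * n) + 2000 * (n * k) + search_cost * (n * k * (4 * Z + 4))) (\<lambda>\<sigma>'.
      holds_matrix \<sigma>' ''C'' (map_mat real (transaction_matrix n b s)) \<and>
      holds_matrix \<sigma>' ''P'' (price_matrix n b s) \<and> holds_matrix \<sigma>' ''R'' (reserve_matrix n b s))"
      using inp \<mu> unfolding \<mu>_def
      by (intro runs_buyer_seller[OF assms n k]) (auto simp: input_tables_def)
    moreover have "real (2000 * (n * n) + 2000 * (n * k) + search_cost * (n * k * (4 * Z + 4))) \<le> T n k"
    proof -
      have "k \<le> n * k" using n by (cases n) auto
      then have "real k \<le> real (n * k)" by (simp only: of_nat_le_iff)
      \<comment> \<open>The input bound gives \<open>k \<le> M n k\<close> as well, and this is what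
        brings \<open>n * k\<close> below \<open>Q\<close>.\<close>
      then have kM: "real k \<le> M n k" using M(2) by linarith
      have "real (n * n) \<le> Q"
      proof -
        have "(real n)\<^sup>2 \<le> M n k" using M(1) by (simp add: power2_eq_square)
        also have "\<dots> \<le> real k * M n k" using k \<open>0 \<le> M n k\<close> mult_right_mono[of 1 "real k" "M n k"] by simp
        finally have "real n \<le> sqrt (real k * M n k)" by (rule real_le_rsqrt)
        then show ?thesis unfolding Q_def of_nat_mult by (rule mult_left_mono) simp
      qed
      moreover have "real (n * k) \<le> Q"
      proof -
        have "(real k)\<^sup>2 \<le> real k * M n k" unfolding power2_eq_square using kM by (rule mult_left_mono) simp
        then have "real k \<le> sqrt (real k * M n k)" by (rule real_le_rsqrt)
        then show ?thesis unfolding Q_def of_nat_mult by (rule mult_left_mono) simp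
      qed
      moreover have "real (n * k * Z) \<le> 2 * Q"
      proof -
        have "real Z \<le> sqrt (3 * M n k / k)" unfolding Z_def using \<open>0 \<le> M n k\<close> by simp
        \<comment> \<open>Raising 3 to 4 puts a square under the root.\<close>
        also have "\<dots> \<le> sqrt (4 * M n k / k)" using \<open>0 \<le> M n k\<close> by (intro real_sqrt_le_mono divide_right_mono) auto
        finally have "real k * real Z \<le> real k * sqrt (4 * M n k / k)" by (rule mult_left_mono) simp
        also have "\<dots> = sqrt ((real k)\<^sup>2 * (4 * M n k / k))" by (simp only: real_sqrt_mult real_sqrt_abs abs_of_nat)
        also have "(real k)\<^sup>2 * (4 * M n k / k) = 2\<^sup>2 * (real k * M n k)" using k by (simp add: power2_eq_square)
        also have "sqrt \<dots> = 2 * sqrt (real k * M n k)" by (simp only: real_sqrt_mult real_sqrt_abs abs_numeral)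
        finally have "real n * (real k * real Z) \<le> real n * (2 * sqrt (real k * M n k))"
          by (rule mult_left_mono) simp
        then show ?thesis by (simp add: Q_def mult_ac)
      qed
      ultimately have "real search_cost * (4 * real (n * k * Z) + 4 * real (n * k)) \<le> real search_cost * (12 * Q)"
        and "2000 * real (n * n) + 2000 * real (n * k) \<le> 4000 * Q"
        by (auto intro!: mult_left_mono)
      moreover have "T n k = 4000 * Q + real search_cost * (12 * Q)"
        by (simp add: T_def K_def Q_def algebra_simps)
      moreover have "real (2000 * (n * n) + 2000 * (n * k) + search_cost * (n * k * (4 * Z + 4))) =
        2000 * real (n * n) + 2000 * real (n * k) + real search_cost * (4 * real (n * k * Z) + 4 * real (n * k))"
        by (simp add: algebra_simps)
      ultimately show ?thesis by linarith
    qed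
    ultimately show "\<exists>t \<sigma>'. exec buyer_seller \<sigma> t \<sigma>' \<and> real t \<le> T n k \<and>
      holds_matrix \<sigma>' ''C'' (map_mat real (transaction_matrix n b s)) \<and>
      holds_matrix \<sigma>' ''P'' (price_matrix n b s) \<and> holds_matrix \<sigma>' ''R'' (reserve_matrix n b s)"
      unfolding runs_def by (meson of_nat_le_iff order_trans)
  qed
  moreover have "(\<lambda>(n, k). T n k) \<in> O[principal {(n, k). 1 \<le> n \<and> 1 \<le> k}](\<lambda>(n, k). real n * sqrt (real k * M n k))"
    by (rule bigoI[where c = "\<bar>K\<bar>"]) (auto simp: T_def eventually_principal abs_mult)
  ultimately show ?thesis by blast
qed

end
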